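(* Let $f$ be a transcendental meromorphic function and $g$ be an entire function such that $\rho_g(m,n)<\lambda_f(p,q)\le\rho_f(p,q)<\infty$, where $p,q,m,n$ are positive integers with $p\ge q$ and $m\ge n$. Let $F=f^{\alpha}Q[f]$, where $Q[f]$ is a differential polynomial in $f$. Then for any integer $\alpha\ge 1$: (i) if $q\ge m$, $$\lim_{r\to\infty}\frac{\log^{[p-1]}T_{f\circ g}\left(\exp^{[n-1]}r\right)}{\log^{[p-2]}T_F\left(\exp^{[q-1]}r\right)}=0;$$ (ii) if $q<m$, $$\lim_{r\to\infty}\frac{\log^{[p+m-q-2]}T_{f\circ g}\left(\exp^{[n-1]}r\right)}{\log^{[p-2]}T_F\left(\exp^{[q-1]}r\right)}=0.$$
   Context: All functions are defined on the complex plane $\mathbb{C}$. Iterated exponentials and logarithms: $\exp^{[0]}x=\log^{[0]}x=x$, and for positive integers $k$, $\exp^{[k]}x=\exp(\exp^{[k-1]}x)$, $\log^{[k]}x=\log(\log^{[k-1]}x)$ (for $x$ large enough that this is defined); also $\log^{[-1]}x=\exp x$. $T_h(r)$ is the Nevanlinna characteristic function of a meromorphic function $h$, and $M_g(r)=\max_{|z|=r}|g(z)|$ for an entire function $g$. For positive integers $p\ge q$, the $(p,q)$-th order and $(p,q)$-th lower order of an entire function $g$ are $$\rho_g(p,q)=\limsup_{r\to\infty}\frac{\log^{[p]}M_g(r)}{\log^{[q]}r},\qquad \lambda_g(p,q)=\liminf_{r\to\infty}\frac{\log^{[p]}M_g(r)}{\log^{[q]}r},$$ and those of a meromorphic function $f$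 are $$\rho_f(p,q)=\limsup_{r\to\infty}\frac{\log^{[p-1]}T_f(r)}{\log^{[q]}r},\qquad \lambda_f(p,q)=\liminf_{r\to\infty}\frac{\log^{[p-1]}T_f(r)}{\log^{[q]}r}.$$ A monomial generated by a transcendental meromorphic function $f$ is an expression $M[f]=f^{n_0}(f^{(1)})^{n_1}\cdots(f^{(k)})^{n_k}$ with non-negative integers $n_0,\dots,n_k$. A differential polynomial generated by (in) $f$ is an expression $Q[f]=a_1M_1[f]+\cdots+a_sM_s[f]$, where $M_1[f],\dots,M_s[f]$ are monomials in $f$ and $a_1,\dots,a_s$ are nonzero constants. *)

theory Defs
  imports "HOL-Complex_Analysis.Complex_Analysis"
begin

text \<open>
  Meromorphic functions on the plane are rendered by the library predicate
  \<open>f meromorphic_on UNIV\<close>, which leaves the values of \<open>f\<close> unconstrained on a sparse set (such as the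
  poles).  Every notion below that is applied to a meromorphic function is insensitive to changes of
  the function on a sparse set.
\<close>

definition transcendental_meromorphic :: "(complex \<Rightarrow> complex) \<Rightarrow> bool" where
  "transcendental_meromorphic f \<longleftrightarrow>
     f meromorphic_on UNIV \<and>
     \<not> (\<exists>P Q :: complex poly. Q \<noteq> 0 \<and>
          eventually (\<lambda>z. f z = poly P z / poly Q z) (cosparse UNIV))"

text \<open>
  \<open>iter_log k\<close> is \<open>log\<^sup>[\<^sup>k\<^sup>]\<close>; the index is an integer because \<open>log\<^sup>[\<^sup>-\<^sup>1\<^sup>] = exp\<close> is needed.
  Where the iterated logarithm is undefined the values are those dictated by the totality of \<open>ln\<close>.
\<close>

definition iter_exp :: "nat \<Rightarrow> real \<Rightarrow> real" where
  "iter_exp k = exp ^^ k"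

definition iter_log :: "int \<Rightarrow> real \<Rightarrow> real" where
  "iter_log k = (if 0 \<le> k then ln ^^ nat k else exp ^^ nat (- k))"

definition log_plus :: "real \<Rightarrow> real" where
  "log_plus x = (if x \<le> 1 then 0 else ln x)"

definition pole_count :: "(complex \<Rightarrow> complex) \<Rightarrow> real \<Rightarrow> real" where
  "pole_count h r = (\<Sum>z | is_pole h z \<and> norm z \<le> r. real_of_int (- zorder h z))"

definition nevanlinna_N :: "(complex \<Rightarrow> complex) \<Rightarrow> real \<Rightarrow> real" where
  "nevanlinna_N h r =
     integral {0..r} (\<lambda>t. (pole_count h t - pole_count h 0) / t) + pole_count h 0 * ln r"

definition nevanlinna_m :: "(complex \<Rightarrow> complex) \<Rightarrow> real \<Rightarrow> real" where
  "nevanlinna_m h r =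
     integral {0..2 * pi} (\<lambda>\<theta>. log_plus (norm (h (complex_of_real r * cis \<theta>)))) / (2 * pi)"

definition nevanlinna_T :: "(complex \<Rightarrow> complex) \<Rightarrow> real \<Rightarrow> real" where
  "nevanlinna_T h r = nevanlinna_m h r + nevanlinna_N h r"

definition max_modulus :: "(complex \<Rightarrow> complex) \<Rightarrow> real \<Rightarrow> real" where
  "max_modulus g r = (SUP z\<in>sphere 0 r. norm (g z))"

definition entire_order :: "nat \<Rightarrow> nat \<Rightarrow> (complex \<Rightarrow> complex) \<Rightarrow> ereal" where
  "entire_order p q g =
     Limsup at_top (\<lambda>r. ereal (iter_log (int p) (max_modulus g r) / iter_log (int q) r))"

definition mero_order :: "nat \<Rightarrow> nat \<Rightarrow> (complex \<Rightarrow> complex) \<Rightarrow> ereal" where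
  "mero_order p q f =
     Limsup at_top (\<lambda>r. ereal (iter_log (int p - 1) (nevanlinna_T f r) / iter_log (int q) r))"

definition mero_lower_order :: "nat \<Rightarrow> nat \<Rightarrow> (complex \<Rightarrow> complex) \<Rightarrow> ereal" where
  "mero_lower_order p q f =
     Liminf at_top (\<lambda>r. ereal (iter_log (int p - 1) (nevanlinna_T f r) / iter_log (int q) r))"

definition diff_monomial :: "(complex \<Rightarrow> complex) \<Rightarrow> (complex \<Rightarrow> complex) \<Rightarrow> bool" where
  "diff_monomial f M \<longleftrightarrow>
     (\<exists>(k::nat) (n :: nat \<Rightarrow> nat). M = (\<lambda>z. \<Prod>i\<le>k. ((deriv ^^ i) f z) ^ n i))"

definition diff_polynomial :: "(complex \<Rightarrow> complex) \<Rightarrow> (complex \<Rightarrow> complex) \<Rightarrow> bool" where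
  "diff_polynomial f Q \<longleftrightarrow>
     (\<exists>(s::nat) (a :: nat \<Rightarrow> complex) (M :: nat \<Rightarrow> complex \<Rightarrow> complex).
        1 \<le> s \<and> (\<forall>j\<in>{1..s}. a j \<noteq> 0 \<and> diff_monomial f (M j)) \<and>
        Q = (\<lambda>z. \<Sum>j=1..s. a j * M j z))"

end

theory Submission
  imports Defs
begin

text \<open>
  Jensen's formula gives the first main theorem. Near a disc of radius \<open>R\<close> write \<open>f = e\<^sup>u \<Prod>(z - a)\<^sup>k\<close> over the
  zeros and poles \<open>a\<close> in the disc; the number of these and the mean of \<open>\<bar>Re u\<bar>\<close> on the circle are bounded in
  terms of \<open>T\<^sub>f(R)\<close> and \<open>T\<^sub>f(R\<^sup>2)\<close>, and Schwarz' formula then bounds \<open>Re u\<close> and \<open>u'\<close> inside. This representation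
  yields the lemma on the logarithmic derivative, the estimate \<open>T\<^sub>f\<^sub>\<circ>\<^sub>g(r) = O(T\<^sub>f(R) + T\<^sub>f(R\<^sup>2))\<close> with
  \<open>R = 2 M\<^sub>g(r)\<close>, and \<open>T\<^sub>f(r) / ln r \<rightarrow> \<infinity>\<close> for transcendental \<open>f\<close>; the squares and constants do not matter
  on the logarithmic scales of the statement.

  Either \<open>F\<close> vanishes identically, and the quotients are zero since \<open>ln 0 = 0\<close> and \<open>x / 0 = 0\<close>, or
  \<open>T\<^sub>f \<le> 2 T\<^sub>F\<close> eventually, because \<open>T(r, 1/f) \<le> T(r, 1/F) + o(T\<^sub>f(r))\<close>. The growth of \<open>T\<^sub>f\<close> rules out
  \<open>p = 1\<close>. For \<open>p \<ge> 2\<close> the denominator is at least a constant times \<open>r powr c'\<close>, and the numerator is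
  \<open>O(ln r)\<close> in case (i) and \<open>O(r powr c)\<close> in case (ii), where \<open>\<rho>\<^sub>g(m,n) < c < c' < \<lambda>\<^sub>f(p,q)\<close>.
\<close>

section \<open>Means over circles\<close>

text \<open>The square in T(R^2) comes from counting: with outer radius R1, a zero or pole in the
  disc of radius R has weight at least ln (R1/R), and R1 = R^2 turns this into ln R. So n(R) ln R,
  the size of the total contribution of the means of |ln |z - a||, is bounded without any
  exceptional set of radii. The price is that the lemma on the logarithmic derivative has an error
  of the size of log T at about r^2 instead of log T(r). This error is o(T(r)) because log^[p-1] T_f
  lies between two positive multiples of log^[q] r: raising r to a power changes log^[q] r by a
  bounded factor only, while removing one logarithm from log^[p-1] T_f gains an exponential. The
  lower multiple is positive because the order of g cannot be negative. A constant g is treated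
  apart, since composition with it does not respect sparse exceptional sets.\<close>

definition cint :: "(complex \<Rightarrow> real) \<Rightarrow> real \<Rightarrow> bool" where
  "cint \<phi> r \<longleftrightarrow> (\<lambda>\<theta>. \<phi> (complex_of_real r * cis \<theta>)) absolutely_integrable_on {0..2*pi}"

definition cmean :: "(complex \<Rightarrow> real) \<Rightarrow> real \<Rightarrow> real" where
  "cmean \<phi> r = integral {0..2*pi} (\<lambda>\<theta>. \<phi> (complex_of_real r * cis \<theta>)) / (2*pi)"

lemma finite_cis_preimage:
  assumes "r > 0" "finite B"
  shows "finite {\<theta>\<in>{0..2*pi}. complex_of_real r * cis \<theta> \<in> B}"
proof -
  \<comment> \<open>\<open>Arg2pi\<close> takes values in [0, 2 pi), so the endpoint 2 pi is a
    second angle of the same point.\<close>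
  have "{\<theta>\<in>{0..2*pi}. complex_of_real r * cis \<theta> \<in> B} \<subseteq> insert (2*pi) (Arg2pi ` B)"
  proof
    fix \<theta> assume \<theta>: "\<theta> \<in> {\<theta>\<in>{0..2*pi}. complex_of_real r * cis \<theta> \<in> B}"
    show "\<theta> \<in> insert (2*pi) (Arg2pi ` B)"
    proof (cases "\<theta> = 2*pi")
      case False
      then have "Arg2pi (complex_of_real r * cis \<theta>) = \<theta>"
        using \<theta> assms(1) by (intro Arg2pi_unique[of r]) (auto simp: cis_conv_exp)
      then show ?thesis using \<theta> by force
    qed simp
  qed
  then show ?thesis by (rule finite_subset) (use assms in simp)
qed

text \<open>Meromorphic functions are controlled only off a sparse set, which meets a circle in
  finitely many points; these correspond to finitely many, hence negligible, angles.\<close>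

lemma cint_cong:
  assumes "r > 0" "finite B" "\<And>z. norm z = r \<Longrightarrow> z \<notin> B \<Longrightarrow> \<phi> z = \<psi> z"
  shows "cint \<phi> r \<longleftrightarrow> cint \<psi> r" "cmean \<phi> r = cmean \<psi> r"
proof -
  let ?S = "{\<theta>\<in>{0..2*pi}. complex_of_real r * cis \<theta> \<in> B}"
  have neg: "negligible ?S" by (rule negligible_finite[OF finite_cis_preimage[OF assms(1,2)]])
  have eq: "\<phi> (complex_of_real r * cis x) = \<psi> (complex_of_real r * cis x)" if "x \<in> {0..2*pi} - ?S" for x
    using that assms by (intro assms(3)) (auto simp: norm_mult)
  show "cint \<phi> r \<longleftrightarrow> cint \<psi> r" unfolding cint_def
    using absolutely_integrable_spike[OF _ neg] eq by (metis (no_types, lifting))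
  show "cmean \<phi> r = cmean \<psi> r" unfolding cmean_def
    using integral_spike[OF neg, of "{0..2*pi}" "\<lambda>x. \<psi> (complex_of_real r * cis x)" "\<lambda>x. \<phi> (complex_of_real r * cis x)"] eq by simp
qed

lemma cint_continuous:
  assumes "r \<ge> 0" "continuous_on (sphere 0 r) \<phi>"
  shows "cint \<phi> r"
  unfolding cint_def
  by (rule absolutely_integrable_continuous_real, rule continuous_on_compose2[OF assms(2)])
     (use assms in \<open>auto intro!: continuous_intros simp: norm_mult\<close>)

lemma cint_integrable: "cint \<phi> r \<Longrightarrow> (\<lambda>\<theta>. \<phi> (complex_of_real r * cis \<theta>)) integrable_on {0..2*pi}"
  unfolding cint_def using absolutely_integrable_on_def by blast

lemma cint_const [simp, intro]: "cint (\<lambda>_. c) r"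
  unfolding cint_def by (rule absolutely_integrable_continuous_real) auto

lemma cmean_const [simp]: "cmean (\<lambda>_. c) r = c"
  by (simp add: cmean_def)

lemma cint_add: "cint \<phi> r \<Longrightarrow> cint \<psi> r \<Longrightarrow> cint (\<lambda>z. \<phi> z + \<psi> z) r"
  unfolding cint_def by (rule set_integral_add)

lemma cmean_add: "cint \<phi> r \<Longrightarrow> cint \<psi> r \<Longrightarrow> cmean (\<lambda>z. \<phi> z + \<psi> z) r = cmean \<phi> r + cmean \<psi> r"
  unfolding cmean_def by (subst integral_add) (auto dest: cint_integrable simp: add_divide_distrib)

lemma cint_cmult: "cint \<phi> r \<Longrightarrow> cint (\<lambda>z. c * \<phi> z) r"
  unfolding cint_def by (rule set_integrable_mult_right) auto

lemma cmean_cmult: "cmean (\<lambda>z. c * \<phi> z) r = c * cmean \<phi> r"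
  unfolding cmean_def by simp

lemma cint_minus: "cint \<phi> r \<Longrightarrow> cint (\<lambda>z. - \<phi> z) r"
  using cint_cmult[of \<phi> r "-1"] by simp

lemma cmean_minus: "cmean (\<lambda>z. - \<phi> z) r = - cmean \<phi> r"
  using cmean_cmult[of "-1" \<phi> r] by simp

lemma cint_abs: "cint \<phi> r \<Longrightarrow> cint (\<lambda>z. \<bar>\<phi> z\<bar>) r"
  unfolding cint_def using absolutely_integrable_norm by (fastforce simp: o_def)

text \<open>This closure is why \<open>cint\<close> asks for absolute integrability:
  \<open>log_plus\<close> of a norm is the maximum of 0 and a logarithm.\<close>

lemma cint_max: "cint \<phi> r \<Longrightarrow> cint \<psi> r \<Longrightarrow> cint (\<lambda>z. max (\<phi> z) (\<psi> z)) r"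
  unfolding cint_def by (rule absolutely_integrable_max_1)

lemma cint_sum: "finite A \<Longrightarrow> (\<And>a. a \<in> A \<Longrightarrow> cint (\<phi> a) r) \<Longrightarrow> cint (\<lambda>z. \<Sum>a\<in>A. \<phi> a z) r"
  by (induction A rule: finite_induct) (auto intro!: cint_add)

lemma cmean_sum:
  "finite A \<Longrightarrow> (\<And>a. a \<in> A \<Longrightarrow> cint (\<phi> a) r) \<Longrightarrow> cmean (\<lambda>z. \<Sum>a\<in>A. \<phi> a z) r = (\<Sum>a\<in>A. cmean (\<phi> a) r)"
  by (induction A rule: finite_induct) (auto simp: cmean_add cint_sum)

lemma cmean_mono_strong:
  assumes "r > 0" "finite B" "cint \<phi> r" "cint \<psi> r" "\<And>z. norm z = r \<Longrightarrow> z \<notin> B \<Longrightarrow> \<phi> z \<le> \<psi> z"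
  shows "cmean \<phi> r \<le> cmean \<psi> r"
proof -
  have "cmean \<phi> r = cmean (\<lambda>z. if z \<in> B then \<psi> z else \<phi> z) r"
    by (rule cint_cong(2)[OF assms(1,2)]) auto
  moreover have "cint (\<lambda>z. if z \<in> B then \<psi> z else \<phi> z) r"
    using cint_cong(1)[OF assms(1,2), of \<phi> "\<lambda>z. if z \<in> B then \<psi> z else \<phi> z"] assms by simp
  moreover have "cmean (\<lambda>z. if z \<in> B then \<psi> z else \<phi> z) r \<le> cmean \<psi> r" unfolding cmean_def
    by (intro divide_right_mono integral_le cint_integrable assms calculation)
       (use assms in \<open>auto simp: norm_mult\<close>)
  ultimately show ?thesis by simp
qed

lemma cmean_nonneg: "(\<And>z. norm z = \<bar>r\<bar> \<Longrightarrow> 0 \<le> \<phi> z) \<Longrightarrow> 0 \<le> cmean \<phi> r"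
  unfolding cmean_def
  \<comment> \<open>A non-integrable function has integral 0 by convention, which is also
    nonnegative.\<close>
  by (cases "(\<lambda>\<theta>. \<phi> (complex_of_real r * cis \<theta>)) integrable_on {0..2*pi}")
     (auto simp: norm_mult not_integrable_integral intro!: divide_nonneg_nonneg integral_nonneg)

section \<open>Integrable singularities on a circle\<close>

lemma has_integral_inverse_sqrt:
  assumes "a \<le> (b::real)"
  shows "((\<lambda>x. 1 / sqrt \<bar>x - c\<bar>) has_integral
     (2 * sgn (b-c) * sqrt \<bar>b-c\<bar> - 2 * sgn (a-c) * sqrt \<bar>a-c\<bar>)) {a..b}"
proof (rule fundamental_theorem_of_calculus_interior_strong[where S="{c}"])
  \<comment> \<open>The antiderivative is continuous across c although \<open>sgn\<close> is not: it
    is a difference of two continuous square roots.\<close>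
  have sq: "sgn (x-c) * sqrt \<bar>x-c\<bar> = root 2 (max (x-c) 0) - root 2 (max (c-x) 0)" for x
    by (cases "x > c"; cases "x = c") (auto simp: sqrt_def max_def sgn_if)
  show "continuous_on {a..b} (\<lambda>x. 2 * sgn (x-c) * sqrt \<bar>x-c\<bar>)"
    unfolding mult.assoc sq by (auto intro!: continuous_intros)
  fix x assume x: "x \<in> {a<..<b} - {c}"
  show "((\<lambda>x. 2 * sgn (x-c) * sqrt \<bar>x-c\<bar>) has_vector_derivative 1 / sqrt \<bar>x - c\<bar>) (at x)"
  proof (cases "x > c")
    case True
    have "((\<lambda>x. 2 * sqrt (x-c)) has_real_derivative 1 / sqrt (x - c)) (at x)"
      using True by (auto intro!: derivative_eq_intros simp: field_simps)
    moreover have "eventually (\<lambda>x. 2 * sgn (x-c) * sqrt \<bar>x-c\<bar> = 2 * sqrt (x-c)) (nhds x)"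
      using eventually_nhds_in_open[of "{c<..}" x] True by (auto elim!: eventually_mono)
    ultimately have "((\<lambda>x. 2 * sgn (x-c) * sqrt \<bar>x-c\<bar>) has_real_derivative 1 / sqrt (x - c)) (at x)"
      by (subst DERIV_cong_ev) auto
    then show ?thesis using True by (simp add: has_real_derivative_iff_has_vector_derivative)
  next
    case False
    then have F: "x < c" using x by auto
    have "((\<lambda>x. - (2 * sqrt (c-x))) has_real_derivative 1 / sqrt (c - x)) (at x)"
      using F by (auto intro!: derivative_eq_intros simp: field_simps)
    moreover have "eventually (\<lambda>x. 2 * sgn (x-c) * sqrt \<bar>x-c\<bar> = - (2 * sqrt (c-x))) (nhds x)"
      using eventually_nhds_in_open[of "{..<c}" x] F by (auto elim!: eventually_mono)
    ultimately have "((\<lambda>x. 2 * sgn (x-c) * sqrt \<bar>x-c\<bar>) has_real_derivative 1 / sqrt (c - x)) (at x)"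
      by (subst DERIV_cong_ev) auto
    then show ?thesis using F by (simp add: has_real_derivative_iff_has_vector_derivative abs_if)
  qed
qed (use assms in auto)

text \<open>Up to pi/3 the cosine is at least 1/2, so sin y - y/2 increases; beyond, sin x >= sqrt 3
  / 2 > pi/4 >= x/2.\<close>

lemma sin_ge_half: 
  assumes "0 \<le> x" "x \<le> pi/2" shows "x/2 \<le> sin (x::real)"
proof (cases "x \<le> pi/3")
  case True
  have "(\<lambda>y. sin y - y/2) 0 \<le> (\<lambda>y. sin y - y/2) x"
  proof (rule DERIV_nonneg_imp_nondecreasing[OF assms(1)])
    fix y assume y: "0 \<le> y" "y \<le> x"
    have "cos (pi/3) \<le> cos y" by (rule cos_monotone_0_pi_le) (use y True in auto)
    then show "\<exists>d. ((\<lambda>y. sin y - y/2) has_real_derivative d) (at y) \<and> 0 \<le> d"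
      by (intro exI[of _ "cos y - 1/2"] conjI) (auto intro!: derivative_eq_intros simp: cos_60)
  qed
  then show ?thesis by simp
next
  case False
  have "sin (pi/3) \<le> sin x" by (rule sin_monotone_2pi_le) (use False assms in auto)
  moreover have "sqrt 3 \<ge> 1.7" by (rule real_le_rsqrt) (simp add: power2_eq_square)
  moreover have "pi < 3.2" using pi_less_4 pi_approx by simp
  ultimately show ?thesis using assms by (simp add: sin_60)
qed

text \<open>The distance of s from 1 is the difference of the moduli of s and cis x, so replacing s
  by 1 at most doubles the distance to cis x; and |cis x - 1| = 2 |sin (x/2)| >= |x|/2.\<close>

lemma norm_cis_diff_ge:
  assumes "\<bar>x\<bar> \<le> pi" "s \<ge> 0"
  shows "norm (cis x - of_real s) \<ge> \<bar>x\<bar>/4"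
proof -
  have "norm (cis x - 1) \<le> norm (cis x - of_real s) + norm (complex_of_real s - 1)"
    using norm_triangle_ineq[of "cis x - of_real s" "of_real s - 1"] by simp
  also have "norm (complex_of_real s - 1) = \<bar>norm (complex_of_real s) - norm (cis x)\<bar>"
    using assms norm_of_real[of "s - 1", where ?'a = complex] by simp
  also have "\<dots> \<le> norm (cis x - of_real s)"
    using norm_triangle_ineq3[of "complex_of_real s" "cis x"] by (simp add: norm_minus_commute)
  finally have A: "norm (cis x - 1) \<le> 2 * norm (cis x - of_real s)" by simp
  have "(norm (cis x - 1))\<^sup>2 = (2 * sin (x/2))\<^sup>2"
  proof -
    have "(norm (cis x - 1))\<^sup>2 = (cos x - 1)\<^sup>2 + (sin x)\<^sup>2" by (simp add: cmod_power2)
    also have "\<dots> = 2 - 2 * cos x" using sin_cos_squared_add[of x] by (simp add: power2_eq_square algebra_simps)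
    also have "cos x = 1 - 2 * (sin (x/2))\<^sup>2" using cos_double_sin[of "x/2"] by simp
    finally show ?thesis by (simp add: power_mult_distrib)
  qed
  then have "norm (cis x - 1) = \<bar>2 * sin (x/2)\<bar>" by - (rule power2_eq_imp_eq, simp_all only: power2_abs norm_ge_zero abs_ge_zero)
  moreover have "\<bar>sin (x/2)\<bar> = sin (\<bar>x\<bar>/2)"
    using assms sin_ge_zero[of "x/2"] sin_ge_zero[of "-(x/2)"] pi_gt_zero by (cases "x \<ge> 0") auto
  moreover have "sin (\<bar>x\<bar>/2) \<ge> \<bar>x\<bar>/2/2" by (rule sin_ge_half) (use assms in auto)
  ultimately show ?thesis using A by simp
qed

text \<open>Rotation by - Arg a moves a to the nonnegative ray, where
  \<open>norm_cis_diff_ge\<close> applies with s = |a| / r.\<close>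

lemma norm_circle_point_diff_ge:
  assumes "r > 0" "\<theta> \<in> {0..2*pi}"
  shows "norm (of_real r * cis \<theta> - a) \<ge> r * min \<bar>\<theta> - Arg a\<bar> \<bar>\<theta> - (Arg a + 2*pi)\<bar> / 4"
proof -
  \<comment> \<open>The shift k brings the difference of the angles into [-pi, pi].\<close>
  obtain k where k: "k \<in> {0, 2*pi}" "\<bar>\<theta> - Arg a - k\<bar> \<le> pi"
  proof -
    have "- pi < Arg a" "Arg a \<le> pi" by (rule mpi_less_Arg, rule Arg_le_pi)
    then show ?thesis using that[of 0] that[of "2*pi"] assms by (cases "\<theta> - Arg a \<le> pi") auto
  qed
  let ?x = "\<theta> - Arg a - k"
  have "cis ?x * cis (Arg a) = cis (\<theta> - k)" by (simp add: cis_mult)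
  also have "\<dots> = cis \<theta>" using k cos_periodic[of "\<theta> - 2*pi"] sin_periodic[of "\<theta> - 2*pi"] by (auto simp: cis.ctr complex_eq_iff)
  finally have c: "cis \<theta> = cis ?x * cis (Arg a)" by simp
  have "a = of_real (norm a) * cis (Arg a)" using rcis_cmod_Arg[of a] by (simp add: rcis_def)
  then have "of_real r * cis \<theta> - a = of_real r * cis (Arg a) * (cis ?x - of_real (norm a / r))"
    using assms c by (simp add: algebra_simps)
  then have "norm (of_real r * cis \<theta> - a) = r * norm (cis ?x - of_real (norm a / r))"
    using assms by (simp add: norm_mult)
  also have "\<dots> \<ge> r * (\<bar>?x\<bar> / 4)" using assms k by (intro mult_left_mono norm_cis_diff_ge) auto
  also have "r * (\<bar>?x\<bar>/4) \<ge> r * min \<bar>\<theta> - Arg a\<bar> \<bar>\<theta> - (Arg a + 2*pi)\<bar> / 4"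
    using k assms by (auto simp: algebra_simps intro!: mult_left_mono)
  finally show ?thesis by simp
qed

text \<open>
  On \<open>[0, 2\<pi>]\<close> the point \<open>r cis \<theta>\<close> can approach \<open>a\<close> only near the angles \<open>Arg a\<close> and \<open>Arg a + 2\<pi>\<close>, since
  \<open>Arg a\<close> lies in \<open>(-\<pi>, \<pi>]\<close>.
\<close>
definition sing_dom :: "complex \<Rightarrow> real \<Rightarrow> real" where
  "sing_dom a \<theta> = 1 / sqrt \<bar>\<theta> - Arg a\<bar> + 1 / sqrt \<bar>\<theta> - (Arg a + 2*pi)\<bar>"

lemma sing_dom_nonneg: "sing_dom a \<theta> \<ge> 0" by (simp add: sing_dom_def)

text \<open>The point is that the bound on the integral is the same for all a.\<close>

lemma sing_dom_has_integral:
  obtains I where "(sing_dom a has_integral I) {0..2*pi}" "I \<le> 16 * sqrt (4*pi)"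
proof
  let ?J = "\<lambda>c. 2 * sgn (2*pi-c) * sqrt \<bar>2*pi-c\<bar> - 2 * sgn (0-c) * sqrt \<bar>0-c\<bar>"
  show "(sing_dom a has_integral (?J (Arg a) + ?J (Arg a + 2*pi))) {0..2*pi}"
    unfolding sing_dom_def by (intro has_integral_add has_integral_inverse_sqrt) auto
  have J: "?J c \<le> 8 * sqrt (4*pi)" if "- pi \<le> c" "c \<le> 3*pi" for c
  proof -
    have "sgn x * sqrt \<bar>x\<bar> \<le> sqrt (4*pi) \<and> - sqrt (4*pi) \<le> sgn x * sqrt \<bar>x\<bar>" if "\<bar>x\<bar> \<le> 4*pi" for x
    proof -
      have "sqrt \<bar>x\<bar> \<le> sqrt (4*pi)" using that by simp
      moreover have nn: "sqrt \<bar>x\<bar> \<ge> 0" "sqrt (4*pi) \<ge> 0" by auto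
      moreover have "sgn x * sqrt \<bar>x\<bar> = sqrt \<bar>x\<bar> \<or> sgn x * sqrt \<bar>x\<bar> = - sqrt \<bar>x\<bar> \<or> sgn x * sqrt \<bar>x\<bar> = 0"
        by (cases "x > 0"; cases "x = 0") (auto simp: sgn_if)
      ultimately show ?thesis by linarith
    qed
    from this[of "2*pi-c"] this[of "0-c"] show ?thesis using that pi_gt_zero by (simp add: abs_le_iff)
  qed
  have "- pi < Arg a" "Arg a \<le> pi" by (rule mpi_less_Arg, rule Arg_le_pi)
  then show "?J (Arg a) + ?J (Arg a + 2*pi) \<le> 16 * sqrt (4*pi)"
    using J[of "Arg a"] J[of "Arg a + 2*pi"] pi_gt_zero by auto
qed

lemma inverse_sqrt_le_sing_dom:
  assumes "r > 0" "\<theta> \<in> {0..2*pi} - {Arg a, Arg a + 2*pi}"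
  shows "1 / sqrt (norm (of_real r * cis \<theta> - a)) \<le> 2 / sqrt r * sing_dom a \<theta>"
proof -
  let ?m = "min \<bar>\<theta> - Arg a\<bar> \<bar>\<theta> - (Arg a + 2*pi)\<bar>"
  have m: "?m > 0" using assms by auto
  have "r * ?m / 4 \<le> norm (of_real r * cis \<theta> - a)" using norm_circle_point_diff_ge assms by auto
  then have "1 / sqrt (norm (of_real r * cis \<theta> - a)) \<le> 1 / sqrt (r * ?m / 4)"
    using m assms order.strict_trans2[of 0 "r * ?m / 4" "norm (of_real r * cis \<theta> - a)"]
    by (intro divide_left_mono mult_pos_pos real_sqrt_le_mono) (auto simp del: zero_less_mult_iff)
  also have "\<dots> = 2 / sqrt r * (1 / sqrt ?m)" using assms m by (simp add: real_sqrt_divide real_sqrt_mult)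
  also have "1 / sqrt ?m \<le> sing_dom a \<theta>" unfolding sing_dom_def by (auto simp: min_def)
  finally show ?thesis using assms by (simp add: mult_left_mono del: times_divide_eq_left)
qed

text \<open>Reduces the logarithmic singularity to 1 / sqrt x, for which \<open>sing_dom\<close> is
  made: ln y <= y - 1 is applied at x and at 1 / sqrt x.\<close>

lemma abs_ln_le: assumes "x > 0" shows "\<bar>ln x\<bar> \<le> x + 2 / sqrt x"
proof -
  have "ln x \<le> x" using ln_le_minus_one[OF assms] by simp
  moreover have "ln (1 / sqrt x) \<le> 1 / sqrt x - 1" by (rule ln_le_minus_one) (use assms in auto)
  then have "- ln x \<le> 2 / sqrt x" using assms by (simp add: ln_div ln_sqrt)
  ultimately show ?thesis using assms by (auto simp: abs_le_iff add_increasing add_increasing2)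
qed

section \<open>Cauchy's and Schwarz' formulas on a circle\<close>

lemma contour_circle_iff:
  assumes "r > 0"
  shows "((\<lambda>\<theta>. f (of_real r * cis \<theta>) * (of_real r * \<i> * cis \<theta>)) has_integral I) {0..2*pi}
     \<longleftrightarrow> (f has_contour_integral I) (circlepath 0 r)"
  using has_contour_integral_part_circlepath_iff[of 0 "2*pi" f I 0 r]
  by (simp add: circlepath_def mult.assoc)

lemma Cauchy_mean:
  fixes u :: "complex \<Rightarrow> complex"
  assumes "u holomorphic_on ball 0 R'" "0 < r" "r < R'" "norm z < r"
  shows "((\<lambda>\<theta>. u (of_real r * cis \<theta>) * (of_real r * cis \<theta> / (of_real r * cis \<theta> - z))) has_integral (2*pi) * u z) {0..2*pi}"
proof -
  have "((\<lambda>w. u w / (w - z)) has_contour_integral (2 * of_real pi * \<i> * u z)) (circlepath 0 r)"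
    by (rule Cauchy_integral_circlepath_simple)
       (use assms in \<open>auto intro!: holomorphic_on_subset[OF assms(1)]\<close>)
  then have "((\<lambda>\<theta>. u (of_real r * cis \<theta>) / (of_real r * cis \<theta> - z) * (of_real r * \<i> * cis \<theta>)) has_integral (2 * of_real pi * \<i> * u z)) {0..2*pi}"
    by (subst contour_circle_iff[OF assms(2)])
  from has_integral_mult_right[OF this, of "-\<i>"] show ?thesis
    by (simp add: algebra_simps)
qed

lemma mean_value_holomorphic:
  fixes u :: "complex \<Rightarrow> complex"
  assumes "u holomorphic_on ball 0 R'" "0 < r" "r < R'"
  shows "((\<lambda>\<theta>. u (of_real r * cis \<theta>)) has_integral (2*pi) * u 0) {0..2*pi}"
  using Cauchy_mean[OF assms, of 0] assms by simp

lemma cmean_Re_holomorphic: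
  fixes u :: "complex \<Rightarrow> complex"
  assumes "u holomorphic_on ball 0 R'" "0 < r" "r < R'"
  shows "cmean (\<lambda>z. Re (u z)) r = Re (u 0)"
proof -
  have "((\<lambda>\<theta>. Re (u (of_real r * cis \<theta>))) has_integral Re ((2*pi) * u 0)) {0..2*pi}"
    by (rule has_integral_Re[OF mean_value_holomorphic[OF assms]])
  then show ?thesis unfolding cmean_def by (simp add: integral_unique)
qed

lemma cint_Re_holomorphic:
  fixes u :: "complex \<Rightarrow> complex"
  assumes "u holomorphic_on ball 0 R'" "0 < r" "r < R'"
  shows "cint (\<lambda>z. Re (u z)) r"
  by (rule cint_continuous)
     (use assms in \<open>auto intro!: continuous_intros holomorphic_on_imp_continuous_on holomorphic_on_subset[OF assms(1)]\<close>)

text \<open>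
  Reflection in the circle turns \<open>cnj (u \<zeta>) * \<zeta> / (\<zeta> - z)\<close> into the conjugate of a function \<open>v\<close> holomorphic in
  the disc with \<open>v 0 = u 0\<close>; adding its mean to Cauchy's formula leaves only \<open>Re u\<close> under the integral.
\<close>
lemma Schwarz_bound:
  fixes u :: "complex \<Rightarrow> complex"
  assumes u: "u holomorphic_on ball 0 R'" and r: "0 < r" "r < R'" and z: "norm z < r"
  shows "norm (u z + cnj (u 0)) \<le> 2 * r / (r - norm z) * cmean (\<lambda>z. \<bar>Re (u z)\<bar>) r"
proof -
  let ?w = "\<lambda>\<theta>. of_real r * cis \<theta>"
  define v where "v = (\<lambda>w. u w * (of_real (r\<^sup>2) / (of_real (r\<^sup>2) - cnj z * w)))"
  have nz: "of_real (r\<^sup>2) - cnj z * w \<noteq> 0" if "norm w < r * r / norm z \<or> z = 0" for w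
  proof
    assume eq: "of_real (r\<^sup>2) - cnj z * w = 0"
    then have "norm (cnj z * w) = norm (complex_of_real (r\<^sup>2))" by simp
    then have *: "norm z * norm w = r * r" unfolding norm_mult by (simp add: power2_eq_square norm_mult)
    show False
    proof (cases "z = 0")
      case True with * r show False by simp
    next
      case False with * that r show False by (simp add: field_simps)
    qed
  qed
  \<comment> \<open>The denominator of \<open>v\<close> vanishes only at the reflection of z in the
    circle, of modulus r * r / |z| > r; R'' stays below it, so that \<open>v\<close> is holomorphic
    beyond the circle.\<close>
  obtain R'' where R'': "r < R''" "R'' \<le> R'" "z = 0 \<or> R'' \<le> r * r / norm z"
  proof (cases "z = 0")
    case True then show ?thesis using that[of R'] r by auto
  next
    case False
    then have "r < r * r / norm z" using z r by (simp add: field_simps)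
    then show ?thesis using that[of "min R' (r*r/norm z)"] r by auto
  qed
  have v: "v holomorphic_on ball 0 R''" unfolding v_def
    by (intro holomorphic_intros holomorphic_on_subset[OF u] nz) (use R'' in auto)
  have v0: "v 0 = u 0" using r by (simp add: v_def)
  have I1: "((\<lambda>\<theta>. u (?w \<theta>) * (?w \<theta> / (?w \<theta> - z))) has_integral (2*pi) * u z) {0..2*pi}"
    by (rule Cauchy_mean[OF u r z])
  have "((\<lambda>\<theta>. v (?w \<theta>)) has_integral (2*pi) * u 0) {0..2*pi}"
    using mean_value_holomorphic[OF v r(1) R''(1)] v0 by simp
  then have "((\<lambda>\<theta>. cnj (v (?w \<theta>))) has_integral cnj ((2*pi) * u 0)) {0..2*pi}"
    using has_integral_cnj[of "\<lambda>\<theta>. v (?w \<theta>)" "(2*pi) * u 0" "{0..2*pi}"] by (simp only: o_def)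
  \<comment> \<open>On the circle r^2 = cnj w * w, so conjugating the kernel of \<open>v\<close>
    gives the Cauchy kernel w / (w - z).\<close>
  moreover have "cnj (v (?w \<theta>)) = cnj (u (?w \<theta>)) * (?w \<theta> / (?w \<theta> - z))" for \<theta>
  proof -
    have nzw: "?w \<theta> - z \<noteq> 0"
    proof
      assume "?w \<theta> - z = 0" then have "norm z = norm (?w \<theta>)" by simp
      then show False using z r by (simp add: norm_mult)
    qed
    have c1: "cnj (?w \<theta>) * ?w \<theta> = of_real (r\<^sup>2)" using complex_norm_square[of "?w \<theta>"] r
      by (simp add: norm_mult mult.commute)
    have c2: "of_real (r\<^sup>2) - z * cnj (?w \<theta>) = cnj (?w \<theta>) * (?w \<theta> - z)" unfolding c1[symmetric] by (simp only: right_diff_distrib mult.commute)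
    have "cnj (v (?w \<theta>)) = cnj (u (?w \<theta>)) * (of_real (r\<^sup>2) / (of_real (r\<^sup>2) - z * cnj (?w \<theta>)))"
      by (simp add: v_def)
    also have "of_real (r\<^sup>2) / (of_real (r\<^sup>2) - z * cnj (?w \<theta>)) = (cnj (?w \<theta>) * ?w \<theta>) / (cnj (?w \<theta>) * (?w \<theta> - z))"
      unfolding c2 c1 ..
    also have "\<dots> = ?w \<theta> / (?w \<theta> - z)" using r by (intro mult_divide_mult_cancel_left) auto
    finally show ?thesis .
  qed
  ultimately have I2: "((\<lambda>\<theta>. cnj (u (?w \<theta>)) * (?w \<theta> / (?w \<theta> - z))) has_integral (2*pi) * cnj (u 0)) {0..2*pi}" by simp
  have uu: "u x + cnj (u x) = of_real (2 * Re (u x))" for x by (simp add: complex_eq_iff)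
  have I3: "((\<lambda>\<theta>. of_real (2 * Re (u (?w \<theta>))) * (?w \<theta> / (?w \<theta> - z))) has_integral (2*pi) * (u z + cnj (u 0))) {0..2*pi}"
    using has_integral_add[OF I1 I2] by (simp only: ring_distribs(2)[symmetric] ring_distribs(1)[symmetric] uu)
  have "norm (integral {0..2*pi} (\<lambda>\<theta>. of_real (2 * Re (u (?w \<theta>))) * (?w \<theta> / (?w \<theta> - z))))
      \<le> integral {0..2*pi} (\<lambda>\<theta>. 2 * r / (r - norm z) * \<bar>Re (u (?w \<theta>))\<bar>)"
  proof (rule integral_norm_bound_integral)
    show "(\<lambda>\<theta>. 2 * r / (r - norm z) * \<bar>Re (u (?w \<theta>))\<bar>) integrable_on {0..2*pi}"
      using cint_integrable[OF cint_cmult[OF cint_abs[OF cint_Re_holomorphic[OF u r]], of "2 * r / (r - norm z)"]] .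
    fix \<theta> assume "\<theta> \<in> {0..2*pi}"
    have "r - norm z \<le> norm (?w \<theta> - z)" using norm_triangle_ineq2[of "?w \<theta>" z] r by (simp add: norm_mult)
    then have "norm (?w \<theta> / (?w \<theta> - z)) \<le> r / (r - norm z)"
      using r z by (simp add: norm_divide norm_mult frac_le)
    then have "2 * \<bar>Re (u (?w \<theta>))\<bar> * norm (?w \<theta> / (?w \<theta> - z)) \<le> 2 * \<bar>Re (u (?w \<theta>))\<bar> * (r / (r - norm z))"
      by (rule mult_left_mono) simp
    moreover have "norm (of_real (2 * Re (u (?w \<theta>))) * (?w \<theta> / (?w \<theta> - z))) = 2 * \<bar>Re (u (?w \<theta>))\<bar> * norm (?w \<theta> / (?w \<theta> - z))"
      unfolding norm_mult norm_of_real by (simp only: abs_mult abs_numeral)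
    ultimately show "norm (of_real (2 * Re (u (?w \<theta>))) * (?w \<theta> / (?w \<theta> - z))) \<le> 2 * r / (r - norm z) * \<bar>Re (u (?w \<theta>))\<bar>"
      by (simp only: mult_ac times_divide_eq_right times_divide_eq_left)
  qed (rule has_integral_integrable[OF I3])
  also have "\<dots> = 2 * r / (r - norm z) * integral {0..2*pi} (\<lambda>\<theta>. \<bar>Re (u (?w \<theta>))\<bar>)"
    by (rule integral_mult_right)
  finally have "norm (complex_of_real (2*pi) * (u z + cnj (u 0))) \<le> 2 * r / (r - norm z) * integral {0..2*pi} (\<lambda>\<theta>. \<bar>Re (u (?w \<theta>))\<bar>)"
    unfolding integral_unique[OF I3] .
  then have "(2*pi) * norm (u z + cnj (u 0)) \<le> 2 * r / (r - norm z) * integral {0..2*pi} (\<lambda>\<theta>. \<bar>Re (u (?w \<theta>))\<bar>)"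
    unfolding norm_mult norm_of_real by simp
  then have "norm (u z + cnj (u 0)) \<le> (2 * r / (r - norm z) * integral {0..2*pi} (\<lambda>\<theta>. \<bar>Re (u (?w \<theta>))\<bar>)) / (2*pi)"
    by (subst pos_le_divide_eq) (auto simp only: mult.commute pi_gt_zero zero_less_mult_iff zero_less_numeral)
  then show ?thesis unfolding cmean_def by simp
qed

section \<open>The mean of ln |z - a| over a circle\<close>

lemma holomorphic_Ln_affine:
  assumes "a \<noteq> 0"
  obtains u where "u holomorphic_on ball 0 (norm a)" "\<And>z. z \<in> ball 0 (norm a) \<Longrightarrow> exp (u z) = a - z"
proof -
  have "\<exists>u. u holomorphic_on ball 0 (norm a) \<and> (\<forall>z\<in>ball 0 (norm a). a - z = exp (u z))"
  proof -
    have "(\<lambda>z. a - z) holomorphic_on ball 0 (norm a)" by (intro holomorphic_intros)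
    moreover have "a - z \<noteq> 0" if "z \<in> ball 0 (norm a)" for z using that by auto
    ultimately show ?thesis
      using contractible_imp_holomorphic_log[of "\<lambda>z. a - z" "ball 0 (norm a)"]
      by (metis convex_ball convex_imp_contractible)
  qed
  then show ?thesis using that by metis
qed

lemma cint_ln_norm_diff_off:
  assumes "0 < r" "norm a \<noteq> r"
  shows "cint (\<lambda>z. ln (norm (z - a))) r"
  by (rule cint_continuous) (use assms in \<open>auto intro!: continuous_intros\<close>)

lemma cmean_ln_norm_diff_outside:
  assumes "0 < r" "r < norm a"
  shows "cmean (\<lambda>z. ln (norm (z - a))) r = ln (norm a)"
proof -
  have "a \<noteq> 0" using assms by auto
  obtain u where u: "u holomorphic_on ball 0 (norm a)" "\<And>z. z \<in> ball 0 (norm a) \<Longrightarrow> exp (u z) = a - z"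
    using holomorphic_Ln_affine[OF \<open>a \<noteq> 0\<close>] by blast
  have eq: "ln (norm (z - a)) = Re (u z)" if "norm z < norm a" for z
  proof -
    have "norm (z - a) = exp (Re (u z))" using u(2)[of z] that by (simp add: norm_minus_commute flip: norm_exp_eq_Re)
    then show ?thesis by simp
  qed
  have "ln (norm a) = Re (u 0)" using eq[of 0] \<open>a \<noteq> 0\<close> by simp
  have "cmean (\<lambda>z. ln (norm (z - a))) r = cmean (\<lambda>z. Re (u z)) r"
    by (rule cint_cong(2)[of r "{}"]) (use assms eq in auto)
  also have "\<dots> = Re (u 0)" by (rule cmean_Re_holomorphic[OF u(1) assms])
  finally show ?thesis using \<open>ln (norm a) = Re (u 0)\<close> by simp
qed

text \<open>The reflection b = r^2 / cnj a lies outside the disc, and r |z - a| = |a| |z - b| on the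
  circle, which reduces the claim to the case of an outer point.\<close>

lemma cmean_ln_norm_diff_inside:
  assumes "0 < r" "norm a < r"
  shows "cmean (\<lambda>z. ln (norm (z - a))) r = ln r"
proof (cases "a = 0")
  case True
  then have "cmean (\<lambda>z. ln (norm (z - a))) r = cmean (\<lambda>z. ln r) r"
    by (intro cint_cong(2)[of r "{}"]) (use assms in auto)
  then show ?thesis by simp
next
  case False
  define b where "b = of_real (r\<^sup>2) / cnj a"
  have nb: "norm b = r * r / norm a" by (simp add: b_def norm_divide power2_eq_square norm_mult)
  have rb: "r < norm b" unfolding nb using assms False by (simp add: pos_less_divide_eq)
  have eq: "ln (norm (z - a)) = ln (norm (z - b)) + (ln (norm a) - ln r)" if z: "norm z = r" for z
  proof -
    have zz: "cnj z * z = of_real (r\<^sup>2)" using complex_norm_square[of z] z by (simp add: mult.commute)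
    have "z - b \<noteq> 0" using z rb by auto
    have "norm (z - a) * r = norm (cnj (z - a) * z)" using z by (simp add: norm_mult del: complex_cnj_diff)
    also have "cnj (z - a) * z = - (cnj a * (z - b))" using zz False by (simp add: b_def algebra_simps)
    also have "norm \<dots> = norm a * norm (z - b)" by (simp add: norm_mult)
    finally have "norm (z - a) = norm (z - b) * (norm a / r)" using assms by (simp add: field_simps)
    then have "ln (norm (z - a)) = ln (norm (z - b)) + ln (norm a / r)"
      using \<open>z - b \<noteq> 0\<close> False assms by (simp only:) (subst ln_mult, auto)
    then show ?thesis using False assms by (simp add: ln_div)
  qed
  have "cmean (\<lambda>z. ln (norm (z - a))) r = cmean (\<lambda>z. ln (norm (z - b)) + (ln (norm a) - ln r)) r"
    by (rule cint_cong(2)[of r "{}"]) (use assms eq in auto)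
  also have "\<dots> = ln (norm b) + (ln (norm a) - ln r)"
    using rb assms by (subst cmean_add) (auto intro!: cint_ln_norm_diff_off simp: cmean_ln_norm_diff_outside)
  also have "\<dots> = ln r" using nb assms False by (simp add: ln_div ln_mult)
  finally show ?thesis .
qed

text \<open>The point a is approached from outside along its own ray. All these points have the same
  argument, so a single function built from \<open>sing_dom a\<close> dominates all the logarithms,
  and dominated convergence carries the mean over.\<close>

lemma ln_norm_diff_on_circle:
  assumes r: "0 < r" and a: "norm a = r"
  shows "cint (\<lambda>z. ln (norm (z - a))) r \<and> cmean (\<lambda>z. ln (norm (z - a))) r = ln r"
proof -
  \<comment> \<open>Angles to be discarded: those where the point is a itself, and the two singular
    angles of \<open>sing_dom a\<close>, where division by zero destroys the domination.\<close>
  let ?B = "{\<theta>\<in>{0..2*pi}. complex_of_real r * cis \<theta> \<in> {a}} \<union> {Arg a, Arg a + 2*pi}"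
  have finB: "finite ?B" using finite_cis_preimage[OF r, of "{a}"] by simp
  define ak where "ak = (\<lambda>k::nat. of_real (1 + 1 / real (Suc k)) * a)"
  have nak: "norm (ak k) = (1 + 1 / real (Suc k)) * r" for k
    unfolding ak_def norm_mult norm_of_real a by simp
  have rak: "r < norm (ak k)" for k unfolding nak using r by (simp add: field_simps)
  have nak2: "norm (ak k) \<le> 2 * r" for k unfolding nak using r by (intro mult_right_mono) auto
  have Argak: "Arg (ak k) = Arg a" for k unfolding ak_def by (rule Arg_times_of_real) (simp add: add_pos_pos)
  have lim: "ak \<longlonglongrightarrow> a"
  proof -
    have "(\<lambda>k. 1 / real (Suc k)) \<longlonglongrightarrow> 0" using LIMSEQ_inverse_real_of_nat by (simp add: inverse_eq_divide)
    then have "(\<lambda>k. complex_of_real (1 + 1 / real (Suc k)) * a) \<longlonglongrightarrow> of_real (1 + 0) * a"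
      by (intro tendsto_intros)
    then show ?thesis by (simp add: ak_def)
  qed
  let ?h = "\<lambda>\<theta>. 3 * r + 4 / sqrt r * sing_dom a \<theta>"
  let ?w = "\<lambda>\<theta>. of_real r * cis \<theta> :: complex"
  have sint: "sing_dom a integrable_on {0..2*pi}"
    using sing_dom_has_integral[of a] has_integral_integrable by blast
  have hint: "?h integrable_on {0..2*pi}"
    by (intro integrable_add integrable_on_mult_right sint integrable_const_ivl)
  have hnn: "0 \<le> ?h \<theta>" for \<theta> using r sing_dom_nonneg[of a \<theta>] by simp
  \<comment> \<open>3 r comes from |w| + |b| with |b| <= 2 r; 4 / sqrt r is the coefficient 2 of
    \<open>abs_ln_le\<close> times that of \<open>inverse_sqrt_le_sing_dom\<close>.\<close>
  have bd: "\<bar>ln (norm (?w \<theta> - b))\<bar> \<le> ?h \<theta>"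
    if \<theta>: "\<theta> \<in> {0..2*pi} - ?B" and b: "Arg b = Arg a" "?w \<theta> \<noteq> b" "norm b \<le> 2 * r" for \<theta> b
  proof -
    have "\<bar>ln (norm (?w \<theta> - b))\<bar> \<le> norm (?w \<theta> - b) + 2 / sqrt (norm (?w \<theta> - b))"
      by (rule abs_ln_le) (use b in auto)
    moreover have "norm (?w \<theta> - b) \<le> 3 * r" using norm_triangle_ineq4[of "?w \<theta>" b] b r by (simp add: norm_mult)
    moreover have "1 / sqrt (norm (?w \<theta> - b)) \<le> 2 / sqrt r * sing_dom b \<theta>"
      by (rule inverse_sqrt_le_sing_dom) (use \<theta> b r in auto)
    moreover have "sing_dom b \<theta> = sing_dom a \<theta>" by (simp add: sing_dom_def b)
    ultimately show ?thesis by simp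
  qed
  \<comment> \<open>Setting the functions to 0 on the null set \<open>?B\<close> makes domination
    and convergence hold at every angle.\<close>
  define \<phi> where "\<phi> = (\<lambda>k \<theta>. if \<theta> \<in> ?B then 0 else ln (norm (?w \<theta> - ak k)))"
  define \<phi>0 where "\<phi>0 = (\<lambda>\<theta>. if \<theta> \<in> ?B then 0 else ln (norm (?w \<theta> - a)))"
  have neg: "negligible ?B" using finB by (rule negligible_finite)
  have i1: "\<phi> k integrable_on {0..2*pi}" for k
  proof -
    have "cint (\<lambda>z. ln (norm (z - ak k))) r" by (rule cint_ln_norm_diff_off) (use r rak[of k] in auto)
    show ?thesis by (rule integrable_spike[OF cint_integrable[OF \<open>cint (\<lambda>z. ln (norm (z - ak k))) r\<close>] neg]) (simp only: \<phi>_def if_False Diff_iff)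
  qed
  have dA: "norm (\<phi> k \<theta>) \<le> ?h \<theta>" if t: "\<theta> \<in> {0..2*pi}" for k \<theta>
    proof (cases "\<theta> \<in> ?B")
      case True then show ?thesis using hnn[of \<theta>] by (simp only: \<phi>_def if_True norm_zero)
    next
      case False
      have "?w \<theta> \<noteq> ak k" using rak[of k] r by (metis norm_mult norm_cis norm_of_real mult.right_neutral abs_of_pos less_irrefl)
      then show ?thesis using bd[of \<theta> "ak k"] False t Argak nak2
        by (simp only: \<phi>_def if_False real_norm_def) auto
    qed
  have dB: "(\<lambda>k. \<phi> k \<theta>) \<longlonglongrightarrow> \<phi>0 \<theta>" if t: "\<theta> \<in> {0..2*pi}" for \<theta>
    proof (cases "\<theta> \<in> ?B")
      case True then show ?thesis by (simp only: \<phi>_def \<phi>0_def if_True tendsto_const)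
    next
      case False
      then have "?w \<theta> \<noteq> a" using t by auto
      then have "(\<lambda>k. ln (norm (?w \<theta> - ak k))) \<longlonglongrightarrow> ln (norm (?w \<theta> - a))"
        by (intro tendsto_intros lim) auto
      then show ?thesis using False by (simp only: \<phi>_def \<phi>0_def if_False)
    qed
  have dc: "\<phi>0 integrable_on {0..2*pi} \<and> (\<lambda>k. integral {0..2*pi} (\<phi> k)) \<longlonglongrightarrow> integral {0..2*pi} \<phi>0"
    using dominated_convergence[OF i1 hint dA dB] by simp
  have I0: "(\<lambda>\<theta>. ln (norm (?w \<theta> - a))) integrable_on {0..2*pi}"
    by (rule integrable_spike[OF conjunct1[OF dc] neg]) (auto simp: \<phi>0_def)
  have "\<phi>0 absolutely_integrable_on {0..2*pi}"
  proof (rule absolutely_integrable_integrable_bound[OF _ conjunct1[OF dc] hint])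
    fix \<theta> assume t: "\<theta> \<in> {0..2*pi}"
    show "norm (\<phi>0 \<theta>) \<le> ?h \<theta>"
    proof (cases "\<theta> \<in> ?B")
      case True then show ?thesis using hnn[of \<theta>] by (simp only: \<phi>0_def if_True norm_zero)
    next
      case False
      then have "?w \<theta> \<noteq> a" using t by auto
      then show ?thesis using bd[of \<theta> a] False t a r
        by (simp only: \<phi>0_def if_False real_norm_def) auto
    qed
  qed
  then have c1: "cint (\<lambda>z. ln (norm (z - a))) r" unfolding cint_def
    by (rule absolutely_integrable_spike[OF _ neg]) (auto simp: \<phi>0_def)
  have "integral {0..2*pi} (\<phi> k) = 2*pi * ln (norm (ak k))" for k
  proof -
    have "integral {0..2*pi} (\<phi> k) = integral {0..2*pi} (\<lambda>\<theta>. ln (norm (?w \<theta> - ak k)))"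
      by (rule integral_spike[OF neg]) (auto simp: \<phi>_def)
    then show ?thesis using cmean_ln_norm_diff_outside[OF r rak[of k]] unfolding cmean_def by (simp add: field_simps)
  qed
  then have "(\<lambda>k. 2*pi * ln (norm (ak k))) \<longlonglongrightarrow> integral {0..2*pi} \<phi>0" using conjunct2[OF dc] by simp
  moreover have "(\<lambda>k. 2*pi * ln (norm (ak k))) \<longlonglongrightarrow> 2 * pi * ln (norm a)"
    by (intro tendsto_intros lim) (use a r in auto)
  ultimately have "integral {0..2*pi} \<phi>0 = 2 * pi * ln (norm a)" by (rule LIMSEQ_unique)
  moreover have "integral {0..2*pi} \<phi>0 = integral {0..2*pi} (\<lambda>\<theta>. ln (norm (?w \<theta> - a)))"
    by (rule integral_spike[OF neg]) (auto simp: \<phi>0_def)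
  ultimately have "cmean (\<lambda>z. ln (norm (z - a))) r = ln r" unfolding cmean_def using a by simp
  with c1 show ?thesis by simp
qed

lemma cint_ln_norm_diff: "0 < r \<Longrightarrow> cint (\<lambda>z. ln (norm (z - a))) r"
  using cint_ln_norm_diff_off[of r a] ln_norm_diff_on_circle[of r a] by blast

lemma cmean_ln_norm_diff: "0 < r \<Longrightarrow> cmean (\<lambda>z. ln (norm (z - a))) r = ln (max r (norm a))"
  using cmean_ln_norm_diff_inside[of r a] cmean_ln_norm_diff_outside[of r a] ln_norm_diff_on_circle[of r a]
  by (cases "norm a" r rule: linorder_cases) (auto simp: max_def)

text \<open>If x <= B and B >= 0, then |x| <= 2 B - x. With B = ln (2 r) the mean of the modulus
  follows from the exact mean ln r of the logarithm itself.\<close>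

lemma cmean_abs_ln_norm_diff:
  assumes "1 \<le> r" "norm a \<le> r"
  shows "cmean (\<lambda>z. \<bar>ln (norm (z - a))\<bar>) r \<le> ln r + 2 * ln 2"
proof -
  have r: "0 < r" using assms by simp
  have "cmean (\<lambda>z. \<bar>ln (norm (z - a))\<bar>) r \<le> cmean (\<lambda>z. 2 * ln (2 * r) + (- ln (norm (z - a)))) r"
  proof (rule cmean_mono_strong[of r "{a}"])
    fix z assume z: "norm z = r" "z \<notin> {a}"
    have "norm (z - a) \<le> 2 * r" using norm_triangle_ineq4[of z a] z assms by simp
    then have "ln (norm (z - a)) \<le> ln (2 * r)" using z r by simp
    moreover have "0 \<le> ln (2 * r)" using assms by simp
    ultimately show "\<bar>ln (norm (z - a))\<bar> \<le> 2 * ln (2 * r) + (- ln (norm (z - a)))" by linarith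
  qed (use r in \<open>auto intro!: cint_abs cint_ln_norm_diff cint_add cint_minus simp del: add_uminus_conv_diff\<close>)
  also have "\<dots> = 2 * ln (2 * r) - ln r"
    using assms r by (subst cmean_add) (auto simp del: add_uminus_conv_diff intro!: cint_minus cint_ln_norm_diff simp: cmean_minus cmean_ln_norm_diff max_def)
  also have "\<dots> = ln r + 2 * ln 2" using r by (simp add: ln_mult)
  finally show ?thesis .
qed

text \<open>The bound is uniform in a, which may also lie on the circle; hence sums over zeros and
  poles cost only their number.\<close>

lemma inverse_sqrt_norm_diff:
  assumes "r > 0"
  shows "cint (\<lambda>z. 1 / sqrt (norm (z - a))) r"
    and "cmean (\<lambda>z. 1 / sqrt (norm (z - a))) r \<le> 16 * sqrt (4*pi) / (pi * sqrt r)"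
proof -
  let ?w = "\<lambda>\<theta>. of_real r * cis \<theta> :: complex"
  let ?B = "{Arg a, Arg a + 2*pi}"
  obtain I where I: "(sing_dom a has_integral I) {0..2*pi}" "I \<le> 16 * sqrt (4*pi)"
    using sing_dom_has_integral[of a] by blast
  have sint: "(\<lambda>\<theta>. 2 / sqrt r * sing_dom a \<theta>) integrable_on {0..2*pi}"
    by (intro integrable_on_mult_right has_integral_integrable[OF I(1)])
  have neg: "negligible ?B" by (intro negligible_finite) simp
  define \<phi> where "\<phi> = (\<lambda>\<theta>. if \<theta> \<in> ?B then 0 else 1 / sqrt (norm (?w \<theta> - a)))"
  have bd: "norm (\<phi> \<theta>) \<le> 2 / sqrt r * sing_dom a \<theta>" if t: "\<theta> \<in> {0..2*pi}" for \<theta>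
  proof (cases "\<theta> \<in> ?B")
    case True then show ?thesis using sing_dom_nonneg[of a \<theta>] assms by (simp add: \<phi>_def)
  next
    case False
    then show ?thesis using inverse_sqrt_le_sing_dom[OF assms, of \<theta> a] t by (simp add: \<phi>_def)
  qed
  have ab: "\<phi> absolutely_integrable_on {0..2*pi}"
  proof (rule measurable_bounded_by_integrable_imp_absolutely_integrable)
    \<comment> \<open>Measurability goes through the continuous square root, because the quotient is
      discontinuous when a lies on the circle.\<close>
    have "(\<lambda>\<theta>. sqrt (norm (?w \<theta> - a))) \<in> borel_measurable borel"
      by (intro borel_measurable_continuous_onI continuous_intros)
    from borel_measurable_divide[OF borel_measurable_const[of 1] this]
    have "(\<lambda>\<theta>. 1 / sqrt (norm (?w \<theta> - a))) \<in> borel_measurable lebesgue"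
      by (intro measurable_completion) simp
    then show "\<phi> \<in> borel_measurable (lebesgue_on {0..2*pi})" unfolding \<phi>_def
      by (intro measurable_restrict_space1 measurable_If_set borel_measurable_const) auto
    show "(\<lambda>\<theta>. 2 / sqrt r * sing_dom a \<theta>) integrable_on {0..2*pi}" by (rule sint)
    show "\<And>\<theta>. \<theta> \<in> {0..2*pi} \<Longrightarrow> norm (\<phi> \<theta>) \<le> 2 / sqrt r * sing_dom a \<theta>" by (rule bd)
  qed auto
  show "cint (\<lambda>z. 1 / sqrt (norm (z - a))) r" unfolding cint_def
    by (rule absolutely_integrable_spike[OF ab neg]) (auto simp: \<phi>_def)
  have "integral {0..2*pi} (\<lambda>\<theta>. 1 / sqrt (norm (?w \<theta> - a))) = integral {0..2*pi} \<phi>"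
    by (rule integral_spike[OF neg]) (auto simp: \<phi>_def)
  also have "\<dots> \<le> integral {0..2*pi} (\<lambda>\<theta>. 2 / sqrt r * sing_dom a \<theta>)"
  proof (rule integral_le)
    show "\<phi> integrable_on {0..2*pi}" using ab absolutely_integrable_on_def by blast
    show "(\<lambda>\<theta>. 2 / sqrt r * sing_dom a \<theta>) integrable_on {0..2*pi}" by (rule sint)
    show "\<phi> \<theta> \<le> 2 / sqrt r * sing_dom a \<theta>" if "\<theta> \<in> {0..2*pi}" for \<theta>
      using bd[OF that] by simp
  qed
  also have "\<dots> = 2 / sqrt r * I" using I by (simp add: integral_unique)
  also have "\<dots> \<le> 2 / sqrt r * (16 * sqrt (4*pi))" using I assms by (intro mult_left_mono) auto
  finally show "cmean (\<lambda>z. 1 / sqrt (norm (z - a))) r \<le> 16 * sqrt (4*pi) / (pi * sqrt r)"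
    unfolding cmean_def using assms by (simp add: field_simps)
qed

section \<open>Zeros, poles and Jensen's formula\<close>

text \<open>\<open>zorder\<close> behaves like a valuation only on functions that do not vanish
  identically. The class is closed under products, powers and inverses, so orders can be added
  without side conditions.\<close>

definition nzmero :: "(complex \<Rightarrow> complex) \<Rightarrow> bool" where
  "nzmero f \<longleftrightarrow> f meromorphic_on UNIV \<and> (\<forall>\<^sub>\<approx>z. f z \<noteq> 0)"

lemma cosparse_finite:
  assumes "\<forall>\<^sub>\<approx>z. P z" shows "finite {z::complex. norm z \<le> r \<and> \<not> P z}"
proof -
  have "{z. \<not> P z} sparse_in cball 0 r"
    using assms by (auto simp: eventually_cosparse intro: sparse_in_subset)
  from sparse_in_compact_finite[OF this compact_cball] show ?thesis
    by (rule rev_finite_subset) auto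
qed

lemma cosparse_at: "\<forall>\<^sub>\<approx>z. P (z::complex) \<Longrightarrow> eventually P (at z)"
  by (rule eventually_cosparse_imp_eventually_at) auto

lemma nzmero_or_zero: "f meromorphic_on UNIV \<Longrightarrow> nzmero f \<or> (\<forall>\<^sub>\<approx>z. f z = 0)"
  using meromorphic_imp_constant_or_avoid[of f UNIV 0] by (auto simp: nzmero_def)

lemma nzmeroD:
  assumes "nzmero f"
  shows "f meromorphic_on A" "eventually (\<lambda>z. f z \<noteq> 0) (at z)" "frequently (\<lambda>z. f z \<noteq> 0) (at z)"
    "isolated_singularity_at f z" "not_essential f z"
proof -
  show 1: "f meromorphic_on A" for A using assms by (auto simp: nzmero_def intro: meromorphic_on_subset)
  show 2: "eventually (\<lambda>z. f z \<noteq> 0) (at z)" using assms by (auto simp: nzmero_def cosparse_at)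
  then show "frequently (\<lambda>z. f z \<noteq> 0) (at z)" by (simp add: eventually_frequently)
  show "isolated_singularity_at f z" "not_essential f z"
    using 1[of "{z}"] by (auto simp: meromorphic_at_iff)
qed

lemma nzmero_cong: "\<forall>\<^sub>\<approx>z. f z = g z \<Longrightarrow> nzmero f \<Longrightarrow> nzmero g"
  unfolding nzmero_def using meromorphic_on_cong'[of f g UNIV UNIV]
  by (auto elim: eventually_elim2)

lemma nzmero_mult: "nzmero f \<Longrightarrow> nzmero g \<Longrightarrow> nzmero (\<lambda>z. f z * g z)"
  unfolding nzmero_def by (auto intro!: meromorphic_intros elim: eventually_elim2)

lemma nzmero_powi: "nzmero f \<Longrightarrow> nzmero (\<lambda>z. f z powi n)"
proof -
  assume "nzmero f"
  then have "f meromorphic_on UNIV" "\<forall>\<^sub>\<approx>z. f z \<noteq> 0" by (simp_all add: nzmero_def)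
  moreover from this(2) have "\<forall>\<^sub>\<approx>z. f z powi n \<noteq> 0" by eventually_elim simp
  ultimately show ?thesis by (simp add: nzmero_def meromorphic_on_powi)
qed

lemma nzmero_power: "nzmero f \<Longrightarrow> nzmero (\<lambda>z. f z ^ n)"
  using nzmero_powi[of f "int n"] by simp

lemma nzmero_inverse: "nzmero f \<Longrightarrow> nzmero (\<lambda>z. inverse (f z))"
  unfolding nzmero_def by (auto intro!: meromorphic_intros elim: eventually_mono)

lemma nzmero_const: "c \<noteq> 0 \<Longrightarrow> nzmero (\<lambda>_. c)"
  unfolding nzmero_def by auto

lemma nzmero_prod: "(\<And>a. a \<in> A \<Longrightarrow> nzmero (f a)) \<Longrightarrow> nzmero (\<lambda>z. \<Prod>a\<in>A. f a z)"
  by (induction A rule: infinite_finite_induct) (auto intro!: nzmero_mult nzmero_const)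

lemma nzmero_diff: "nzmero (\<lambda>z. z - a)"
  unfolding nzmero_def
proof
  have "eventually (\<lambda>z. z \<notin> {a}) (cosparse UNIV)" by (rule eventually_not_in_cosparse) auto
  then show "\<forall>\<^sub>\<approx>z. z - a \<noteq> 0" by simp
qed (auto intro!: meromorphic_intros)

lemma nzmero_remove_sings: "nzmero f \<Longrightarrow> nzmero (remove_sings f)"
proof (rule nzmero_cong[of f])
  assume "nzmero f"
  then have "\<forall>\<^sub>\<approx>z. remove_sings f z = f z" by (intro eventually_remove_sings_eq) (simp add: nzmero_def)
  then show "\<forall>\<^sub>\<approx>z. f z = remove_sings f z" by eventually_elim simp
qed

lemma nzmero_entire: "f holomorphic_on UNIV \<Longrightarrow> \<exists>z. f z \<noteq> 0 \<Longrightarrow> nzmero f"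
  using nicely_meromorphic_imp_constant_or_avoid[of f UNIV 0]
  by (auto simp: nzmero_def analytic_on_open analytic_on_imp_nicely_meromorphic_on analytic_on_imp_meromorphic_on)

section \<open>Orders and divisors\<close>

lemma zorder_cong_cosparse: "\<forall>\<^sub>\<approx>z. f z = g z \<Longrightarrow> zorder f z = zorder g z"
  by (rule zorder_cong[OF cosparse_at refl])

lemma is_pole_cong_cosparse:
  fixes f g :: "complex \<Rightarrow> complex"
  shows "\<forall>\<^sub>\<approx>z. f z = g z \<Longrightarrow> is_pole f z = is_pole g z"
  by (rule is_pole_cong[OF cosparse_at refl])

lemma is_pole_iff_zorder: "nzmero f \<Longrightarrow> is_pole f z \<longleftrightarrow> zorder f z < 0"
  using zorder_neg_imp_is_pole nzmeroD isolated_pole_imp_neg_zorder by blast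

lemma nzmero_zorder_mult: "nzmero f \<Longrightarrow> nzmero g \<Longrightarrow> zorder (\<lambda>z. f z * g z) z = zorder f z + zorder g z"
  by (rule zorder_mult) (auto intro: nzmeroD)

lemma nzmero_zorder_powi: "nzmero f \<Longrightarrow> zorder (\<lambda>z. f z powi n) z = n * zorder f z"
  by (rule zorder_power_int) (auto intro: nzmeroD)

lemma nzmero_zorder_inverse: "nzmero f \<Longrightarrow> zorder (\<lambda>z. inverse (f z)) z = - zorder f z"
  using nzmero_zorder_powi[of f "-1"] by (simp add: power_int_minus)

lemma nzmero_zorder_prod:
  "finite A \<Longrightarrow> (\<And>a. a \<in> A \<Longrightarrow> nzmero (f a)) \<Longrightarrow> zorder (\<lambda>z. \<Prod>a\<in>A. f a z) z = (\<Sum>a\<in>A. zorder (f a) z)"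
  by (induction A rule: finite_induct) (auto simp: nzmero_zorder_mult nzmero_prod)

lemma zorder_linear: "zorder (\<lambda>w. w - a) z = (if z = a then 1 else 0)"
proof (cases "z = a")
  case True
  have "zorder (\<lambda>w. w - a) a = 1"
    by (rule zorder_eqI[of UNIV _ "\<lambda>_. 1"]) auto
  then show ?thesis using True by simp
next
  case False
  then show ?thesis by (auto intro!: zorder_eq_0I analytic_intros)
qed

text \<open>The support of the divisor of f in the closed disc. Since \<open>zorder\<close> looks
  only at a punctured neighbourhood, wrong values at removable singularities do not enter.\<close>

definition divs :: "(complex \<Rightarrow> complex) \<Rightarrow> real \<Rightarrow> complex set" where
  "divs f r = {z. norm z \<le> r \<and> zorder f z \<noteq> 0}"

lemma finite_divs: assumes "nzmero f" shows "finite (divs f r)"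
proof -
  have "\<forall>\<^sub>\<approx>z. f analytic_on {z} \<and> f z \<noteq> 0"
    using assms meromorphic_on_imp_analytic_cosparse[of f UNIV] by (auto simp: nzmero_def elim: eventually_elim2)
  from cosparse_finite[OF this, of r] show ?thesis
    by (rule rev_finite_subset) (use zorder_eq_0I[of f] in \<open>auto simp: divs_def\<close>)
qed

lemma analytic_of_zorder:
  assumes "nzmero f" "zorder f z \<ge> 0" shows "remove_sings f analytic_on {z}"
proof -
  have "remove_sings f nicely_meromorphic_on UNIV"
    using assms by (intro remove_sings_nicely_meromorphic) (auto simp: nzmero_def)
  moreover have "\<not> is_pole (remove_sings f) z"
    using assms is_pole_iff_zorder[of f z] nzmeroD(4)[of f z] by simp
  ultimately show ?thesis by (intro nicely_meromorphic_on_imp_analytic_at) auto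
qed

lemma nonzero_of_zorder:
  assumes "nzmero f" "zorder f z = 0" shows "remove_sings f z \<noteq> 0"
proof -
  have "zorder (remove_sings f) z = 0"
    using assms nzmeroD(4)[of f z] by simp
  then show ?thesis
    using zorder_eq_0_iff[OF analytic_of_zorder nzmeroD(3)[OF nzmero_remove_sings]] assms by auto
qed

lemma prod_powi_uminus_cancel:
  assumes "z \<notin> D"
  shows "(\<Prod>a\<in>D. (z - a :: complex) powi n a) * (\<Prod>a\<in>D. (z - a) powi (- n a)) = 1"
  unfolding prod.distrib[symmetric]
proof (intro prod.neutral ballI)
  fix a assume "a \<in> D"
  then have "(z - a) powi n a \<noteq> 0" using assms by auto
  then show "(z - a) powi n a * (z - a) powi (- n a) = 1" unfolding power_int_minus by (rule right_inverse)
qed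

text \<open>\<open>P\<close> is kept general: it is used for all zeros and poles in a disc, for the
  poles in a disc alone, and for all zeros and poles in the plane.\<close>

lemma divide_divisor:
  assumes f: "nzmero f" and fin: "finite P"
    and h_def: "h = (\<lambda>z. f z * (\<Prod>a\<in>P. (z - a) powi (- zorder f a)))"
  shows "nzmero h" and "zorder h z = (if z \<in> P then 0 else zorder f z)"
    and "z \<notin> P \<Longrightarrow> f z = h z * (\<Prod>a\<in>P. (z - a) powi zorder f a)"
proof -
  show "nzmero h" unfolding h_def by (intro nzmero_mult f nzmero_prod nzmero_powi nzmero_diff)
  have "zorder h z = zorder f z + (\<Sum>a\<in>P. - zorder f a * (if z = a then 1 else 0))"
    unfolding h_def using f fin
    by (subst nzmero_zorder_mult) (auto intro!: nzmero_prod nzmero_powi nzmero_diff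
      simp: nzmero_zorder_prod nzmero_zorder_powi zorder_linear nzmero_powi nzmero_diff)
  also have "(\<Sum>a\<in>P. - zorder f a * (if z = a then 1 else 0)) = (\<Sum>a\<in>P. if z = a then - zorder f z else 0)"
    by (intro sum.cong) auto
  also have "\<dots> = (if z \<in> P then - zorder f z else 0)" using fin by simp
  finally show "zorder h z = (if z \<in> P then 0 else zorder f z)" by simp
  show "f z = h z * (\<Prod>a\<in>P. (z - a) powi zorder f a)" if "z \<notin> P"
    using prod_powi_uminus_cancel[OF that, of "zorder f"] by (simp add: h_def mult_ac)
qed

text \<open>\<open>B\<close> absorbs the points where the value of f is accidental as well as the
  zeros and poles. R' exceeds R so that \<open>u\<close> is holomorphic across the circle over which
  means are taken.\<close>

definition represents :: "(complex \<Rightarrow> complex) \<Rightarrow> real \<Rightarrow> (complex \<Rightarrow> complex) \<Rightarrow> real \<Rightarrow> complex set \<Rightarrow> bool" where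
  "represents f R u R' B \<longleftrightarrow> R < R' \<and> u holomorphic_on ball 0 R' \<and> finite B \<and>
     (\<forall>z\<in>ball 0 R' - B. z \<notin> divs f R \<and> f z = exp (u z) * (\<Prod>a\<in>divs f R. (z - a) powi zorder f a))"

lemma representsD:
  assumes "represents f R u R' B"
  shows "R < R'" "u holomorphic_on ball 0 R'" "finite B"
    "z \<in> ball 0 R' - B \<Longrightarrow> z \<notin> divs f R \<and> f z = exp (u z) * (\<Prod>a\<in>divs f R. (z - a) powi zorder f a)"
  using assms by (auto simp: represents_def)

text \<open>With zeros and poles divided out, \<open>k\<close> is analytic and zero-free on the
  closed disc and, as the bad set \<open>X\<close> is closed, on a slightly larger open disc. That
  disc is contractible, so \<open>k\<close> has a logarithm there.\<close>

lemma meromorphic_decomposition: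
  assumes f: "nzmero f" and R: "0 < R"
  shows "\<exists>u R' B. represents f R u R' B"
proof -
  let ?D = "divs f R"
  note fin = finite_divs[OF f, of R]
  define h where "h = (\<lambda>z. f z * (\<Prod>a\<in>?D. (z - a) powi (- zorder f a)))"
  note h = divide_divisor(1)[OF f fin h_def]
  have zh: "zorder h z = 0" if "norm z \<le> R" for z
    using divide_divisor(2)[OF f fin h_def, of z] that by (auto simp: divs_def)
  define k where "k = remove_sings h"
  have k: "nzmero k" unfolding k_def by (rule nzmero_remove_sings[OF h])
  define X where "X = {z. \<not> (k analytic_on {z} \<and> k z \<noteq> 0)}"
  have "\<forall>\<^sub>\<approx>z. k analytic_on {z} \<and> k z \<noteq> 0"
    using k meromorphic_on_imp_analytic_cosparse[of k UNIV] by (auto simp: nzmero_def elim: eventually_elim2)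
  then have "X sparse_in UNIV" by (simp add: eventually_cosparse X_def)
  then have clX: "closed X" by (rule sparse_in_UNIV_imp_closed)
  have disj: "cball 0 R \<inter> X = {}"
    using analytic_of_zorder[OF h] nonzero_of_zorder[OF h] zh by (auto simp: X_def k_def)
  obtain d where d: "d > 0" "\<And>x y. x \<in> cball 0 R \<Longrightarrow> y \<in> X \<Longrightarrow> d \<le> dist x y"
    using separate_compact_closed[OF compact_cball clX disj] by metis
  define R' where "R' = R + d"
  have RR: "R < R'" using d by (simp add: R'_def)
  have sub: "ball 0 R' \<inter> X = {}"
  proof (rule ccontr)
    assume "ball 0 R' \<inter> X \<noteq> {}"
    then obtain z where z: "norm z < R + d" "z \<in> X" by (auto simp: R'_def)
    have zR: "norm z > R" using z disj by force
    then have znz: "norm z > 0" using R by linarith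
    \<comment> \<open>The radial projection of z to the circle of radius R.\<close>
    define x where "x = of_real (R / norm z) * z"
    have "z \<noteq> 0" using znz by simp
    then have "norm x = R" using R by (simp add: x_def norm_mult norm_divide)
    have "x - z = of_real (R / norm z - 1) * z" by (simp add: x_def algebra_simps)
    then have "norm (x - z) = \<bar>R / norm z - 1\<bar> * norm z" by (simp only: norm_mult norm_of_real)
    also have "\<bar>R / norm z - 1\<bar> = 1 - R / norm z" using zR znz by (simp add: abs_if del: zero_less_norm_iff)
    also have "\<dots> * norm z = norm z - R" using znz by (simp add: left_diff_distrib)
    finally have "dist x z < d" using z by (simp add: dist_norm)
    with d(2)[of x z] \<open>norm x = R\<close> z show False by simp
  qed
  have kh: "k holomorphic_on ball 0 R'"
    by (rule analytic_imp_holomorphic, subst analytic_on_analytic_at) (use sub in \<open>auto simp: X_def\<close>)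
  have knz: "k z \<noteq> 0" if "z \<in> ball 0 R'" for z using that sub by (auto simp: X_def)
  obtain u where u: "u holomorphic_on ball 0 R'" "\<And>z. z \<in> ball 0 R' \<Longrightarrow> k z = exp (u z)"
    using contractible_imp_holomorphic_log[OF kh convex_imp_contractible[OF convex_ball] knz] by metis
  have "\<forall>\<^sub>\<approx>z. k z = h z" unfolding k_def using h by (intro eventually_remove_sings_eq) (simp add: nzmero_def)
  from cosparse_finite[OF this, of R'] fin
  have finB: "finite ({z. norm z \<le> R' \<and> k z \<noteq> h z} \<union> ?D)" by simp
  have "z \<notin> divs f R \<and> f z = exp (u z) * (\<Prod>a\<in>?D. (z - a) powi zorder f a)"
    if z: "z \<in> ball 0 R' - ({z. norm z \<le> R' \<and> k z \<noteq> h z} \<union> ?D)" for z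
  proof -
    have "exp (u z) = h z" using z u(2)[of z] by auto
    then show ?thesis using z divide_divisor(3)[OF f fin h_def, of z] by auto
  qed
  then have "represents f R u R' ({z. norm z \<le> R' \<and> k z \<noteq> h z} \<union> ?D)"
    unfolding represents_def using RR u(1) finB by blast
  then show ?thesis by blast
qed

section \<open>The counting function N\<close>

text \<open>The contribution of a simple pole at \<open>a\<close> to \<open>N(r)\<close>.\<close>
definition wt :: "real \<Rightarrow> complex \<Rightarrow> real" where
  "wt r a = (if a = 0 then ln r else if norm a \<le> r then ln (r / norm a) else 0)"

definition pdeg :: "(complex \<Rightarrow> complex) \<Rightarrow> complex \<Rightarrow> real" where
  "pdeg f z = real_of_int (max 0 (- zorder f z))"

lemma pdeg_nonneg: "pdeg f z \<ge> 0" by (simp add: pdeg_def)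

lemma wt_nonneg: "r \<ge> 1 \<Longrightarrow> wt r a \<ge> 0" by (auto simp: wt_def)

lemma wt_has_integral:
  assumes "0 < norm a" "norm a \<le> r"
  shows "((\<lambda>t. if norm a \<le> t then 1 / t else 0) has_integral wt r a) {0..r}"
proof -
  have "((\<lambda>t. 1 / t) has_integral (ln r - ln (norm a))) {norm a..r}"
  proof (rule fundamental_theorem_of_calculus)
    fix x assume "x \<in> {norm a..r}"
    then have "x > 0" using order.strict_trans2[OF assms(1), of x] by auto
    then have "(ln has_real_derivative 1 / x) (at x within {norm a..r})" by (auto intro!: derivative_eq_intros)
    then show "(ln has_vector_derivative 1 / x) (at x within {norm a..r})"
      by (simp add: has_real_derivative_iff_has_vector_derivative)
  qed (use assms in auto)
  then have "((\<lambda>t. if t \<in> {norm a..r} then 1 / t else 0) has_integral (ln r - ln (norm a))) {0..r}"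
    by (subst has_integral_restrict) (use assms in auto)
  then have "((\<lambda>t. if norm a \<le> t then 1 / t else 0) has_integral (ln r - ln (norm a))) {0..r}"
    by (rule has_integral_eq[rotated]) auto
  then show ?thesis using assms by (auto simp: wt_def ln_div)
qed

text \<open>The sum over the poles is integrated term by term. A pole at the origin enters through
  the separate term with ln r, which is why \<open>wt r 0\<close> is ln r.\<close>

lemma nevanlinna_N_eq_poles:
  assumes fin: "finite {z. is_pole h z \<and> norm z \<le> r}" and r: "0 < r"
  shows "nevanlinna_N h r = (\<Sum>z | is_pole h z \<and> norm z \<le> r. real_of_int (- zorder h z) * wt r z)"
proof -
  let ?P = "{z. is_pole h z \<and> norm z \<le> r}"
  let ?c = "\<lambda>z. real_of_int (- zorder h z)"
  have fin': "finite (?P - {0})" using fin by simp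
  have p0: "pole_count h 0 = (if 0 \<in> ?P then ?c 0 else 0)"
  proof -
    have "{z. is_pole h z \<and> norm z \<le> 0} = (if 0 \<in> ?P then {0} else {})" using r by auto
    then show ?thesis unfolding pole_count_def by simp
  qed
  have pc: "pole_count h t - pole_count h 0 = (\<Sum>z\<in>?P - {0}. if norm z \<le> t then ?c z else 0)"
    if t: "t \<in> {0..r}" for t
  proof -
    have "(\<Sum>z\<in>?P - {0}. if norm z \<le> t then ?c z else 0) = (\<Sum>z\<in>{z\<in>?P - {0}. norm z \<le> t}. ?c z)"
      using sum.inter_filter[OF fin', of ?c "\<lambda>z. norm z \<le> t"] by simp
    moreover have "pole_count h t = (\<Sum>z\<in>{z\<in>?P - {0}. norm z \<le> t}. ?c z) + pole_count h 0"
    proof -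
      have eq: "{z. is_pole h z \<and> norm z \<le> t} = {z\<in>?P - {0}. norm z \<le> t} \<union> (if 0 \<in> ?P then {0} else {})"
        using t r by auto
      show ?thesis unfolding pole_count_def[of h t] eq p0
      proof (subst sum.union_disjoint)
        show "finite {z \<in> ?P - {0}. norm z \<le> t}" by (rule rev_finite_subset[OF fin]) auto
      qed auto
    qed
    ultimately show ?thesis by simp
  qed
  have "((\<lambda>t. \<Sum>z\<in>?P - {0}. ?c z * (if norm z \<le> t then 1 / t else 0)) has_integral (\<Sum>z\<in>?P - {0}. ?c z * wt r z)) {0..r}"
    by (intro has_integral_sum fin' has_integral_mult_right wt_has_integral) auto
  then have "((\<lambda>t. (pole_count h t - pole_count h 0) / t) has_integral (\<Sum>z\<in>?P - {0}. ?c z * wt r z)) {0..r}"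
    by (rule has_integral_eq[rotated]) (simp add: pc sum_divide_distrib, intro sum.cong, auto)
  then have "nevanlinna_N h r = (\<Sum>z\<in>?P - {0}. ?c z * wt r z) + pole_count h 0 * ln r"
    unfolding nevanlinna_N_def by (simp add: integral_unique)
  also have "\<dots> = (\<Sum>z\<in>?P. ?c z * wt r z)"
  proof (cases "0 \<in> ?P")
    case True
    then show ?thesis using fin by (subst sum.remove[OF fin True]) (simp add: p0 wt_def)
  qed (use r in \<open>auto simp: p0\<close>)
  finally show ?thesis .
qed

text \<open>\<open>S\<close> may exceed the divisor, so that the counting functions of several
  functions become sums over one common set.\<close>

lemma nevanlinna_N_eq:
  assumes h: "nzmero h" and r: "0 < r" and S: "finite S" "divs h r \<subseteq> S" "S \<subseteq> cball 0 r"
  shows "nevanlinna_N h r = (\<Sum>z\<in>S. pdeg h z * wt r z)"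
proof -
  have sub: "{z. is_pole h z \<and> norm z \<le> r} \<subseteq> S" using S is_pole_iff_zorder[OF h] by (auto simp: divs_def)
  then have "nevanlinna_N h r = (\<Sum>z | is_pole h z \<and> norm z \<le> r. real_of_int (- zorder h z) * wt r z)"
    using nevanlinna_N_eq_poles[OF finite_subset[OF sub S(1)] r] by simp
  also have "\<dots> = (\<Sum>z | is_pole h z \<and> norm z \<le> r. pdeg h z * wt r z)"
    using is_pole_iff_zorder[OF h] by (intro sum.cong) (auto simp: pdeg_def)
  also have "\<dots> = (\<Sum>z\<in>S. pdeg h z * wt r z)"
    by (rule sum.mono_neutral_left[OF S(1) sub]) (use S is_pole_iff_zorder[OF h] in \<open>auto simp: pdeg_def\<close>)
  finally show ?thesis .
qed

lemma nevanlinna_N_nonneg: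
  assumes h: "nzmero h" and r: "1 \<le> r" shows "0 \<le> nevanlinna_N h r"
proof -
  have "nevanlinna_N h r = (\<Sum>z\<in>divs h r. pdeg h z * wt r z)"
    by (rule nevanlinna_N_eq[OF h _ finite_divs[OF h]]) (use r in \<open>auto simp: divs_def\<close>)
  then show ?thesis using r by (auto intro!: sum_nonneg mult_nonneg_nonneg pdeg_nonneg wt_nonneg)
qed

section \<open>The proximity function m and Jensen's formula\<close>

lemma log_plus_eq_max: "0 \<le> x \<Longrightarrow> log_plus x = max 0 (ln x)"
proof -
  assume "0 \<le> x"
  then consider "x = 0" | "0 < x" "x \<le> 1" | "1 < x" by linarith
  then show ?thesis by cases (auto simp: log_plus_def max_def)
qed

lemma log_plus_nonneg: "0 \<le> log_plus x" by (simp add: log_plus_def)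

lemma ln_eq_log_plus: "0 \<le> x \<Longrightarrow> ln x = log_plus x - log_plus (inverse x)"
  \<comment> \<open>At 0 both sides vanish, since \<open>ln 0 = 0\<close> and
    \<open>inverse 0 = 0\<close>.\<close>
  by (cases "x = 0") (auto simp: log_plus_eq_max max_def ln_inverse)

lemma abs_ln_eq_log_plus: "0 \<le> x \<Longrightarrow> \<bar>ln x\<bar> = log_plus x + log_plus (inverse x)"
  by (cases "x = 0") (auto simp: log_plus_eq_max max_def ln_inverse)

lemma log_plus_mono: "x \<le> y \<Longrightarrow> log_plus x \<le> log_plus y"
  by (auto simp: log_plus_def)

lemma log_plus_mult: "0 \<le> x \<Longrightarrow> 0 \<le> y \<Longrightarrow> log_plus (x * y) \<le> log_plus x + log_plus y"
proof (cases "x = 0 \<or> y = 0")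
  case False
  assume "0 \<le> x" "0 \<le> y"
  then show ?thesis using False by (simp add: log_plus_eq_max ln_mult)
qed (auto simp: log_plus_def)

lemma nevanlinna_m_eq_cmean: "nevanlinna_m h r = cmean (\<lambda>z. log_plus (norm (h z))) r"
  by (simp add: nevanlinna_m_def cmean_def)

lemma nevanlinna_m_nonneg: "0 \<le> nevanlinna_m h r"
  unfolding nevanlinna_m_eq_cmean by (rule cmean_nonneg) (rule log_plus_nonneg)

lemma nevanlinna_m_cong:
  fixes f g :: "complex \<Rightarrow> complex"
  assumes "\<forall>\<^sub>\<approx>z. f z = g z" "r > 0" shows "nevanlinna_m f r = nevanlinna_m g r"
  unfolding nevanlinna_m_eq_cmean
  by (rule cint_cong(2)[OF assms(2) cosparse_finite[OF assms(1), of r]]) auto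

lemma nevanlinna_N_cong:
  fixes f g :: "complex \<Rightarrow> complex"
  assumes "\<forall>\<^sub>\<approx>z. f z = g z" shows "nevanlinna_N f r = nevanlinna_N g r"
  unfolding nevanlinna_N_def pole_count_def using zorder_cong_cosparse[OF assms] is_pole_cong_cosparse[OF assms] by simp

lemma nevanlinna_T_cong:
  fixes f g :: "complex \<Rightarrow> complex"
  assumes "\<forall>\<^sub>\<approx>z. f z = g z" "r > 0" shows "nevanlinna_T f r = nevanlinna_T g r"
  unfolding nevanlinna_T_def using nevanlinna_m_cong[OF assms] nevanlinna_N_cong[OF assms(1)] by simp

lemma nevanlinna_const:
  fixes c :: complex
  shows
  "nevanlinna_m (\<lambda>_. c) r = log_plus (norm c)" "nevanlinna_N (\<lambda>_. c) r = 0" "nevanlinna_T (\<lambda>_. c) r = log_plus (norm c)"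
proof -
  show 1: "nevanlinna_m (\<lambda>_. c) r = log_plus (norm c)" unfolding nevanlinna_m_eq_cmean by simp
  have "\<not> is_pole (\<lambda>_. c) z" for z :: complex using not_is_pole_holomorphic[of UNIV z "\<lambda>_. c"] by auto
  then show 2: "nevanlinna_N (\<lambda>_. c) r = 0" unfolding nevanlinna_N_def pole_count_def by simp
  show "nevanlinna_T (\<lambda>_. c) r = log_plus (norm c)" unfolding nevanlinna_T_def 1 2 by simp
qed

lemma ln_powi: "x > 0 \<Longrightarrow> ln (x powi n) = of_int n * ln (x::real)"
  by (cases n rule: int_cases4) (auto simp: ln_realpow power_int_minus ln_inverse)

lemma ln_norm_decomposition:
  assumes f: "nzmero f" and z: "z \<notin> divs f R" "f z = exp (u z) * (\<Prod>a\<in>divs f R. (z - a) powi zorder f a)"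
  shows "f z \<noteq> 0" "ln (norm (f z)) = Re (u z) + (\<Sum>a\<in>divs f R. real_of_int (zorder f a) * ln (norm (z - a)))"
proof -
  note fin = finite_divs[OF f, of R]
  have nz: "norm (z - a) > 0" if "a \<in> divs f R" for a using that z by auto
  then have nz': "norm (z - a) powi zorder f a > 0" if "a \<in> divs f R" for a using that by (intro zero_less_power_int) auto
  have n: "norm (f z) = exp (Re (u z)) * (\<Prod>a\<in>divs f R. norm (z - a) powi zorder f a)"
    unfolding z(2) norm_mult norm_exp_eq_Re by (simp add: prod_norm[symmetric] norm_power_int)
  have p: "(\<Prod>a\<in>divs f R. norm (z - a) powi zorder f a) > 0" by (intro prod_pos nz')
  then have "norm (f z) > 0" unfolding n by simp
  then show "f z \<noteq> 0" by simp
  have "ln (norm (f z)) = Re (u z) + ln (\<Prod>a\<in>divs f R. norm (z - a) powi zorder f a)"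
    unfolding n using p by (subst ln_mult) auto
  also have "ln (\<Prod>a\<in>divs f R. norm (z - a) powi zorder f a) = (\<Sum>a\<in>divs f R. ln (norm (z - a) powi zorder f a))"
    using nz' by (intro ln_prod fin) force
  also have "\<dots> = (\<Sum>a\<in>divs f R. real_of_int (zorder f a) * ln (norm (z - a)))"
    using nz by (intro sum.cong ln_powi) auto
  finally show "ln (norm (f z)) = Re (u z) + (\<Sum>a\<in>divs f R. real_of_int (zorder f a) * ln (norm (z - a)))" .
qed

text \<open>Logarithm of the modulus of the leading Laurent coefficient at the origin.\<close>
definition lcn :: "(complex \<Rightarrow> complex) \<Rightarrow> real" where
  "lcn f = ln (norm (Lim (at 0) (\<lambda>z. f z * z powi (- zorder f 0))))"

text \<open>Near 0 the factor belonging to the origin cancels, and the remaining factors are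
  continuous, so the limit is their value at 0.\<close>

lemma lcn_eq:
  assumes f: "nzmero f" and R0: "0 < R" and rep: "represents f R u R' B"
  shows "lcn f = Re (u 0) + (\<Sum>a\<in>divs f R - {0}. real_of_int (zorder f a) * ln (norm a))"
proof -
  note R = R0 representsD[OF rep]
  note fin = finite_divs[OF f, of R]
  let ?D = "divs f R - {0}"
  let ?g = "\<lambda>z. exp (u z) * (\<Prod>a\<in>?D. (z - a) powi zorder f a)"
  have "isCont u 0" using R by (intro continuous_on_interior[OF holomorphic_on_imp_continuous_on[OF R(3)]]) auto
  then have "((\<lambda>z. u z) \<longlongrightarrow> u 0) (at 0)" by (simp add: isCont_def)
  then have "(?g \<longlongrightarrow> ?g 0) (at 0)"
    by (intro tendsto_intros) auto
  moreover have "eventually (\<lambda>z. ?g z = f z * z powi (- zorder f 0)) (at 0)"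
  proof -
    \<comment> \<open>The origin may belong to \<open>B\<close>; deleting only the other points of
      \<open>B\<close> leaves an open neighbourhood of 0, and the limit ignores 0 itself.\<close>
    have "eventually (\<lambda>z. z \<in> ball 0 R' - (B - {0})) (nhds (0::complex))"
      using R by (intro eventually_nhds_in_open open_Diff finite_imp_closed) auto
    then have "eventually (\<lambda>z. z \<in> ball 0 R' - (B - {0})) (at (0::complex))" by (simp add: eventually_nhds_conv_at)
    moreover have "eventually (\<lambda>z. z \<noteq> 0) (at (0::complex))" by (auto simp: eventually_at_filter)
    ultimately show ?thesis
    proof eventually_elim
      case (elim z)
      then have fz: "f z = exp (u z) * (\<Prod>a\<in>divs f R. (z - a) powi zorder f a)" using R(5)[of z] by auto
      have zz: "z powi zorder f 0 * z powi (- zorder f 0) = 1"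
        using elim by (simp add: power_int_minus)
      show ?case
      proof (cases "0 \<in> divs f R")
        case True
        have "(\<Prod>a\<in>divs f R. (z - a) powi zorder f a) = z powi zorder f 0 * (\<Prod>a\<in>?D. (z - a) powi zorder f a)"
          using prod.remove[OF fin True, of "\<lambda>a. (z - a) powi zorder f a"] by simp
        then show ?thesis using zz by (simp add: fz mult_ac)
      next
        case False
        then have "zorder f 0 = 0" using R by (auto simp: divs_def)
        then show ?thesis using False fz by simp
      qed
    qed
  qed
  ultimately have "((\<lambda>z. f z * z powi (- zorder f 0)) \<longlongrightarrow> ?g 0) (at 0)"
    by (rule Lim_transform_eventually)
  then have L: "Lim (at 0) (\<lambda>z. f z * z powi (- zorder f 0)) = ?g 0" by (intro tendsto_Lim) auto
  have nz': "norm a powi zorder f a > 0" if "a \<in> ?D" for a using that by (intro zero_less_power_int) auto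
  have "norm (?g 0) = exp (Re (u 0)) * (\<Prod>a\<in>?D. norm a powi zorder f a)"
    unfolding norm_mult norm_exp_eq_Re by (simp add: prod_norm[symmetric] norm_power_int)
  moreover have "(\<Prod>a\<in>?D. norm a powi zorder f a) > 0" by (intro prod_pos nz')
  ultimately have "lcn f = Re (u 0) + ln (\<Prod>a\<in>?D. norm a powi zorder f a)"
    unfolding lcn_def L by (simp only:) (subst ln_mult, auto)
  also have "ln (\<Prod>a\<in>?D. norm a powi zorder f a) = (\<Sum>a\<in>?D. ln (norm a powi zorder f a))"
    using nz' fin by (intro ln_prod) force+
  also have "\<dots> = (\<Sum>a\<in>?D. real_of_int (zorder f a) * ln (norm a))"
    by (intro sum.cong ln_powi) auto
  finally show ?thesis .
qed

text \<open>Every linear factor at a point of the closed disc has mean logarithm ln r, and Re u has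
  mean Re (u 0); what remains is to sort the constants.\<close>

lemma Jensen_formula:
  assumes f: "nzmero f" and r: "0 < r"
  shows "cint (\<lambda>z. ln (norm (f z))) r"
    and "cmean (\<lambda>z. ln (norm (f z))) r = lcn f + (\<Sum>a\<in>divs f r. real_of_int (zorder f a) * wt r a)"
proof -
  obtain u R' B where rep: "represents f r u R' B" using meromorphic_decomposition[OF f r] by blast
  note d = representsD[OF rep]
  note fin = finite_divs[OF f, of r]
  let ?\<psi> = "\<lambda>z. Re (u z) + (\<Sum>a\<in>divs f r. real_of_int (zorder f a) * ln (norm (z - a)))"
  have eq: "ln (norm (f z)) = ?\<psi> z" if "norm z = r" "z \<notin> B" for z
    using d(4)[of z] that d(1) by (intro ln_norm_decomposition[OF f]) auto
  have c1: "cint (\<lambda>z. \<Sum>a\<in>divs f r. real_of_int (zorder f a) * ln (norm (z - a))) r"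
    by (intro cint_sum fin cint_cmult cint_ln_norm_diff r)
  have c2: "cint (\<lambda>z. Re (u z)) r" by (rule cint_Re_holomorphic[OF d(2) r d(1)])
  show "cint (\<lambda>z. ln (norm (f z))) r"
    using cint_cong(1)[OF r d(3) eq] cint_add[OF c2 c1] by simp
  have "cmean (\<lambda>z. ln (norm (f z))) r = Re (u 0) + (\<Sum>a\<in>divs f r. real_of_int (zorder f a) * ln r)"
  proof -
    have "cmean (\<lambda>z. ln (norm (f z))) r = cmean ?\<psi> r" by (rule cint_cong(2)[OF r d(3) eq])
    also have "\<dots> = cmean (\<lambda>z. Re (u z)) r + cmean (\<lambda>z. \<Sum>a\<in>divs f r. real_of_int (zorder f a) * ln (norm (z - a))) r"
      by (rule cmean_add[OF c2 c1])
    also have "cmean (\<lambda>z. Re (u z)) r = Re (u 0)" by (rule cmean_Re_holomorphic[OF d(2) r d(1)])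
    also have "cmean (\<lambda>z. \<Sum>a\<in>divs f r. real_of_int (zorder f a) * ln (norm (z - a))) r
       = (\<Sum>a\<in>divs f r. real_of_int (zorder f a) * cmean (\<lambda>z. ln (norm (z - a))) r)"
      by (subst cmean_sum[OF fin]) (auto intro!: cint_cmult cint_ln_norm_diff r simp: cmean_cmult)
    also have "\<dots> = (\<Sum>a\<in>divs f r. real_of_int (zorder f a) * ln r)"
      by (intro sum.cong refl) (auto simp: cmean_ln_norm_diff[OF r] divs_def max_def)
    finally show ?thesis .
  qed
  \<comment> \<open>ln r = ln |a| + wt r a for nonzero a. The terms ln |a| belong to
    \<open>lcn f\<close>; at the origin \<open>wt r 0\<close> is all of ln r.\<close>
  also have "(\<Sum>a\<in>divs f r. real_of_int (zorder f a) * ln r)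
      = (\<Sum>a\<in>divs f r. real_of_int (zorder f a) * (if a = 0 then 0 else ln (norm a))) + (\<Sum>a\<in>divs f r. real_of_int (zorder f a) * wt r a)"
    unfolding sum.distrib[symmetric] 
    by (intro sum.cong refl) (use r in \<open>auto simp: wt_def divs_def ln_div algebra_simps\<close>)
  also have "(\<Sum>a\<in>divs f r. real_of_int (zorder f a) * (if a = 0 then 0 else ln (norm a)))
      = (\<Sum>a\<in>divs f r - {0}. real_of_int (zorder f a) * ln (norm a))"
    by (rule sum.mono_neutral_cong_right) (use fin in auto)
  finally show "cmean (\<lambda>z. ln (norm (f z))) r = lcn f + (\<Sum>a\<in>divs f r. real_of_int (zorder f a) * wt r a)"
    using lcn_eq[OF f r rep] by simp
qed

section \<open>The first main theorem and rules for T\<close>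

lemma cint_log_plus:
  assumes f: "f meromorphic_on UNIV" and r: "0 < r"
  shows "cint (\<lambda>z. log_plus (norm (f z))) r"
proof (cases "nzmero f")
  case True
  have "cint (\<lambda>z. max 0 (ln (norm (f z)))) r" by (rule cint_max[OF cint_const Jensen_formula(1)[OF True r]])
  then show ?thesis by (simp add: log_plus_eq_max)
next
  case False
  then have z: "\<forall>\<^sub>\<approx>z. f z = 0" using nzmero_or_zero[OF f] by simp
  have "cint (\<lambda>z. log_plus (norm (f z))) r \<longleftrightarrow> cint (\<lambda>z. 0) r"
    by (rule cint_cong(1)[OF r cosparse_finite[OF z, of r]]) (auto simp: log_plus_def)
  then show ?thesis by simp
qed

lemma nevanlinna_m_mono:
  assumes "f meromorphic_on UNIV" "cint \<psi> r" "0 < r" "finite B"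
    "\<And>z. norm z = r \<Longrightarrow> z \<notin> B \<Longrightarrow> log_plus (norm (f z)) \<le> \<psi> z"
  shows "nevanlinna_m f r \<le> cmean \<psi> r"
  unfolding nevanlinna_m_eq_cmean by (rule cmean_mono_strong[OF assms(3,4) cint_log_plus]) (use assms in auto)

lemma divs_inverse: "nzmero f \<Longrightarrow> divs (\<lambda>z. inverse (f z)) r = divs f r"
  by (auto simp: divs_def nzmero_zorder_inverse)

lemma divs_sub_cball: "divs f r \<subseteq> cball 0 r" by (auto simp: divs_def)

text \<open>Jensen's formula sorted by sign: ln |f| splits into two \<open>log_plus\<close> terms,
  and \<open>zorder f\<close> into the pole multiplicity of 1/f minus that of f.\<close>

lemma first_main_theorem:
  assumes f: "nzmero f" and r: "0 < r"
  shows "nevanlinna_T (\<lambda>z. inverse (f z)) r = nevanlinna_T f r - lcn f"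
proof -
  have f': "nzmero (\<lambda>z. inverse (f z))" by (rule nzmero_inverse[OF f])
  have mer: "f meromorphic_on UNIV" "(\<lambda>z. inverse (f z)) meromorphic_on UNIV" using f f' by (auto simp: nzmero_def)
  have "cmean (\<lambda>z. ln (norm (f z))) r = cmean (\<lambda>z. log_plus (norm (f z)) + - log_plus (norm (inverse (f z)))) r"
    unfolding norm_inverse by (subst ln_eq_log_plus) simp_all
  also have "\<dots> = nevanlinna_m f r - nevanlinna_m (\<lambda>z. inverse (f z)) r"
    unfolding nevanlinna_m_eq_cmean
    by (subst cmean_add[OF cint_log_plus[OF mer(1) r] cint_minus[OF cint_log_plus[OF mer(2) r]]])
       (simp only: cmean_minus add_uminus_conv_diff)
  finally have 1: "nevanlinna_m f r - nevanlinna_m (\<lambda>z. inverse (f z)) r = lcn f + (\<Sum>a\<in>divs f r. real_of_int (zorder f a) * wt r a)"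
    using Jensen_formula(2)[OF f r] by simp
  have "nevanlinna_N (\<lambda>z. inverse (f z)) r - nevanlinna_N f r = (\<Sum>a\<in>divs f r. pdeg (\<lambda>z. inverse (f z)) a * wt r a - pdeg f a * wt r a)"
    unfolding sum_subtractf
    using nevanlinna_N_eq[OF f r finite_divs[OF f] order.refl divs_sub_cball]
      nevanlinna_N_eq[OF f' r finite_divs[OF f'] order.refl divs_sub_cball] divs_inverse[OF f] by simp
  also have "\<dots> = (\<Sum>a\<in>divs f r. real_of_int (zorder f a) * wt r a)"
    by (intro sum.cong refl) (simp add: pdeg_def nzmero_zorder_inverse[OF f] left_diff_distrib[symmetric] max_def)
  finally show ?thesis using 1 unfolding nevanlinna_T_def by simp
qed

lemma nevanlinna_T_nonneg: "nzmero f \<Longrightarrow> 1 \<le> r \<Longrightarrow> 0 \<le> nevanlinna_T f r"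
  unfolding nevanlinna_T_def using nevanlinna_m_nonneg nevanlinna_N_nonneg by (simp add: add_nonneg_nonneg)

lemma nevanlinna_m_mult:
  assumes "f meromorphic_on UNIV" "g meromorphic_on UNIV" "0 < r"
  shows "nevanlinna_m (\<lambda>z. f z * g z) r \<le> nevanlinna_m f r + nevanlinna_m g r"
proof -
  have "nevanlinna_m (\<lambda>z. f z * g z) r \<le> cmean (\<lambda>z. log_plus (norm (f z)) + log_plus (norm (g z))) r"
    by (rule nevanlinna_m_mono[of _ _ _ "{}"])
       (use assms in \<open>auto intro!: meromorphic_intros cint_add cint_log_plus log_plus_mult simp: norm_mult\<close>)
  also have "\<dots> = nevanlinna_m f r + nevanlinna_m g r"
    unfolding nevanlinna_m_eq_cmean by (rule cmean_add; rule cint_log_plus; use assms in simp)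
  finally show ?thesis .
qed

text \<open>Multiplicities are compared point by point, with weights that are nonnegative because r
  >= 1. A one-point \<open>S\<close> compares with a single function; an empty \<open>S\<close>
  expresses the absence of poles.\<close>

lemma nevanlinna_N_le:
  assumes f: "nzmero f" and r: "1 \<le> r" and S: "finite S" "\<And>a. a \<in> S \<Longrightarrow> nzmero (g a)" "\<And>a. a \<in> S \<Longrightarrow> 0 \<le> c a"
    and le: "\<And>z. norm z \<le> r \<Longrightarrow> pdeg f z \<le> (\<Sum>a\<in>S. c a * pdeg (g a) z)"
  shows "nevanlinna_N f r \<le> (\<Sum>a\<in>S. c a * nevanlinna_N (g a) r)"
proof -
  have r0: "0 < r" using r by simp
  let ?U = "divs f r \<union> (\<Union>a\<in>S. divs (g a) r)"
  have U: "finite ?U" "?U \<subseteq> cball 0 r" using S finite_divs[OF f] finite_divs by (auto simp: divs_def)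
  have "nevanlinna_N f r = (\<Sum>z\<in>?U. pdeg f z * wt r z)"
    by (rule nevanlinna_N_eq[OF f r0 U(1) _ U(2)]) auto
  also have "\<dots> \<le> (\<Sum>z\<in>?U. (\<Sum>a\<in>S. c a * pdeg (g a) z) * wt r z)"
    using U by (intro sum_mono mult_right_mono le wt_nonneg r) auto
  also have "\<dots> = (\<Sum>a\<in>S. \<Sum>z\<in>?U. c a * (pdeg (g a) z * wt r z))"
    unfolding sum_distrib_right by (subst sum.swap) (simp add: mult.assoc)
  also have "\<dots> = (\<Sum>a\<in>S. c a * nevanlinna_N (g a) r)"
    unfolding sum_distrib_left[symmetric]
    by (intro sum.cong refl arg_cong2[of _ _ _ _ "(*)"] nevanlinna_N_eq[symmetric] S r0 U) auto
  finally show ?thesis .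
qed

lemma nevanlinna_T_mult:
  assumes f: "nzmero f" and g: "nzmero g" and r: "1 \<le> r"
  shows "nevanlinna_T (\<lambda>z. f z * g z) r \<le> nevanlinna_T f r + nevanlinna_T g r"
proof -
  have "nevanlinna_N (\<lambda>z. f z * g z) r \<le> (\<Sum>a\<in>{True,False}. 1 * nevanlinna_N (if a then f else g) r)"
    by (rule nevanlinna_N_le) (use f g r in \<open>auto intro: nzmero_mult simp: pdeg_def nzmero_zorder_mult\<close>)
  moreover have "nevanlinna_m (\<lambda>z. f z * g z) r \<le> nevanlinna_m f r + nevanlinna_m g r"
    by (rule nevanlinna_m_mult) (use f g r in \<open>auto simp: nzmero_def\<close>)
  ultimately show ?thesis unfolding nevanlinna_T_def by simp
qed

lemma nevanlinna_T_power:
  assumes f: "nzmero f" and r: "1 \<le> r"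
  shows "nevanlinna_T (\<lambda>z. f z ^ n) r \<le> n * nevanlinna_T f r"
proof (induction n)
  case (Suc n)
  have "nevanlinna_T (\<lambda>z. f z ^ Suc n) r \<le> nevanlinna_T f r + nevanlinna_T (\<lambda>z. f z ^ n) r"
    unfolding power_Suc by (rule nevanlinna_T_mult[OF f nzmero_power[OF f] r])
  with Suc show ?case by (simp add: algebra_simps)
qed (simp add: nevanlinna_const log_plus_def)

lemma nevanlinna_T_prod:
  assumes "finite A" "\<And>a. a \<in> A \<Longrightarrow> nzmero (f a)" "1 \<le> r"
  shows "nevanlinna_T (\<lambda>z. \<Prod>a\<in>A. f a z) r \<le> (\<Sum>a\<in>A. nevanlinna_T (f a) r)"
  using assms(1,2)
proof (induction A rule: finite_induct)
  case (insert a A)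
  have "nevanlinna_T (\<lambda>z. f a z * (\<Prod>a\<in>A. f a z)) r \<le> nevanlinna_T (f a) r + nevanlinna_T (\<lambda>z. \<Prod>a\<in>A. f a z) r"
    by (rule nevanlinna_T_mult) (use insert assms in \<open>auto intro: nzmero_prod\<close>)
  with insert show ?case by simp
qed (simp add: nevanlinna_const log_plus_def)

lemma log_plus_add: "0 \<le> x \<Longrightarrow> 0 \<le> y \<Longrightarrow> log_plus (x + y) \<le> log_plus x + log_plus y + ln 2"
proof -
  assume xy: "0 \<le> x" "0 \<le> y"
  have "log_plus (x + y) \<le> log_plus (2 * max x y)" by (rule log_plus_mono) auto
  also have "\<dots> \<le> log_plus 2 + log_plus (max x y)" by (rule log_plus_mult) (use xy in auto)
  also have "\<dots> \<le> log_plus x + log_plus y + ln 2"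
    using log_plus_nonneg[of x] log_plus_nonneg[of y] by (auto simp: log_plus_def[of 2] max_def)
  finally show ?thesis .
qed

lemma nevanlinna_m_diff_const:
  assumes "f meromorphic_on UNIV" "0 < r"
  shows "nevanlinna_m (\<lambda>z. f z - c) r \<le> nevanlinna_m f r + (log_plus (norm c) + ln 2)"
proof -
  have "nevanlinna_m (\<lambda>z. f z - c) r \<le> cmean (\<lambda>z. log_plus (norm (f z)) + (log_plus (norm c) + ln 2)) r"
  proof (rule nevanlinna_m_mono[of _ _ _ "{}"])
    fix z
    have "log_plus (norm (f z - c)) \<le> log_plus (norm (f z) + norm c)" by (rule log_plus_mono[OF norm_triangle_ineq4])
    also have "\<dots> \<le> log_plus (norm (f z)) + log_plus (norm c) + ln 2" by (rule log_plus_add) auto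
    finally show "log_plus (norm (f z - c)) \<le> log_plus (norm (f z)) + (log_plus (norm c) + ln 2)" by simp
  qed (use assms in \<open>auto intro!: meromorphic_intros cint_add cint_log_plus\<close>)
  also have "\<dots> = nevanlinna_m f r + (log_plus (norm c) + ln 2)"
    unfolding nevanlinna_m_eq_cmean by (subst cmean_add) (use assms in \<open>auto intro!: cint_log_plus\<close>)
  finally show ?thesis .
qed

lemma nevanlinna_T_diff_const:
  assumes f: "nzmero f" "nzmero (\<lambda>z. f z - c)" and r: "1 \<le> r"
  shows "nevanlinna_T (\<lambda>z. f z - c) r \<le> nevanlinna_T f r + (log_plus (norm c) + ln 2)"
proof -
  have "pdeg (\<lambda>z. f z - c) z \<le> pdeg f z" for z
  \<comment> \<open>The order of the constant function c is meaningful only for nonzero c.\<close>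
  proof (cases "c = 0")
    case False
    have "zorder (\<lambda>z. f z - c) z \<ge> min (zorder f z) (zorder (\<lambda>_. c) z)"
      by (rule zorder_diff_ge)
         (use nzmeroD[OF f(1)] nzmeroD[OF f(2)] nzmeroD[OF nzmero_const[OF False]] in auto)
    then show ?thesis using False by (auto simp: pdeg_def)
  qed simp
  then have "nevanlinna_N (\<lambda>z. f z - c) r \<le> (\<Sum>a\<in>{()}. 1 * nevanlinna_N f r)"
    by (intro nevanlinna_N_le f r) auto
  moreover have "nevanlinna_m (\<lambda>z. f z - c) r \<le> nevanlinna_m f r + (log_plus (norm c) + ln 2)"
    by (rule nevanlinna_m_diff_const) (use f r in \<open>auto simp: nzmero_def\<close>)
  ultimately show ?thesis unfolding nevanlinna_T_def by simp
qed

section \<open>Local representation and logarithmic derivatives\<close>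

text \<open>In classical notation n(R, f) + n(R, 1/f).\<close>

definition ncount :: "(complex \<Rightarrow> complex) \<Rightarrow> real \<Rightarrow> real" where
  "ncount f R = (\<Sum>a\<in>divs f R. \<bar>real_of_int (zorder f a)\<bar>)"

lemma ncount_nonneg: "0 \<le> ncount f R" by (simp add: ncount_def sum_nonneg)

lemma nevanlinna_N_le_T: "nevanlinna_N f r \<le> nevanlinna_T f r"
  unfolding nevanlinna_T_def using nevanlinna_m_nonneg by simp

text \<open>A point of the smaller disc has \<open>wt R1 a\<close> at least ln (R1 / R); summing
  over zeros and poles gives N(R1, f) + N(R1, 1/f), which the first main theorem bounds.\<close>

lemma ncount_le_T:
  assumes f: "nzmero f" and R: "1 \<le> R" "R \<le> R1"
  shows "ncount f R * ln (R1 / R) \<le> 2 * nevanlinna_T f R1 - lcn f"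
proof -
  have R1: "1 \<le> R1" "0 < R1" using R by auto
  note fin = finite_divs[OF f]
  have sub: "divs f R \<subseteq> divs f R1" using R by (auto simp: divs_def)
  have "ncount f R * ln (R1 / R) = (\<Sum>a\<in>divs f R. \<bar>real_of_int (zorder f a)\<bar> * ln (R1 / R))"
    unfolding ncount_def sum_distrib_right ..
  also have "\<dots> \<le> (\<Sum>a\<in>divs f R. \<bar>real_of_int (zorder f a)\<bar> * wt R1 a)"
  proof (intro sum_mono mult_left_mono)
    fix a assume "a \<in> divs f R"
    then have a: "norm a \<le> R" by (simp add: divs_def)
    show "ln (R1 / R) \<le> wt R1 a"
    proof (cases "a = 0")
      case True
      have "R1 / R \<le> R1 / 1" using R R1 by (intro divide_left_mono) auto
      then show ?thesis using True R R1 by (simp add: wt_def)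
    next
      case False
      have "R1 / R \<le> R1 / norm a" using R R1 a False by (intro divide_left_mono) auto
      then show ?thesis using False a R R1 by (auto simp: wt_def)
    qed
  qed auto
  also have "\<dots> \<le> (\<Sum>a\<in>divs f R1. \<bar>real_of_int (zorder f a)\<bar> * wt R1 a)"
    by (rule sum_mono2[OF fin sub]) (auto intro!: mult_nonneg_nonneg wt_nonneg R1)
  also have "\<dots> = (\<Sum>a\<in>divs f R1. pdeg f a * wt R1 a) + (\<Sum>a\<in>divs f R1. pdeg (\<lambda>z. inverse (f z)) a * wt R1 a)"
    unfolding sum.distrib[symmetric]
    by (intro sum.cong refl) (simp add: pdeg_def nzmero_zorder_inverse[OF f] ring_distribs(2)[symmetric] max_def)
  also have "(\<Sum>a\<in>divs f R1. pdeg f a * wt R1 a) = nevanlinna_N f R1"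
    by (rule nevanlinna_N_eq[OF f R1(2) fin order.refl divs_sub_cball, symmetric])
  also have "(\<Sum>a\<in>divs f R1. pdeg (\<lambda>z. inverse (f z)) a * wt R1 a) = nevanlinna_N (\<lambda>z. inverse (f z)) R1"
    by (rule nevanlinna_N_eq[OF nzmero_inverse[OF f] R1(2) fin _ divs_sub_cball, symmetric]) (simp add: divs_inverse[OF f])
  also have "nevanlinna_N f R1 + nevanlinna_N (\<lambda>z. inverse (f z)) R1 \<le> nevanlinna_T f R1 + nevanlinna_T (\<lambda>z. inverse (f z)) R1"
    using nevanlinna_N_le_T by (intro add_mono)
  also have "\<dots> = 2 * nevanlinna_T f R1 - lcn f" using first_main_theorem[OF f R1(2)] by simp
  finally show ?thesis .
qed

text \<open>On the circle Re u is ln |f| minus the logarithms of the linear factors. The mean of |ln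
  |f|| is m(R, f) + m(R, 1/f), and each factor costs at most ln R + 2 ln 2 by
  \<open>cmean_abs_ln_norm_diff\<close>.\<close>

lemma local_representation:
  assumes f: "nzmero f" and R: "1 \<le> R"
  obtains u R' B where "represents f R u R' B"
    "cmean (\<lambda>z. \<bar>Re (u z)\<bar>) R \<le> 2 * nevanlinna_T f R - lcn f + ncount f R * (ln R + 2 * ln 2)"
proof -
  have R0: "0 < R" using R by simp
  obtain u R' B where rep: "represents f R u R' B" using meromorphic_decomposition[OF f R0] by blast
  note d = representsD[OF rep]
  note fin = finite_divs[OF f, of R]
  note f' = nzmero_inverse[OF f]
  have mer: "f meromorphic_on UNIV" "(\<lambda>z. inverse (f z)) meromorphic_on UNIV" using f f' by (auto simp: nzmero_def)
  let ?\<psi> = "\<lambda>z. \<Sum>a\<in>divs f R. \<bar>real_of_int (zorder f a)\<bar> * \<bar>ln (norm (z - a))\<bar>"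
  let ?\<phi> = "\<lambda>z. log_plus (norm (f z)) + log_plus (norm (inverse (f z)))"
  have c1: "cint ?\<psi> R" by (intro cint_sum fin cint_cmult cint_abs cint_ln_norm_diff R0)
  have c2: "cint ?\<phi> R" by (intro cint_add cint_log_plus mer R0)
  have "cmean (\<lambda>z. \<bar>Re (u z)\<bar>) R \<le> cmean (\<lambda>z. ?\<phi> z + ?\<psi> z) R"
  proof (rule cmean_mono_strong[OF R0 d(3)])
    fix z assume z: "norm z = R" "z \<notin> B"
    have "ln (norm (f z)) = Re (u z) + (\<Sum>a\<in>divs f R. real_of_int (zorder f a) * ln (norm (z - a)))"
      using d(4)[of z] z d(1) by (intro ln_norm_decomposition[OF f]) auto
    then have "\<bar>Re (u z)\<bar> \<le> \<bar>ln (norm (f z))\<bar> + \<bar>\<Sum>a\<in>divs f R. real_of_int (zorder f a) * ln (norm (z - a))\<bar>" by linarith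
    also have "\<bar>ln (norm (f z))\<bar> = ?\<phi> z" using abs_ln_eq_log_plus[of "norm (f z)"] by (simp add: norm_inverse)
    also have "\<bar>\<Sum>a\<in>divs f R. real_of_int (zorder f a) * ln (norm (z - a))\<bar> \<le> ?\<psi> z"
      unfolding abs_mult[symmetric] by (rule sum_abs)
    finally show "\<bar>Re (u z)\<bar> \<le> ?\<phi> z + ?\<psi> z" by simp
  qed (intro cint_abs cint_Re_holomorphic[OF d(2) R0 d(1)] cint_add c1 c2)+
  also have "\<dots> = cmean ?\<phi> R + cmean ?\<psi> R" by (rule cmean_add[OF c2 c1])
  also have "cmean ?\<phi> R = nevanlinna_m f R + nevanlinna_m (\<lambda>z. inverse (f z)) R"
    unfolding nevanlinna_m_eq_cmean by (intro cmean_add cint_log_plus mer R0)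
  also have "\<dots> \<le> nevanlinna_T f R + nevanlinna_T (\<lambda>z. inverse (f z)) R"
    unfolding nevanlinna_T_def using nevanlinna_N_nonneg[OF f R] nevanlinna_N_nonneg[OF f' R] by simp
  also have "\<dots> = 2 * nevanlinna_T f R - lcn f" using first_main_theorem[OF f R0] by simp
  also have "cmean ?\<psi> R = (\<Sum>a\<in>divs f R. \<bar>real_of_int (zorder f a)\<bar> * cmean (\<lambda>z. \<bar>ln (norm (z - a))\<bar>) R)"
    by (subst cmean_sum[OF fin]) (auto intro!: cint_cmult cint_abs cint_ln_norm_diff R0 simp: cmean_cmult)
  also have "\<dots> \<le> (\<Sum>a\<in>divs f R. \<bar>real_of_int (zorder f a)\<bar> * (ln R + 2 * ln 2))"
    by (intro sum_mono mult_left_mono cmean_abs_ln_norm_diff R) (auto simp: divs_def)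
  also have "\<dots> = ncount f R * (ln R + 2 * ln 2)" unfolding ncount_def sum_distrib_right ..
  finally show ?thesis using that[OF rep] by simp
qed

section \<open>Bounds for u inside the disc\<close>

text \<open>A common bound for the mean of \<open>\<bar>Re u\<bar>\<close>, for \<open>ncount f R\<close> and for \<open>ncount f R * ln R\<close>.\<close>
definition Tb :: "(complex \<Rightarrow> complex) \<Rightarrow> real \<Rightarrow> real" where
  "Tb f R = 2 * nevanlinna_T f R + 6 * nevanlinna_T f (R\<^sup>2) + 4 * \<bar>lcn f\<bar>"

lemma ln2_ge_half: "1/2 \<le> ln (2::real)"
  using ln_le_minus_one[of "1/2::real"] by (simp add: ln_div)

text \<open>\<open>ncount_le_T\<close> is used with outer radius R^2. The factor 3 is there because
  ln R + 2 ln 2 <= 3 ln R for R >= 2; the bound for \<open>ncount\<close> alone uses ln R >=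
  1/2.\<close>

lemma ncount_ln_le_Tb:
  assumes f: "nzmero f" and R: "2 \<le> R"
  shows "3 * (ncount f R * ln R) \<le> 6 * nevanlinna_T f (R\<^sup>2) + 3 * \<bar>lcn f\<bar>" "ncount f R * ln R \<le> Tb f R" "ncount f R \<le> Tb f R"
proof -
  have R2: "R \<le> R\<^sup>2" using R by (simp add: power2_eq_square)
  have T: "0 \<le> nevanlinna_T f R" "0 \<le> nevanlinna_T f (R\<^sup>2)" using R R2 by (auto intro!: nevanlinna_T_nonneg f)
  have "ncount f R * ln R \<le> 2 * nevanlinna_T f (R\<^sup>2) - lcn f"
    using ncount_le_T[OF f, of R "R\<^sup>2"] R R2 by (simp add: power2_eq_square)
  then show 1: "3 * (ncount f R * ln R) \<le> 6 * nevanlinna_T f (R\<^sup>2) + 3 * \<bar>lcn f\<bar>" by linarith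
  show 2: "ncount f R * ln R \<le> Tb f R" unfolding Tb_def using 1 T by linarith
  have "1/2 \<le> ln R" using ln2_ge_half R order.trans[OF ln2_ge_half, of "ln R"] by simp
  then have "ncount f R * (1/2) \<le> ncount f R * ln R" by (intro mult_left_mono ncount_nonneg)
  then show "ncount f R \<le> Tb f R" unfolding Tb_def using 1 T by linarith
qed

lemma Tb_nonneg: "nzmero f \<Longrightarrow> 2 \<le> R \<Longrightarrow> 0 \<le> Tb f R"
  using ncount_ln_le_Tb(3) ncount_nonneg order.trans by blast

lemma cmean_Re_le_Tb:
  assumes f: "nzmero f" and R: "2 \<le> R"
    and "A \<le> 2 * nevanlinna_T f R - lcn f + ncount f R * (ln R + 2 * ln 2)"
  shows "A \<le> Tb f R"
proof -
  have "ln 2 \<le> ln R" using R by simp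
  then have "ncount f R * (ln R + 2 * ln 2) \<le> ncount f R * (3 * ln R)" by (intro mult_left_mono ncount_nonneg) auto
  then show ?thesis using assms(3) ncount_ln_le_Tb(1)[OF f R] unfolding Tb_def by linarith
qed

text \<open>For |z| <= R/2 the factor in \<open>Schwarz_bound\<close> is at most 4; at the origin it
  is 2 and bounds 2 |Re (u 0)|. Hence 5 = 4 + 1.\<close>

lemma Schwarz_Re_bound:
  fixes u :: "complex \<Rightarrow> complex"
  assumes u: "u holomorphic_on ball 0 R'" and R: "0 < R" "R < R'" and z: "norm z \<le> R / 2"
  shows "\<bar>Re (u z)\<bar> \<le> 5 * cmean (\<lambda>z. \<bar>Re (u z)\<bar>) R"
proof -
  let ?K = "cmean (\<lambda>z. \<bar>Re (u z)\<bar>) R"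
  have K: "0 \<le> ?K" by (rule cmean_nonneg) auto
  have "norm (u z + cnj (u 0)) \<le> 2 * R / (R - norm z) * ?K" by (rule Schwarz_bound[OF u R]) (use z R in auto)
  also have "2 * R / (R - norm z) \<le> 2 * R / (R / 2)" using z R by (intro divide_left_mono mult_pos_pos) auto
  then have "2 * R / (R - norm z) * ?K \<le> 2 * R / (R / 2) * ?K" using K by (rule mult_right_mono)
  also have "\<dots> = 4 * ?K" using R by simp
  finally have 1: "\<bar>Re (u z + cnj (u 0))\<bar> \<le> 4 * ?K" using abs_Re_le_cmod order.trans by blast
  have "norm (u 0 + cnj (u 0)) \<le> 2 * R / (R - norm (0::complex)) * ?K" by (rule Schwarz_bound[OF u R]) (use z R in auto)
  also have "\<dots> = 2 * ?K" using R by simp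
  finally have 2: "\<bar>Re (u 0 + cnj (u 0))\<bar> \<le> 2 * ?K" using abs_Re_le_cmod order.trans by blast
  show ?thesis using 1 2 by simp
qed

text \<open>Cauchy's estimate on the circle of radius R/4 about z. There |w| <= 3 R / 4, so the
  factor in \<open>Schwarz_bound\<close> is at most 8, and 8 / (R/4) = 32 / R. Adding the constant
  \<open>cnj (u 0)\<close> leaves the derivative unchanged.\<close>

lemma Schwarz_deriv_bound:
  fixes u :: "complex \<Rightarrow> complex"
  assumes u: "u holomorphic_on ball 0 R'" and R: "0 < R" "R < R'" and z: "norm z \<le> R / 2"
  shows "norm (deriv u z) \<le> 32 * cmean (\<lambda>z. \<bar>Re (u z)\<bar>) R / R"
proof -
  let ?K = "cmean (\<lambda>z. \<bar>Re (u z)\<bar>) R"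
  let ?v = "\<lambda>w. u w + cnj (u 0)"
  have K: "0 \<le> ?K" by (rule cmean_nonneg) auto
  have sub: "norm w \<le> 3 * R / 4" if "w \<in> cball z (R / 4)" for w
    using norm_triangle_ineq2[of w z] that z by (simp add: dist_norm norm_minus_commute)
  have sub2: "cball z (R/4) \<subseteq> ball 0 R'" 
  proof
    fix w assume "w \<in> cball z (R/4)" from sub[OF this] show "w \<in> ball 0 R'" using R by simp
  qed
  have v: "?v holomorphic_on ball 0 R'" by (intro holomorphic_intros u)
  have "norm ((deriv ^^ 1) ?v z) \<le> fact 1 * (8 * ?K) / (R/4) ^ 1"
  proof (rule Cauchy_inequality)
    show "?v holomorphic_on ball z (R/4)" by (rule holomorphic_on_subset[OF v]) (use sub2 ball_subset_cball in blast)
    show "continuous_on (cball z (R/4)) ?v" by (rule continuous_on_subset[OF holomorphic_on_imp_continuous_on[OF v] sub2])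
    fix w assume w: "norm (z - w) = R / 4"
    have nw: "norm w \<le> 3 * R / 4" using sub[of w] w by (simp add: dist_norm)
    have "norm (?v w) \<le> 2 * R / (R - norm w) * ?K" by (rule Schwarz_bound[OF u R]) (use nw R in auto)
    also have "2 * R / (R - norm w) \<le> 2 * R / (R / 4)" using nw R by (intro divide_left_mono mult_pos_pos) auto
    then have "2 * R / (R - norm w) * ?K \<le> 2 * R / (R / 4) * ?K" using K by (rule mult_right_mono)
    also have "\<dots> = 8 * ?K" using R by simp
    finally show "norm (?v w) \<le> 8 * ?K" .
  qed (use R in auto)
  moreover have "deriv ?v z = deriv u z"
  proof (rule DERIV_imp_deriv)
    have "z \<in> ball 0 R'" using sub2 R by (auto simp: subset_iff)
    then have "(u has_field_derivative deriv u z) (at z)" using holomorphic_derivI[OF u] by auto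
    then show "(?v has_field_derivative deriv u z) (at z)" by (auto intro!: derivative_eq_intros)
  qed
  ultimately show ?thesis by simp
qed

section \<open>The lemma on the logarithmic derivative\<close>

lemma has_field_derivative_prod_powi:
  assumes "finite D" "z \<notin> D"
  shows "((\<lambda>z. \<Prod>a\<in>D. (z - a) powi n a) has_field_derivative
     (\<Prod>a\<in>D. (z - a) powi n a) * (\<Sum>a\<in>D. of_int (n a) / (z - a))) (at (z::complex))"
  using assms
proof (induction D rule: finite_induct)
  case (insert a D)
  have nz: "z - a \<noteq> 0" using insert by auto
  have 1: "((\<lambda>z. (z - a) powi n a) has_field_derivative (z - a) powi n a * (of_int (n a) / (z - a))) (at z)"
    using nz by (auto intro!: derivative_eq_intros simp: power_int_diff)
  have 2: "((\<lambda>z. (\<Prod>a\<in>D. (z - a) powi n a)) has_field_derivative (\<Prod>a\<in>D. (z - a) powi n a) * (\<Sum>a\<in>D. of_int (n a) / (z - a))) (at z)"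
    using insert by auto
  show ?case
    using DERIV_mult[OF 1 2] insert(1,2) by (simp add: algebra_simps)
qed auto

lemma deriv_of_representation:
  assumes f: "nzmero f" and rep: "represents f R u R' B" and z: "z \<in> ball 0 R' - B"
  shows "deriv f z / f z = deriv u z + (\<Sum>a\<in>divs f R. of_int (zorder f a) / (z - a))"
proof -
  let ?D = "divs f R"
  let ?p = "\<lambda>z. \<Prod>a\<in>?D. (z - a) powi zorder f a"
  note d = representsD[OF rep] and fin = finite_divs[OF f, of R]
  have zD: "z \<notin> ?D" "f z = exp (u z) * ?p z" using d(4)[OF z] by auto
  have du: "(u has_field_derivative deriv u z) (at z)" using holomorphic_derivI[OF d(2), of z] z by auto
  then have "((\<lambda>z. exp (u z)) has_field_derivative exp (u z) * deriv u z) (at z)"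
    by (auto intro!: derivative_eq_intros)
  from DERIV_mult[OF this has_field_derivative_prod_powi[OF fin zD(1), of "zorder f"]]
  have "((\<lambda>z. exp (u z) * ?p z) has_field_derivative f z * (deriv u z + (\<Sum>a\<in>?D. of_int (zorder f a) / (z - a)))) (at z)"
    by (simp add: zD algebra_simps)
  \<comment> \<open>As \<open>B\<close> is finite, the representation holds in a whole neighbourhood
    of z and may be differentiated.\<close>
  moreover have "eventually (\<lambda>z. f z = exp (u z) * ?p z) (nhds z)"
    by (rule eventually_mono[OF eventually_nhds_in_open[of "ball 0 R' - B"]])
       (use d(3,4) z in \<open>auto intro!: open_Diff finite_imp_closed\<close>)
  ultimately have "deriv f z = f z * (deriv u z + (\<Sum>a\<in>?D. of_int (zorder f a) / (z - a)))"
    by (subst deriv_cong_ev[OF _ refl]) (auto intro: DERIV_imp_deriv)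
  moreover have "f z \<noteq> 0" using zD fin by auto
  ultimately show ?thesis by simp
qed

lemma sqrt_sum_le:
  assumes "finite A" "\<And>a. a \<in> A \<Longrightarrow> 0 \<le> f a"
  shows "sqrt (\<Sum>a\<in>A. f a) \<le> (\<Sum>a\<in>A. sqrt (f a))"
  using assms
proof (induction A rule: finite_induct)
  case (insert a A)
  have "sqrt (f a + sum f A) \<le> sqrt (f a) + sqrt (sum f A)"
    using insert by (intro sqrt_add_le_add_sqrt sum_nonneg) auto
  with insert show ?case by simp
qed auto

text \<open>
  The mean of \<open>log\<^sup>+ \<bar>f'/f\<bar>\<close> is controlled, via concavity of \<open>ln\<close>, by that of \<open>sqrt \<bar>f'/f\<bar>\<close>; the square root
  makes the singularities \<open>1/(z - a)\<close> integrable uniformly in \<open>a\<close>.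
\<close>
lemma logarithmic_derivative_lemma:
  obtains C where "C > 0"
    "\<And>f r. nzmero f \<Longrightarrow> 1 \<le> r \<Longrightarrow> nevanlinna_m (\<lambda>z. deriv f z / f z) r \<le> 2 * ln (2 + C * Tb f (2 * r))"
proof -
  \<comment> \<open>Bounds the mean of 1 / sqrt |z - a| over circles of radius at least 1.\<close>
  define c where "c = 16 * sqrt (4*pi) / pi"
  have c: "c \<ge> 0" by (simp add: c_def)
  have main: "nevanlinna_m (\<lambda>z. deriv f z / f z) r \<le> 2 * ln (2 + (32 + c) * Tb f (2 * r))"
    if f: "nzmero f" and r: "1 \<le> r" for f r
  proof -
    have r0: "0 < r" using r by simp
    \<comment> \<open>Doubling puts the circle of radius r at half the outer radius, where
      \<open>Schwarz_deriv_bound\<close> applies.\<close>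
    let ?R = "2 * r"
    let ?K = "Tb f ?R"
    let ?D = "divs f ?R"
    have R: "1 \<le> ?R" "2 \<le> ?R" using r by auto
    have K: "?K \<ge> 0" by (rule Tb_nonneg[OF f R(2)])
    obtain u R' B where rep: "represents f ?R u R' B"
      "cmean (\<lambda>z. \<bar>Re (u z)\<bar>) ?R \<le> 2 * nevanlinna_T f ?R - lcn f + ncount f ?R * (ln ?R + 2 * ln 2)"
      using local_representation[OF f R(1)] by blast
    note d = representsD[OF rep(1)] rep(2)
    note fin = finite_divs[OF f, of ?R]
    have A: "cmean (\<lambda>z. \<bar>Re (u z)\<bar>) ?R \<le> ?K" by (rule cmean_Re_le_Tb[OF f R(2) d(5)])
    let ?S = "\<lambda>z. \<Sum>a\<in>?D. \<bar>real_of_int (zorder f a)\<bar> * (1 / sqrt (norm (z - a)))"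
    let ?\<psi> = "\<lambda>z. (2 + 32 * ?K) + ?S z"
    define M where "M = 2 + (32 + c) * ?K"
    have M: "M > 0" using K c by (simp add: M_def add_pos_nonneg)
    have cS: "cint ?S r" by (intro cint_sum fin cint_cmult inverse_sqrt_norm_diff r0)
    have c\<psi>: "cint ?\<psi> r" by (intro cint_add cint_const cS)
    have mer: "(\<lambda>z. deriv f z / f z) meromorphic_on UNIV" using f by (auto simp: nzmero_def intro!: meromorphic_intros)
    \<comment> \<open>The right side is twice the tangent of ln at \<open>M\<close>: ln y <= ln M +
      y / M - 1. As \<open>M\<close> bounds the mean of \<open>?\<psi>\<close>, averaging yields 2
      ln M; this is Jensen's inequality for the concave ln. The factor 2 comes from x = sqrt x *
      sqrt x.\<close>
    have "nevanlinna_m (\<lambda>z. deriv f z / f z) r \<le> cmean (\<lambda>z. (2 * ln M - 2) + 2 / M * ?\<psi> z) r"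
    proof (rule nevanlinna_m_mono[OF mer _ r0 d(3)])
      show "cint (\<lambda>z. (2 * ln M - 2) + 2 / M * ?\<psi> z) r" by (rule cint_add[OF cint_const cint_cmult[OF c\<psi>]])
      fix z assume z: "norm z = r" "z \<notin> B"
      have zb: "z \<in> ball 0 R' - B" using z d(1) r by auto
      have eq: "deriv f z / f z = deriv u z + (\<Sum>a\<in>?D. of_int (zorder f a) / (z - a))"
        by (rule deriv_of_representation[OF f rep(1) zb])
      have "norm (deriv u z) \<le> 32 * cmean (\<lambda>z. \<bar>Re (u z)\<bar>) ?R / ?R"
        by (rule Schwarz_deriv_bound[OF d(2) _ d(1)]) (use z r in auto)
      also have "\<dots> \<le> 32 * ?K / 1" using A K R by (intro frac_le) auto
      finally have du: "norm (deriv u z) \<le> 32 * ?K" by simp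
      let ?x = "norm (deriv f z / f z)"
      have "?x \<le> 32 * ?K + (\<Sum>a\<in>?D. \<bar>real_of_int (zorder f a)\<bar> / norm (z - a))"
      proof -
        have "?x \<le> norm (deriv u z) + norm (\<Sum>a\<in>?D. of_int (zorder f a) / (z - a))" unfolding eq by (rule norm_triangle_ineq)
        also have "norm (\<Sum>a\<in>?D. of_int (zorder f a) / (z - a)) \<le> (\<Sum>a\<in>?D. \<bar>real_of_int (zorder f a)\<bar> / norm (z - a))"
          by (rule sum_norm_le) (simp add: norm_divide)
        finally show ?thesis using du by simp
      qed
      then have "sqrt ?x \<le> sqrt (32 * ?K + (\<Sum>a\<in>?D. \<bar>real_of_int (zorder f a)\<bar> / norm (z - a)))" by simp
      also have "\<dots> \<le> sqrt (32 * ?K) + sqrt (\<Sum>a\<in>?D. \<bar>real_of_int (zorder f a)\<bar> / norm (z - a))"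
        using K by (intro sqrt_add_le_add_sqrt sum_nonneg) auto
      also have "sqrt (\<Sum>a\<in>?D. \<bar>real_of_int (zorder f a)\<bar> / norm (z - a)) \<le> (\<Sum>a\<in>?D. sqrt (\<bar>real_of_int (zorder f a)\<bar> / norm (z - a)))"
        by (rule sqrt_sum_le[OF fin]) auto
      also have "\<dots> \<le> ?S z"
      proof (intro sum_mono)
        fix a assume "a \<in> ?D"
        \<comment> \<open>A nonzero order is an integer, so its absolute value is at least 1 and
          dominates its square root.\<close>
        have "sqrt \<bar>real_of_int (zorder f a)\<bar> \<le> \<bar>real_of_int (zorder f a)\<bar>"
        proof (cases "zorder f a = 0")
          case False
          then have "1 \<le> \<bar>real_of_int (zorder f a)\<bar>" by linarith
          then have "\<bar>real_of_int (zorder f a)\<bar> * 1 \<le> \<bar>real_of_int (zorder f a)\<bar> * \<bar>real_of_int (zorder f a)\<bar>"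
            by (intro mult_left_mono) auto
          then show ?thesis by (intro real_le_lsqrt) (simp_all add: power2_eq_square)
        qed simp
        then show "sqrt (\<bar>real_of_int (zorder f a)\<bar> / norm (z - a)) \<le> \<bar>real_of_int (zorder f a)\<bar> * (1 / sqrt (norm (z - a)))"
          by (simp add: real_sqrt_divide divide_right_mono)
      qed
      also have "sqrt (32 * ?K) \<le> 1 + 32 * ?K"
      proof (rule real_le_lsqrt)
        show "32 * ?K \<le> (1 + 32 * ?K)\<^sup>2" using K by (simp add: power2_eq_square algebra_simps)
      qed (use K in auto)
      finally have s: "1 + sqrt ?x \<le> ?\<psi> z" by simp
      have p: "0 < 1 + sqrt ?x" by (simp add: add_pos_nonneg)
      have "log_plus ?x = log_plus (sqrt ?x * sqrt ?x)" by simp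
      also have "\<dots> \<le> log_plus (sqrt ?x) + log_plus (sqrt ?x)" by (rule log_plus_mult) auto
      also have "log_plus (sqrt ?x) \<le> ln (1 + sqrt ?x)"
      proof -
        have "log_plus y \<le> ln (1 + y)" if "0 \<le> y" for y :: real using that by (auto simp: log_plus_def)
        then show ?thesis by simp
      qed
      finally have "log_plus ?x \<le> 2 * ln (1 + sqrt ?x)" by simp
      also have "ln (1 + sqrt ?x) = ln M + ln ((1 + sqrt ?x) / M)" using M p by (subst ln_div) auto
      also have "ln ((1 + sqrt ?x) / M) \<le> (1 + sqrt ?x) / M - 1" using M p by (intro ln_le_minus_one) auto
      also have "(1 + sqrt ?x) / M \<le> ?\<psi> z / M" by (rule divide_right_mono[OF s]) (use M in auto)
      finally show "log_plus ?x \<le> (2 * ln M - 2) + 2 / M * ?\<psi> z" by simp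
    qed
    also have "\<dots> = (2 * ln M - 2) + 2 / M * cmean ?\<psi> r"
      by (subst cmean_add[OF cint_const cint_cmult[OF c\<psi>]]) (simp only: cmean_cmult cmean_const)
    also have "cmean ?\<psi> r = 2 + 32 * ?K + (\<Sum>a\<in>?D. \<bar>real_of_int (zorder f a)\<bar> * cmean (\<lambda>z. 1 / sqrt (norm (z - a))) r)"
      by (subst cmean_add[OF cint_const cS], subst cmean_sum[OF fin])
         (auto intro!: cint_cmult inverse_sqrt_norm_diff r0 simp only: cmean_cmult cmean_const)
    also have "(\<Sum>a\<in>?D. \<bar>real_of_int (zorder f a)\<bar> * cmean (\<lambda>z. 1 / sqrt (norm (z - a))) r) \<le> (\<Sum>a\<in>?D. \<bar>real_of_int (zorder f a)\<bar> * c)"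
    proof (intro sum_mono mult_left_mono)
      fix a
      have "cmean (\<lambda>z. 1 / sqrt (norm (z - a))) r \<le> 16 * sqrt (4*pi) / (pi * sqrt r)" by (rule inverse_sqrt_norm_diff[OF r0])
      also have "\<dots> \<le> 16 * sqrt (4*pi) / (pi * 1)" using r by (intro divide_left_mono mult_left_mono mult_pos_pos) auto
      finally show "cmean (\<lambda>z. 1 / sqrt (norm (z - a))) r \<le> c" by (simp add: c_def)
    qed auto
    also have "\<dots> = ncount f ?R * c" unfolding ncount_def sum_distrib_right ..
    also have "\<dots> \<le> ?K * c" using ncount_ln_le_Tb(3)[OF f R(2)] c by (rule mult_right_mono)
    also have "2 + 32 * ?K + ?K * c = M" by (simp add: M_def algebra_simps)
    finally have "nevanlinna_m (\<lambda>z. deriv f z / f z) r \<le> 2 * ln M - 2 + 2 / M * M" using M by (simp add: mult_left_mono divide_right_mono)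
    moreover have "2 / M * M = 2" using M by simp
    ultimately have "nevanlinna_m (\<lambda>z. deriv f z / f z) r \<le> 2 * ln M" by linarith
    then show ?thesis unfolding M_def .
  qed
  show ?thesis using that[of "32 + c"] main c by (simp add: add_pos_nonneg)
qed

section \<open>Composition and growth\<close>

text \<open>A nonconstant g omits the value g z0 in a punctured neighbourhood of z0, so g z tends to
  g z0 through values different from g z0; for constant g this fails.\<close>

lemma cosparse_compose:
  fixes g :: "complex \<Rightarrow> complex"
  assumes g: "g holomorphic_on UNIV" "\<not> g constant_on UNIV" and P: "\<forall>\<^sub>\<approx>w. P w"
  shows "\<forall>\<^sub>\<approx>z. P (g z)"
proof (subst eventually_cosparse_open_eq[OF open_UNIV], intro ballI)
  fix z0 :: complex
  have nz: "nzmero (\<lambda>z. g z - g z0)"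
  proof (rule nzmero_entire)
    show "\<exists>z. g z - g z0 \<noteq> 0" using g(2) by (auto simp: constant_on_def)
  qed (intro holomorphic_intros g)
  have "(g \<longlongrightarrow> g z0) (at z0)"
    using g(1) by (metis UNIV_I at_within_open continuous_on_def holomorphic_on_imp_continuous_on open_UNIV)
  moreover have "eventually (\<lambda>z. g z \<noteq> g z0) (at z0)"
    using nzmeroD(2)[OF nz, of z0] by simp
  ultimately have "filterlim g (at (g z0)) (at z0)" by (simp add: filterlim_at)
  moreover have "eventually P (at (g z0))" by (rule cosparse_at[OF P])
  ultimately show "eventually (\<lambda>z. P (g z)) (at z0)" by (simp add: filterlim_iff)
qed

lemma nzmero_compose:
  assumes "nzmero f" "g holomorphic_on UNIV" "\<not> g constant_on UNIV"
  shows "nzmero (\<lambda>z. f (g z))"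
  unfolding nzmero_def
proof
  show "(\<lambda>z. f (g z)) meromorphic_on UNIV"
    by (rule meromorphic_on_compose[of f UNIV]) (use assms in \<open>auto simp: nzmero_def analytic_on_open\<close>)
  show "\<forall>\<^sub>\<approx>z. f (g z) \<noteq> 0" by (rule cosparse_compose[OF assms(2,3)]) (use assms in \<open>simp add: nzmero_def\<close>)
qed

lemma nevanlinna_T_holomorphic_le:
  assumes "g holomorphic_on UNIV" "0 < r" "\<And>z. norm z = r \<Longrightarrow> norm (g z) \<le> K" "1 \<le> K"
  shows "nevanlinna_T g r \<le> ln K"
proof -
  have np: "\<not> is_pole g z" for z using not_is_pole_holomorphic[of UNIV z g] assms by auto
  then have "nevanlinna_N g r = 0" unfolding nevanlinna_N_def pole_count_def by simp
  moreover have "nevanlinna_m g r \<le> cmean (\<lambda>_. ln K) r"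
  proof (rule nevanlinna_m_mono[of _ _ _ "{}"])
    show "g meromorphic_on UNIV" using assms(1) by (intro analytic_on_imp_meromorphic_on) (simp add: analytic_on_open)
    fix z :: complex assume "norm z = r"
    then have "log_plus (norm (g z)) \<le> log_plus K" using assms(3) by (intro log_plus_mono) auto
    then show "log_plus (norm (g z)) \<le> ln K" using assms(4) by (auto simp: log_plus_def split: if_splits)
  qed (use assms in auto)
  ultimately show ?thesis unfolding nevanlinna_T_def by simp
qed

lemma powi_neg_eq_inverse_power: "n < 0 \<Longrightarrow> (x::complex) powi n = (inverse x) ^ nat (- n)"
  by (simp add: power_int_def)

text \<open>The first main theorem for g - b costs - lcn (g - b), which is - ln |g 0 - b| when b
  differs from g 0. Poles of f do not accumulate at g 0, so those other than g 0 keep a distance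
  \<delta> from it; b = g 0 adds one more constant.\<close>

lemma lcn_shift_bounded:
  assumes f: "nzmero f" and g: "g holomorphic_on UNIV" "\<not> g constant_on UNIV"
  obtains C where "C \<ge> 0" "\<And>b. zorder f b < 0 \<Longrightarrow> - lcn (\<lambda>z. g z - b) \<le> C"
proof -
  have "eventually (\<lambda>w. \<not> is_pole f w) (at (g 0))"
    using meromorphic_on_imp_not_pole_cosparse[of f UNIV] f by (auto simp: nzmero_def intro: cosparse_at)
  then obtain \<delta> where \<delta>: "\<delta> > 0" "\<And>w. w \<noteq> g 0 \<Longrightarrow> dist w (g 0) < \<delta> \<Longrightarrow> \<not> is_pole f w"
    by (auto simp: eventually_at)
  let ?C = "max 0 (max (- ln \<delta>) (- lcn (\<lambda>z. g z - g 0)))"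
  have "- lcn (\<lambda>z. g z - b) \<le> ?C" if b: "zorder f b < 0" for b
  proof (cases "b = g 0")
    case False
    have "is_pole f b" using b is_pole_iff_zorder[OF f] by simp
    then have d: "\<delta> \<le> norm (g 0 - b)" using \<delta>(2)[of b] False by (force simp: dist_norm norm_minus_commute)
    have "(\<lambda>z. g z - b) analytic_on {0}"
      by (rule holomorphic_on_imp_analytic_at[of _ UNIV]) (auto intro!: holomorphic_intros g)
    then have zo: "zorder (\<lambda>z. g z - b) 0 = 0" using False by (intro zorder_eq_0I) auto
    have "(g \<longlongrightarrow> g 0) (at 0)"
      using g(1) by (metis UNIV_I at_within_open continuous_on_def holomorphic_on_imp_continuous_on open_UNIV)
    then have "((\<lambda>z. g z - b) \<longlongrightarrow> g 0 - b) (at 0)" by (intro tendsto_intros)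
    then have "Lim (at 0) (\<lambda>z. g z - b) = g 0 - b" by (intro tendsto_Lim) auto
    then have "lcn (\<lambda>z. g z - b) = ln (norm (g 0 - b))" unfolding lcn_def zo by simp
    moreover have "ln \<delta> \<le> ln (norm (g 0 - b))" using d \<delta>(1) by (subst ln_le_cancel_iff) linarith+
    ultimately show ?thesis by simp
  qed simp
  then show ?thesis using that[of ?C] by auto
qed

lemma log_plus_exp: "0 \<le> y \<Longrightarrow> log_plus (exp y) = y"
  by (cases "y = 0") (auto simp: log_plus_def)

text \<open>
  With the poles \<open>b\<close> of \<open>f\<close> in the disc split off, \<open>f = H * \<Prod>(w - b) powi -k\<close>, the factor \<open>H \<circ> g\<close> is
  bounded on the circle, and each \<open>1/(g - b)\<close> has the characteristic of \<open>g - b\<close> up to a constant that does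
  not depend on \<open>b\<close>.
\<close>
lemma nevanlinna_T_compose:
  assumes f: "nzmero f" and g: "g holomorphic_on UNIV" "\<not> g constant_on UNIV"
  obtains C where "C > 0"
    "\<And>r R. 1 \<le> r \<Longrightarrow> 2 \<le> R \<Longrightarrow> (\<And>z. norm z \<le> r \<Longrightarrow> norm (g z) \<le> R / 2) \<Longrightarrow> nevanlinna_T (\<lambda>z. f (g z)) r \<le> C * Tb f R"
proof -
  obtain Cg where Cg: "Cg \<ge> 0" "\<And>b. zorder f b < 0 \<Longrightarrow> - lcn (\<lambda>z. g z - b) \<le> Cg"
    using lcn_shift_bounded[OF f g] by metis
  have main: "nevanlinna_T (\<lambda>z. f (g z)) r \<le> (9 + Cg) * Tb f R"
    if r: "1 \<le> r" and R: "2 \<le> R" and gR: "\<And>z. norm z \<le> r \<Longrightarrow> norm (g z) \<le> R / 2" for r R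
  proof -
    let ?K = "Tb f R"
    let ?D = "divs f R"
    define P where "P = {a\<in>?D. zorder f a < 0}"
    have r0: "0 < r" and R1: "1 \<le> R" and R0: "0 < R" using r R by auto
    note fin = finite_divs[OF f, of R]
    have finP: "finite P" using fin by (simp add: P_def)
    have K: "?K \<ge> 0" by (rule Tb_nonneg[OF f R])
    obtain u R' B where rep: "represents f R u R' B"
      "cmean (\<lambda>z. \<bar>Re (u z)\<bar>) R \<le> 2 * nevanlinna_T f R - lcn f + ncount f R * (ln R + 2 * ln 2)"
      using local_representation[OF f R1] by blast
    note d = representsD[OF rep(1)] rep(2)
    have A: "cmean (\<lambda>z. \<bar>Re (u z)\<bar>) R \<le> ?K" by (rule cmean_Re_le_Tb[OF f R d(5)])
    have ln2R: "ln (2 * R) \<le> 2 * ln R" "0 \<le> ln (2 * R)" "0 \<le> ln R" using R by (auto simp: ln_mult)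
    define H where "H = (\<lambda>w. f w * (\<Prod>a\<in>P. (w - a) powi (- zorder f a)))"
    note H = divide_divisor(1)[OF f finP H_def]
    have gb: "nzmero (\<lambda>z. g z - b)" for b
      using nzmero_compose[OF nzmero_diff[of b] g] .
    have Hg: "nzmero (\<lambda>z. H (g z))" by (rule nzmero_compose[OF H g])
    have Hord: "zorder H w \<ge> 0" if "norm w \<le> R" for w
      using divide_divisor(2)[OF f finP H_def, of w] that by (auto simp: P_def divs_def)
    have eq: "\<forall>\<^sub>\<approx>z. f (g z) = H (g z) * (\<Prod>b\<in>P. (g z - b) powi zorder f b)"
    proof (rule cosparse_compose[OF g])
      have "P sparse_in UNIV" by (rule finite_imp_sparse[OF finP])
      then have "\<forall>\<^sub>\<approx>w. w \<notin> P" by (rule eventually_not_in_cosparse)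
      then show "\<forall>\<^sub>\<approx>w. f w = H w * (\<Prod>b\<in>P. (w - b) powi zorder f b)"
        by eventually_elim (rule divide_divisor(3)[OF f finP H_def])
    qed
    \<comment> \<open>On the values of g, H is exp u times the linear factors at the zeros of f. The
      exponential contributes 5 K; the factors, of modulus at most 2 R, contribute n(R) ln (2 R) <=
      2 n(R) ln R <= 2 K.\<close>
    have TH: "nevanlinna_T (\<lambda>z. H (g z)) r \<le> 7 * ?K"
    proof -
      have pd: "pdeg (\<lambda>z. H (g z)) z = 0" if z: "norm z \<le> r" for z
      proof -
        have "norm (g z) \<le> R" using gR[OF z] R0 by simp
        then have an: "remove_sings H analytic_on {g z}" by (intro analytic_of_zorder[OF H] Hord)
        have "(\<lambda>z. remove_sings H (g z)) analytic_on {z}"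
          using analytic_on_compose_gen[of g "{z}" "remove_sings H" "{g z}"] an
            holomorphic_on_imp_analytic_at[OF g(1) open_UNIV, of z]
          by (simp add: o_def)
        moreover have ev: "\<forall>\<^sub>\<approx>z. remove_sings H (g z) = H (g z)"
          by (rule cosparse_compose[OF g eventually_remove_sings_eq]) (use H in \<open>simp add: nzmero_def\<close>)
        ultimately have "zorder (\<lambda>z. remove_sings H (g z)) z \<ge> 0"
          by (intro zorder_ge_0 nzmeroD(3) nzmero_compose[OF nzmero_remove_sings[OF H] g])
        then show ?thesis using zorder_cong_cosparse[OF ev] by (simp add: pdeg_def)
      qed
      have N: "nevanlinna_N (\<lambda>z. H (g z)) r \<le> (\<Sum>a\<in>({}::unit set). 1 * nevanlinna_N f r)"
        by (rule nevanlinna_N_le[OF Hg r]) (use pd in auto)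
      have "\<forall>\<^sub>\<approx>w. w \<notin> B" by (rule eventually_not_in_cosparse[OF finite_imp_sparse[OF d(3)]])
      then have "\<forall>\<^sub>\<approx>z. g z \<notin> B" by (rule cosparse_compose[OF g])
      from cosparse_finite[OF this, of r] have finB': "finite {z. norm z \<le> r \<and> \<not> g z \<notin> B}" .
      have "nevanlinna_m (\<lambda>z. H (g z)) r \<le> cmean (\<lambda>_. 7 * ?K) r"
      proof (rule nevanlinna_m_mono[OF _ cint_const r0 finB'])
        show "(\<lambda>z. H (g z)) meromorphic_on UNIV" using Hg by (simp add: nzmero_def)
        fix z assume z: "norm z = r" "z \<notin> {z. norm z \<le> r \<and> \<not> g z \<notin> B}"
        let ?w = "g z"
        have w: "norm ?w \<le> R / 2" using gR[of z] z by simp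
        then have wb: "?w \<in> ball 0 R' - B" using z d(1) R0 by auto
        have wD: "?w \<notin> ?D" "f ?w = exp (u ?w) * (\<Prod>a\<in>?D. (?w - a) powi zorder f a)" using d(4)[OF wb] by auto
        have Du: "?D = (?D - P) \<union> P" by (auto simp: P_def)
        have "(\<Prod>a\<in>?D. (?w - a) powi zorder f a) = (\<Prod>a\<in>?D - P. (?w - a) powi zorder f a) * (\<Prod>a\<in>P. (?w - a) powi zorder f a)"
          by (subst Du, rule prod.union_disjoint) (use fin finP in auto)
        moreover have "(\<Prod>a\<in>P. (?w - a) powi zorder f a) * (\<Prod>a\<in>P. (?w - a) powi (- zorder f a)) = 1"
          by (rule prod_powi_uminus_cancel) (use wD in \<open>auto simp: P_def\<close>)
        ultimately have "H ?w = exp (u ?w) * (\<Prod>a\<in>?D - P. (?w - a) powi zorder f a)"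
          unfolding H_def wD(2) by (simp add: mult.assoc)
        then have "norm (H ?w) = exp (Re (u ?w)) * (\<Prod>a\<in>?D - P. norm ((?w - a) powi zorder f a))"
          by (simp add: norm_mult prod_norm)
        also have "\<dots> \<le> exp (5 * ?K) * (\<Prod>a\<in>?D - P. exp (\<bar>real_of_int (zorder f a)\<bar> * ln (2 * R)))"
        proof (intro mult_mono prod_mono conjI)
          have "\<bar>Re (u ?w)\<bar> \<le> 5 * cmean (\<lambda>z. \<bar>Re (u z)\<bar>) R" by (rule Schwarz_Re_bound[OF d(2) R0 d(1) w])
          then show "exp (Re (u ?w)) \<le> exp (5 * ?K)" using A by simp
          fix a assume a: "a \<in> ?D - P"
          then have za: "zorder f a \<ge> 0" and na: "norm a \<le> R" by (auto simp: P_def divs_def)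
          have w2: "norm (?w - a) \<le> 2 * R" using norm_triangle_ineq4[of ?w a] w na R0 by simp
          have "norm ((?w - a) powi zorder f a) = norm (?w - a) ^ nat (zorder f a)"
            using za by (simp add: norm_power power_int_def)
          also have "\<dots> \<le> (2 * R) ^ nat (zorder f a)" by (rule power_mono[OF w2]) simp
          also have "\<dots> = exp (real (nat (zorder f a)) * ln (2 * R))" using R0 by (simp add: exp_of_nat_mult)
          finally show "norm ((?w - a) powi zorder f a) \<le> exp (\<bar>real_of_int (zorder f a)\<bar> * ln (2 * R))"
            using za by simp
        qed (auto intro!: prod_nonneg)
        also have "\<dots> = exp (5 * ?K + (\<Sum>a\<in>?D - P. \<bar>real_of_int (zorder f a)\<bar> * ln (2 * R)))"
          using fin by (simp add: exp_add exp_sum)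
        also have "\<dots> \<le> exp (7 * ?K)"
        proof -
          have "(\<Sum>a\<in>?D - P. \<bar>real_of_int (zorder f a)\<bar> * ln (2 * R)) \<le> (\<Sum>a\<in>?D. \<bar>real_of_int (zorder f a)\<bar> * ln (2 * R))"
            by (rule sum_mono2) (use fin ln2R in auto)
          also have "\<dots> = ncount f R * ln (2 * R)" by (simp add: ncount_def sum_distrib_right)
          also have "\<dots> \<le> ncount f R * (2 * ln R)" using ln2R by (intro mult_left_mono ncount_nonneg)
          also have "\<dots> \<le> 2 * ?K" using ncount_ln_le_Tb(2)[OF f R] by simp
          finally show ?thesis by simp
        qed
        finally have "log_plus (norm (H ?w)) \<le> log_plus (exp (7 * ?K))" by (rule log_plus_mono)
        then show "log_plus (norm (H ?w)) \<le> 7 * ?K" using log_plus_exp[of "7 * ?K"] K by simp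
      qed
      with N show ?thesis unfolding nevanlinna_T_def by simp
    qed
    \<comment> \<open>On the circle |g - b| <= 2 R, so T of g - b is at most ln (2 R) <= 2 ln R; the
      first main theorem carries this over to 1/(g - b) at the cost \<open>Cg\<close>.\<close>
    have Tb1: "nevanlinna_T (\<lambda>z. (g z - b) powi zorder f b) r \<le> \<bar>real_of_int (zorder f b)\<bar> * (2 * ln R + Cg)" if b: "b \<in> P" for b
    proof -
      have zb: "zorder f b < 0" "norm b \<le> R" using b by (auto simp: P_def divs_def)
      have "nevanlinna_T (\<lambda>z. g z - b) r \<le> ln (2 * R)"
      proof (rule nevanlinna_T_holomorphic_le[OF _ r0])
        show "(\<lambda>z. g z - b) holomorphic_on UNIV" by (intro holomorphic_intros g)
        fix z :: complex assume "norm z = r"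
        then show "norm (g z - b) \<le> 2 * R" using gR[of z] zb(2) norm_triangle_ineq4[of "g z" b] R0 by simp
      qed (use R in auto)
      then have 1: "nevanlinna_T (\<lambda>z. inverse (g z - b)) r \<le> 2 * ln R + Cg"
        using first_main_theorem[OF gb r0, of b] Cg(2)[OF zb(1)] ln2R by linarith
      have "nevanlinna_T (\<lambda>z. (g z - b) powi zorder f b) r = nevanlinna_T (\<lambda>z. (inverse (g z - b)) ^ nat (- zorder f b)) r"
        using zb by (simp add: powi_neg_eq_inverse_power)
      also have "\<dots> \<le> nat (- zorder f b) * nevanlinna_T (\<lambda>z. inverse (g z - b)) r"
        by (rule nevanlinna_T_power[OF nzmero_inverse[OF gb] r])
      also have "\<dots> \<le> nat (- zorder f b) * (2 * ln R + Cg)" by (rule mult_left_mono[OF 1]) simp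
      finally show ?thesis using zb by simp
    qed
    have "nevanlinna_T (\<lambda>z. f (g z)) r = nevanlinna_T (\<lambda>z. H (g z) * (\<Prod>b\<in>P. (g z - b) powi zorder f b)) r"
      by (rule nevanlinna_T_cong[OF eq r0])
    also have "\<dots> \<le> nevanlinna_T (\<lambda>z. H (g z)) r + nevanlinna_T (\<lambda>z. \<Prod>b\<in>P. (g z - b) powi zorder f b) r"
      by (intro nevanlinna_T_mult Hg r nzmero_prod nzmero_powi gb)
    also have "nevanlinna_T (\<lambda>z. \<Prod>b\<in>P. (g z - b) powi zorder f b) r \<le> (\<Sum>b\<in>P. nevanlinna_T (\<lambda>z. (g z - b) powi zorder f b) r)"
      by (intro nevanlinna_T_prod finP r nzmero_powi gb)
    also have "\<dots> \<le> (\<Sum>b\<in>P. \<bar>real_of_int (zorder f b)\<bar> * (2 * ln R + Cg))" by (intro sum_mono Tb1)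
    also have "\<dots> \<le> (\<Sum>b\<in>?D. \<bar>real_of_int (zorder f b)\<bar> * (2 * ln R + Cg))"
      by (rule sum_mono2) (use fin ln2R Cg in \<open>auto simp: P_def\<close>)
    also have "\<dots> = 2 * (ncount f R * ln R) + Cg * ncount f R" unfolding ncount_def sum_distrib_right[symmetric] by (simp add: algebra_simps)
    also have "\<dots> \<le> 2 * ?K + Cg * ?K" using ncount_ln_le_Tb[OF f R] Cg by (intro add_mono mult_left_mono) auto
    finally show ?thesis using TH by (simp add: algebra_simps)
  qed
  show ?thesis using that[of "9 + Cg"] main Cg by (simp add: add_pos_nonneg)
qed

text \<open>At a point z0 where f is analytic, 1/(f - f z0) has a pole, which alone contributes at
  least ln (r / |z0|) to N once r >= |z0|. The first main theorem leads back to f - f z0, and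
  subtracting a constant changes T by a bounded amount.\<close>

lemma nevanlinna_T_ge_ln:
  assumes f: "nzmero f" and nc: "\<And>a. nzmero (\<lambda>z. f z - a)"
  obtains C where "\<And>r. 1 \<le> r \<Longrightarrow> ln r - C \<le> nevanlinna_T f r"
proof -
  have "\<forall>\<^sub>\<approx>z. f analytic_on {z}" using f by (intro meromorphic_on_imp_analytic_cosparse) (simp add: nzmero_def)
  moreover have "\<forall>\<^sub>\<approx>z. z \<notin> {0::complex}" by (rule eventually_not_in_cosparse) auto
  ultimately have "\<forall>\<^sub>\<approx>z. f analytic_on {z} \<and> z \<noteq> 0" by eventually_elim auto
  then have "\<exists>z. f analytic_on {z} \<and> z \<noteq> 0" by (rule eventually_happens'[rotated]) simp
  then obtain z0 where z0: "f analytic_on {z0}" "z0 \<noteq> 0" by blast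
  define h where "h = (\<lambda>z. f z - f z0)"
  have h: "nzmero h" unfolding h_def by (rule nc)
  have "h analytic_on {z0}" unfolding h_def by (intro analytic_intros z0)
  then have zo: "zorder h z0 > 0" using zorder_pos_iff'[OF _ nzmeroD(3)[OF h]] by (simp add: h_def)
  let ?C = "ln (norm z0) - lcn h + log_plus (norm (f z0)) + ln 2"
  let ?C' = "max (max ?C (ln (norm z0))) 0"
  have "ln r - ?C' \<le> nevanlinna_T f r" if r: "1 \<le> r" for r
  proof (cases "norm z0 \<le> r")
    case True
    have r0: "0 < r" using r by simp
    note h' = nzmero_inverse[OF h]
    have "1 * wt r z0 \<le> pdeg (\<lambda>z. inverse (h z)) z0 * wt r z0"
      by (intro mult_right_mono wt_nonneg r) (use zo in \<open>simp add: pdeg_def nzmero_zorder_inverse[OF h]\<close>)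
    also have "\<dots> \<le> (\<Sum>z\<in>divs h r. pdeg (\<lambda>z. inverse (h z)) z * wt r z)"
      by (rule member_le_sum) (use zo True finite_divs[OF h] in \<open>auto simp: divs_def intro!: mult_nonneg_nonneg pdeg_nonneg wt_nonneg r\<close>)
    also have "\<dots> = nevanlinna_N (\<lambda>z. inverse (h z)) r"
      by (rule nevanlinna_N_eq[symmetric, OF h' r0 finite_divs[OF h] _ divs_sub_cball]) (simp add: divs_inverse[OF h])
    also have "\<dots> \<le> nevanlinna_T (\<lambda>z. inverse (h z)) r" by (rule nevanlinna_N_le_T)
    also have "\<dots> = nevanlinna_T h r - lcn h" by (rule first_main_theorem[OF h r0])
    also have "nevanlinna_T h r \<le> nevanlinna_T f r + (log_plus (norm (f z0)) + ln 2)"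
      unfolding h_def by (rule nevanlinna_T_diff_const[OF f nc r])
    finally have "wt r z0 \<le> nevanlinna_T f r + (log_plus (norm (f z0)) + ln 2) - lcn h" by simp
    moreover have "wt r z0 = ln r - ln (norm z0)" using True z0 r0 by (simp add: wt_def ln_div)
    ultimately show ?thesis by linarith
  next
    case False
    then have "ln r \<le> ln (norm z0)" using r by (subst ln_le_cancel_iff) linarith+
    moreover have "0 \<le> nevanlinna_T f r" by (rule nevanlinna_T_nonneg[OF f r])
    ultimately show ?thesis by linarith
  qed
  then show ?thesis using that by blast
qed

section \<open>Growth of transcendental functions\<close>

lemma transcendental_nzmero:
  assumes "transcendental_meromorphic f"
  shows "nzmero (\<lambda>z. f z - a)" "nzmero f"
proof -
  have 1: "nzmero (\<lambda>z. f z - a)" for a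
  proof -
    have "(\<lambda>z. f z - a) meromorphic_on UNIV" using assms by (auto simp: transcendental_meromorphic_def intro!: meromorphic_intros)
    moreover have "\<not> (\<forall>\<^sub>\<approx>z. f z - a = 0)"
    proof
      assume "\<forall>\<^sub>\<approx>z. f z - a = 0"
      then have "\<forall>\<^sub>\<approx>z. f z = poly [:a:] z / poly 1 z" by eventually_elim simp
      then show False using assms unfolding transcendental_meromorphic_def by (metis one_neq_zero)
    qed
    ultimately show ?thesis using nzmero_or_zero by blast
  qed
  show "nzmero (\<lambda>z. f z - a)" by (rule 1)
  show "nzmero f" using 1[of 0] by simp
qed

lemma ncount_mono: "nzmero f \<Longrightarrow> R \<le> R1 \<Longrightarrow> ncount f R \<le> ncount f R1"
  unfolding ncount_def by (rule sum_mono2[OF finite_divs]) (auto simp: divs_def)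

lemma powi_eq_divide_powers: "(x::complex) \<noteq> 0 \<Longrightarrow> x powi n = x ^ nat n / x ^ nat (- n)"
  by (cases "n \<ge> 0") (auto simp: power_int_def power_inverse field_simps)

text \<open>
  If \<open>T(r) < k ln r\<close> for arbitrarily large \<open>r\<close>, then \<open>f\<close> has finitely many zeros and poles, and dividing them
  out leaves an entire \<open>e = exp u\<close> with \<open>\<bar>u'\<bar> = O(ln R / R)\<close> along a sequence of radii, so \<open>e\<close> is constant.
\<close>
lemma transcendental_growth_aux:
  assumes f: "nzmero f" and frq: "\<And>x. \<exists>r>x. nevanlinna_T f r < k * ln r" and k: "0 \<le> k"
  shows "\<exists>P Q :: complex poly. Q \<noteq> 0 \<and> eventually (\<lambda>z. f z = poly P z / poly Q z) (cosparse UNIV)"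
proof -
  define L where "L = 4 * k + \<bar>lcn f\<bar>"
  have L: "L \<ge> 0" using k by (simp add: L_def)
  have ln3: "1 \<le> ln R" if "3 \<le> R" for R :: real
    using that ln_ge_iff[of R 1] exp_le by linarith
  have cnt: "ncount f R \<le> L" if R: "3 \<le> R" for R
  proof -
    \<comment> \<open>Comparing the radii sqrt r and r gives n(sqrt r) ln (sqrt r) <= 4 k ln (sqrt
      r) + |lcn f|, and R <= sqrt r; hence the bound \<open>L\<close> does not depend on R.\<close>
    obtain r where r: "r > R\<^sup>2" "nevanlinna_T f r < k * ln r" using frq by blast
    let ?R = "sqrt r"
    have RR: "R \<le> ?R" using r R by (intro real_le_rsqrt) auto
    have r9: "0 < r" using r(1) zero_le_power2[of R] by linarith
    have sq: "?R * ?R = r" using r9 by simp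
    have q: "r / ?R = ?R" by (rule real_div_sqrt) (use r9 in simp)
    have lnr: "ln r = 2 * ln ?R" using r9 by (simp add: ln_sqrt)
    have R1: "1 \<le> ?R" using RR R by linarith
    have "?R * 1 \<le> ?R * ?R" using R1 by (intro mult_left_mono) auto
    then have "ncount f ?R * ln (r / ?R) \<le> 2 * nevanlinna_T f r - lcn f"
      using sq by (intro ncount_le_T[OF f]) (use R1 in auto)
    then have 1: "ncount f ?R * ln ?R \<le> 4 * k * ln ?R + \<bar>lcn f\<bar> * 1" using r(2) unfolding q lnr by linarith
    have l1: "1 \<le> ln ?R" using RR R by (intro ln3) linarith
    have "\<bar>lcn f\<bar> * 1 \<le> \<bar>lcn f\<bar> * ln ?R" using l1 by (intro mult_left_mono) auto
    with 1 have "ncount f ?R * ln ?R \<le> L * ln ?R" by (simp add: L_def algebra_simps)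
    then have "ncount f ?R \<le> L" using l1 by simp
    with ncount_mono[OF f RR] show ?thesis by simp
  qed
  define D where "D = {z. zorder f z \<noteq> 0}"
  have finD: "finite D"
  proof (rule ccontr)
    \<comment> \<open>A finite subset with more than L points would lie in some disc and violate
      \<open>cnt\<close>.\<close>
    assume "infinite D"
    from infinite_arbitrarily_large[OF this, of "Suc (nat \<lceil>L\<rceil>)"] obtain E where
      E: "finite E" "card E = Suc (nat \<lceil>L\<rceil>)" "E \<subseteq> D" by metis
    define R where "R = Max (insert 3 (norm ` E))"
    have R: "3 \<le> R" "\<And>z. z \<in> E \<Longrightarrow> norm z \<le> R" using E(1) by (auto simp: R_def)
    have sub: "E \<subseteq> divs f R" using E(3) R(2) by (auto simp: divs_def D_def)
    have "real (card E) = (\<Sum>a\<in>E. 1)" by simp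
    also have "\<dots> \<le> (\<Sum>a\<in>E. \<bar>real_of_int (zorder f a)\<bar>)"
    proof (rule sum_mono)
      fix a assume "a \<in> E"
      then have "zorder f a \<noteq> 0" using E(3) by (auto simp: D_def)
      then show "1 \<le> \<bar>real_of_int (zorder f a)\<bar>" by linarith
    qed
    also have "\<dots> \<le> ncount f R" unfolding ncount_def by (rule sum_mono2[OF finite_divs[OF f] sub]) auto
    also have "\<dots> \<le> L" by (rule cnt[OF R(1)])
    finally show False using E(2) by linarith
  qed
  define R0 where "R0 = Max (insert 3 (norm ` D))"
  have R0: "3 \<le> R0" "\<And>z. z \<in> D \<Longrightarrow> norm z \<le> R0" using finD by (auto simp: R0_def)
  \<comment> \<open>Beyond \<open>R0\<close> the divisor in the disc no longer changes, so all
    representations share one rational factor and each has exp u = e.\<close>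
  have divsD: "divs f R = D" if "R0 \<le> R" for R using R0(2) that by (force simp: divs_def D_def)
  define h where "h = (\<lambda>z. f z * (\<Prod>a\<in>D. (z - a) powi (- zorder f a)))"
  note h = divide_divisor(1)[OF f finD h_def]
  have zh: "zorder h z = 0" for z
    using divide_divisor(2)[OF f finD h_def, of z] by (auto simp: D_def)
  define e where "e = remove_sings h"
  have an: "e analytic_on {z}" for z unfolding e_def by (rule analytic_of_zorder[OF h]) (simp add: zh)
  have eh: "e holomorphic_on UNIV" using an analytic_imp_holomorphic analytic_on_analytic_at by blast
  have ev: "\<forall>\<^sub>\<approx>z. e z = h z" unfolding e_def using h by (intro eventually_remove_sings_eq) (simp add: nzmero_def)

  define C where "C = 2 * k + \<bar>lcn f\<bar> + 3 * L"
  have de: "norm (deriv e z) \<le> norm (e z) * 32 * C * (ln R / R)"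
    if R: "R0 \<le> R" "2 * norm z \<le> R" "nevanlinna_T f R < k * ln R" for R z
  proof -
    have R3: "3 \<le> R" "1 \<le> R" "0 < R" using R R0 by auto
    have lnR: "1 \<le> ln R" by (rule ln3[OF R3(1)])
    obtain u R' B where rep: "represents f R u R' B"
      "cmean (\<lambda>z. \<bar>Re (u z)\<bar>) R \<le> 2 * nevanlinna_T f R - lcn f + ncount f R * (ln R + 2 * ln 2)"
      using local_representation[OF f R3(2)] by blast
    note d = representsD[OF rep(1)] rep(2)
    have "cmean (\<lambda>z. \<bar>Re (u z)\<bar>) R \<le> C * ln R"
    proof -
      have "ncount f R * (ln R + 2 * ln 2) \<le> L * (3 * ln R)"
        using cnt[OF R3(1)] R3 lnR L by (intro mult_mono) auto
      moreover have "\<bar>lcn f\<bar> * 1 \<le> \<bar>lcn f\<bar> * ln R" using lnR by (intro mult_left_mono) auto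
      moreover have "C * ln R = 2 * (k * ln R) + \<bar>lcn f\<bar> * ln R + L * (3 * ln R)" by (simp add: C_def algebra_simps)
      ultimately show ?thesis using d(5) R(3) by linarith
    qed
    moreover have zb: "z \<in> ball 0 R'" using R(2) R3 d(1) by simp
    moreover have "norm (deriv u z) \<le> 32 * cmean (\<lambda>z. \<bar>Re (u z)\<bar>) R / R"
      by (rule Schwarz_deriv_bound[OF d(2) R3(3) d(1)]) (use R in simp)
    ultimately have du: "norm (deriv u z) \<le> 32 * (C * ln R) / R"
      using R3 by (meson divide_right_mono mult_left_mono order.trans zero_le_numeral less_imp_le)
    \<comment> \<open>Both sides are continuous at w and agree in a punctured neighbourhood of
      w.\<close>
    have eu: "e w = exp (u w)" if w: "w \<in> ball 0 R'" for w
    proof (rule tendsto_unique[of "at w"])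
      have "isCont e w" using an[of w] by (rule analytic_at_imp_isCont)
      then show "(e \<longlongrightarrow> e w) (at w)" by (simp add: isCont_def)
      have "isCont u w" using w by (intro continuous_on_interior[OF holomorphic_on_imp_continuous_on[OF d(2)]]) auto
      then have lim: "((\<lambda>w. exp (u w)) \<longlongrightarrow> exp (u w)) (at w)" by (intro tendsto_exp) (simp add: isCont_def)
      have "eventually (\<lambda>x. x \<in> ball 0 R' - (B - {w})) (nhds w)"
        using w d(3) by (intro eventually_nhds_in_open open_Diff finite_imp_closed) auto
      then have "eventually (\<lambda>x. x \<in> ball 0 R' - B) (at w)"
        unfolding eventually_at_filter by (rule eventually_mono) auto
      with cosparse_at[OF ev, of w] have "eventually (\<lambda>x. exp (u x) = e x) (at w)"
      proof eventually_elim
        case (elim x)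
        then have fx: "x \<notin> D" "f x = exp (u x) * (\<Prod>a\<in>D. (x - a) powi zorder f a)" using d(4)[of x] divsD[OF R(1)] by auto
        have "h x = exp (u x)" unfolding h_def fx(2)
          using prod_powi_uminus_cancel[OF fx(1), of "zorder f"] by (simp add: mult.assoc)
        with elim show ?case by simp
      qed
      from Lim_transform_eventually[OF lim this] show "(e \<longlongrightarrow> exp (u w)) (at w)" .
    qed auto
    have "(u has_field_derivative deriv u z) (at z)" using holomorphic_derivI[OF d(2), of z] zb by auto
    then have "((\<lambda>w. exp (u w)) has_field_derivative e z * deriv u z) (at z)"
      by (auto intro!: derivative_eq_intros simp: eu[OF zb])
    moreover have "eventually (\<lambda>w. e w = exp (u w)) (nhds z)"
      by (rule eventually_mono[OF eventually_nhds_in_open[of "ball 0 R'"]]) (use zb eu in auto)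
    ultimately have "deriv e z = e z * deriv u z"
      by (subst deriv_cong_ev[OF _ refl]) (auto intro: DERIV_imp_deriv)
    then have "norm (deriv e z) = norm (e z) * norm (deriv u z)" by (simp add: norm_mult)
    also have "\<dots> \<le> norm (e z) * (32 * (C * ln R) / R)" by (rule mult_left_mono[OF du]) simp
    finally show ?thesis by (simp add: mult.assoc)
  qed
  have d0: "deriv e z = 0" for z
  proof (rule ccontr)
    assume "deriv e z \<noteq> 0"
    then have p: "0 < norm (deriv e z)" by simp
    \<comment> \<open>z is fixed, while \<open>de\<close> applies at arbitrarily large R.\<close>
    have "((\<lambda>R. norm (e z) * 32 * C * (ln R / R)) \<longlongrightarrow> norm (e z) * 32 * C * 0) at_top"
      by (intro tendsto_intros ln_x_over_x_tendsto_0)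
    then have "eventually (\<lambda>R. norm (e z) * 32 * C * (ln R / R) < norm (deriv e z)) at_top"
      using p by (intro order_tendstoD(2)) auto
    then obtain N where N: "\<And>R. R \<ge> N \<Longrightarrow> norm (e z) * 32 * C * (ln R / R) < norm (deriv e z)"
      by (auto simp: eventually_at_top_linorder)
    obtain R where R: "R > max N (max R0 (2 * norm z))" "nevanlinna_T f R < k * ln R" using frq by blast
    show False using N[of R] de[of R z] R by simp
  qed
  have "\<exists>c. \<forall>z\<in>UNIV. e z = c"
  proof (rule has_field_derivative_zero_constant)
    fix z :: complex assume "z \<in> UNIV"
    show "(e has_field_derivative 0) (at z within UNIV)"
      using holomorphic_derivI[OF eh open_UNIV, of z] d0[of z] by simp
  qed simp
  then obtain c where c: "\<And>z. e z = c" by auto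
  \<comment> \<open>At each point of D one of the two \<open>nat\<close> exponents is 0: zeros go to
    the numerator, poles to the denominator.\<close>
  let ?P = "smult c (\<Prod>a\<in>D. [:-a, 1:] ^ nat (zorder f a))"
  let ?Q = "\<Prod>a\<in>D. [:-a, 1:] ^ nat (- zorder f a)"
  have "?Q \<noteq> 0" using finD by simp
  moreover have "\<forall>\<^sub>\<approx>z. f z = poly ?P z / poly ?Q z"
  proof -
    have "\<forall>\<^sub>\<approx>z. z \<notin> D" by (rule eventually_not_in_cosparse[OF finite_imp_sparse[OF finD]])
    with ev show ?thesis
    proof eventually_elim
      case (elim z)
      have "f z = h z * (\<Prod>a\<in>D. (z - a) powi zorder f a)"
        by (rule divide_divisor(3)[OF f finD h_def elim(2)])
      also have "h z = c" using elim c by simp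
      also have "(\<Prod>a\<in>D. (z - a) powi zorder f a) = (\<Prod>a\<in>D. (z - a) ^ nat (zorder f a) / (z - a) ^ nat (- zorder f a))"
        using elim by (intro prod.cong powi_eq_divide_powers) auto
      also have "c * \<dots> = poly ?P z / poly ?Q z" by (simp add: poly_prod prod_dividef)
      finally show ?case .
    qed
  qed
  ultimately show ?thesis by blast
qed

lemma transcendental_growth:
  assumes f: "transcendental_meromorphic f"
  shows "eventually (\<lambda>r. k * ln r \<le> nevanlinna_T f r) at_top"
proof (rule ccontr)
  assume "\<not> eventually (\<lambda>r. k * ln r \<le> nevanlinna_T f r) at_top"
  then have "\<exists>r>x. nevanlinna_T f r < \<bar>k\<bar> * ln r" for x
  proof -
    assume "\<not> eventually (\<lambda>r. k * ln r \<le> nevanlinna_T f r) at_top"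
    then obtain r where r: "r > max x 1" "nevanlinna_T f r < k * ln r"
      unfolding eventually_at_top_dense by (meson not_le)
    have "k * ln r \<le> \<bar>k\<bar> * ln r" using r by (intro mult_right_mono) auto
    then have "r > x" "nevanlinna_T f r < \<bar>k\<bar> * ln r" using r by linarith+
    then show ?thesis by blast
  qed
  from transcendental_growth_aux[OF transcendental_nzmero(2)[OF f] this] show False
    using f unfolding transcendental_meromorphic_def by auto
qed

section \<open>Differential polynomials\<close>

text \<open>A one-sided s = o(T(r, f)): constants of either sign qualify, and smaller functions
  inherit the property.\<close>

definition small :: "(complex \<Rightarrow> complex) \<Rightarrow> (real \<Rightarrow> real) \<Rightarrow> bool" where
  "small f s \<longleftrightarrow> (\<forall>\<epsilon>>0. eventually (\<lambda>r. s r \<le> \<epsilon> * nevanlinna_T f r) at_top)"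

lemma smallD: "small f s \<Longrightarrow> 0 < \<epsilon> \<Longrightarrow> eventually (\<lambda>r. s r \<le> \<epsilon> * nevanlinna_T f r) at_top"
  by (simp add: small_def)

lemma small_mono: "small f s \<Longrightarrow> eventually (\<lambda>r. s' r \<le> s r) at_top \<Longrightarrow> small f s'"
  unfolding small_def by (auto elim: eventually_elim2)

lemma small_add:
  assumes "small f s" "small f t" shows "small f (\<lambda>r. s r + t r)"
  unfolding small_def
proof (intro allI impI)
  fix \<epsilon> :: real assume "\<epsilon> > 0"
  then have e: "0 < \<epsilon>/2" by simp
  from smallD[OF assms(1) e] smallD[OF assms(2) e] show "eventually (\<lambda>r. s r + t r \<le> \<epsilon> * nevanlinna_T f r) at_top"
    by eventually_elim simp
qed

lemma small_zero: assumes "nzmero f" shows "small f (\<lambda>_. 0)"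
  unfolding small_def
proof (intro allI impI)
  fix \<epsilon> :: real assume e: "\<epsilon> > 0"
  show "eventually (\<lambda>r. 0 \<le> \<epsilon> * nevanlinna_T f r) at_top"
    using eventually_ge_at_top[of 1]
    by eventually_elim (use e nevanlinna_T_nonneg[OF assms] in auto)
qed

lemma small_cmult:
  assumes f: "nzmero f" and s: "small f s" and c: "0 \<le> c" shows "small f (\<lambda>r. c * s r)"
  unfolding small_def
proof (intro allI impI)
  fix \<epsilon> :: real assume e: "\<epsilon> > 0"
  have "eventually (\<lambda>r. s r \<le> \<epsilon>/(c+1) * nevanlinna_T f r) at_top"
    by (rule smallD[OF s]) (use e c in simp)
  then show "eventually (\<lambda>r. c * s r \<le> \<epsilon> * nevanlinna_T f r) at_top"
    using eventually_ge_at_top[of 1]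
  proof eventually_elim
    case (elim r)
    have T: "0 \<le> nevanlinna_T f r" using nevanlinna_T_nonneg[OF f] elim by auto
    have "c * s r \<le> c * (\<epsilon>/(c+1) * nevanlinna_T f r)" using elim c by (intro mult_left_mono) auto
    also have "\<dots> = (c / (c+1)) * (\<epsilon> * nevanlinna_T f r)" by simp
    also have "\<dots> \<le> 1 * (\<epsilon> * nevanlinna_T f r)" using c e T by (intro mult_right_mono) auto
    finally show ?case by simp
  qed
qed

lemma small_sum:
  assumes "nzmero f" "finite A" "\<And>a. a \<in> A \<Longrightarrow> small f (s a)" shows "small f (\<lambda>r. \<Sum>a\<in>A. s a r)"
  using assms(2,3) by (induction A rule: finite_induct) (auto intro!: small_add small_zero assms(1))

lemma small_const:
  assumes "transcendental_meromorphic f" shows "small f (\<lambda>_. c)"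
  unfolding small_def
proof (intro allI impI)
  fix \<epsilon> :: real assume e: "\<epsilon> > 0"
  have "eventually (\<lambda>r. \<bar>c\<bar> / \<epsilon> * ln r \<le> nevanlinna_T f r) at_top" by (rule transcendental_growth[OF assms])
  then show "eventually (\<lambda>r. c \<le> \<epsilon> * nevanlinna_T f r) at_top"
    using eventually_ge_at_top[of 3]
  proof eventually_elim
    case (elim r)
    have "1 \<le> ln r" using elim ln_ge_iff[of r 1] exp_le by linarith
    then have "\<bar>c\<bar> / \<epsilon> * 1 \<le> \<bar>c\<bar> / \<epsilon> * ln r" using e by (intro mult_left_mono) auto
    then have "\<bar>c\<bar> / \<epsilon> \<le> nevanlinna_T f r" using elim by simp
    then have "\<bar>c\<bar> \<le> \<epsilon> * nevanlinna_T f r" using e by (simp add: field_simps)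
    then show ?case by simp
  qed
qed

text \<open>
  The dilated radii \<open>c * r ^ k\<close> make the notion stable under the passage to \<open>2r\<close> and \<open>(2r)\<^sup>2\<close> in \<open>Tb\<close>.
\<close>
definition slow :: "(complex \<Rightarrow> complex) \<Rightarrow> (complex \<Rightarrow> complex) \<Rightarrow> bool" where
  "slow f h \<longleftrightarrow> (\<forall>c\<ge>1. \<forall>k::nat. k \<ge> 1 \<longrightarrow> small f (\<lambda>r. log_plus (nevanlinna_T h (c * r ^ k))))"

lemma log_plus_le_self: "0 \<le> x \<Longrightarrow> log_plus x \<le> x"
  using ln_le_minus_one[of x] by (auto simp: log_plus_def)

lemma ln_le_log_plus: "0 \<le> x \<Longrightarrow> ln x \<le> log_plus x"
  by (simp add: log_plus_eq_max)

text \<open>The logarithm of \<open>Tb\<close> splits under \<open>log_plus\<close> into log T at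
  the radii 2 c r^k and 4 c^2 r^(2k), which again have the form covered by \<open>slow\<close>, and
  the constant \<open>K\<close>.\<close>

lemma small_log_derivative:
  assumes f: "transcendental_meromorphic f" and h: "nzmero h" "slow f h" and c: "1 \<le> c" and k: "(k::nat) \<ge> 1"
  shows "small f (\<lambda>r. nevanlinna_m (\<lambda>z. deriv h z / h z) (c * r ^ k))"
proof -
  note nf = transcendental_nzmero(2)[OF f]
  obtain C where C: "C > 0"
    "\<And>f r. nzmero f \<Longrightarrow> 1 \<le> r \<Longrightarrow> nevanlinna_m (\<lambda>z. deriv f z / f z) r \<le> 2 * ln (2 + C * Tb f (2 * r))"
    using logarithmic_derivative_lemma by metis
  define K where "K = 2 * (log_plus (2 * C) + log_plus (6 * C) + log_plus (2 + 4 * C * \<bar>lcn h\<bar>) + 2 * ln 2)"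
  let ?s = "\<lambda>r. 2 * log_plus (nevanlinna_T h ((2 * c) * r ^ k)) + 2 * log_plus (nevanlinna_T h ((4 * c\<^sup>2) * r ^ (2 * k))) + K"
  have c2: "1 \<le> 4 * c\<^sup>2" using one_le_power[OF c, of 2] by linarith
  have "small f ?s"
    using h(2) c c2 k unfolding slow_def
    by (intro small_add small_const f small_cmult nf) auto
  moreover have "eventually (\<lambda>r. nevanlinna_m (\<lambda>z. deriv h z / h z) (c * r ^ k) \<le> ?s r) at_top"
    using eventually_ge_at_top[of 1]
  proof eventually_elim
    case (elim r)
    let ?R = "2 * (c * r ^ k)"
    have rk: "1 \<le> r ^ k" using elim by simp
    have R1: "1 \<le> c * r ^ k" using mult_mono[OF c rk] c by simp
    have Rsq: "?R\<^sup>2 = (4 * c\<^sup>2) * r ^ (2 * k)" by (simp add: power_mult_distrib power_mult[symmetric] mult.commute)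
    have R2: "1 \<le> ?R" using R1 by simp
    then have R2': "1 \<le> ?R\<^sup>2" by (rule one_le_power)
    let ?T1 = "nevanlinna_T h ?R" and ?T2 = "nevanlinna_T h (?R\<^sup>2)"
    have T: "0 \<le> ?T1" "0 \<le> ?T2" by (rule nevanlinna_T_nonneg[OF h(1) R2], rule nevanlinna_T_nonneg[OF h(1) R2'])
    have "nevanlinna_m (\<lambda>z. deriv h z / h z) (c * r ^ k) \<le> 2 * ln (2 + C * Tb h ?R)" by (rule C(2)[OF h(1) R1])
    also have "2 + C * Tb h ?R = (2 * C * ?T1 + 6 * C * ?T2) + (2 + 4 * C * \<bar>lcn h\<bar>)"
      unfolding Tb_def by (simp add: algebra_simps)
    also have "ln \<dots> \<le> log_plus \<dots>" by (rule ln_le_log_plus) (use T C in auto)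
    also have "\<dots> \<le> log_plus (2 * C * ?T1 + 6 * C * ?T2) + log_plus (2 + 4 * C * \<bar>lcn h\<bar>) + ln 2"
      by (rule log_plus_add) (use T C in auto)
    also have "log_plus (2 * C * ?T1 + 6 * C * ?T2) \<le> log_plus (2 * C * ?T1) + log_plus (6 * C * ?T2) + ln 2"
      by (rule log_plus_add) (use T C in auto)
    also have "log_plus (2 * C * ?T1) \<le> log_plus (2 * C) + log_plus ?T1" by (rule log_plus_mult) (use T C in auto)
    also have "log_plus (6 * C * ?T2) \<le> log_plus (6 * C) + log_plus ?T2" by (rule log_plus_mult) (use T C in auto)
    finally show ?case unfolding K_def Rsq by (simp add: mult.assoc)
  qed
  ultimately show ?thesis by (rule small_mono)
qed

text \<open>The complement of a sparse set is open, so two functions that agree off such a set agree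
  locally at each point of the complement.\<close>

lemma deriv_cong_cosparse:
  fixes f g :: "complex \<Rightarrow> complex"
  assumes "\<forall>\<^sub>\<approx>z. f z = g z" shows "\<forall>\<^sub>\<approx>z. deriv f z = deriv g z"
proof -
  have sp: "{z. f z \<noteq> g z} sparse_in UNIV" using assms by (simp add: eventually_cosparse)
  have "deriv f z = deriv g z" if "f z = g z" for z
  proof (rule deriv_cong_ev)
    have "open (- {z. f z \<noteq> g z})" using sparse_in_UNIV_imp_closed[OF sp] by auto
    then show "\<forall>\<^sub>F x in nhds z. f x = g x"
      by (rule eventually_mono[OF eventually_nhds_in_open]) (use that in auto)
  qed simp
  then show ?thesis using assms by (auto elim: eventually_mono)
qed

lemma higher_deriv_cong_cosparse:
  fixes f g :: "complex \<Rightarrow> complex"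
  assumes "\<forall>\<^sub>\<approx>z. f z = g z" shows "\<forall>\<^sub>\<approx>z. (deriv ^^ i) f z = (deriv ^^ i) g z"
  using assms by (induction i) (auto intro: deriv_cong_cosparse)

text \<open>A pole of order n becomes one of order n + 1 <= 2 n, and differentiation creates no new
  poles.\<close>

lemma pdeg_deriv_le:
  assumes "nzmero h" "nzmero (deriv h)" shows "pdeg (deriv h) z \<le> 2 * pdeg h z"
proof (cases "is_pole (deriv h) z")
  case True
  then have "is_pole h z" using is_pole_deriv_iff[OF nzmeroD(1)[OF assms(1)]] by simp
  then have "zorder h z < 0" using is_pole_iff_zorder[OF assms(1)] by simp
  moreover from this have "zorder (deriv h) z = zorder h z - 1"
    by (intro zorder_deriv_minus_1 nzmeroD[OF assms(1)]) simp
  ultimately show ?thesis by (simp add: pdeg_def)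
next
  case False
  then have "pdeg (deriv h) z = 0" using is_pole_iff_zorder[OF assms(2)] by (simp add: pdeg_def)
  then show ?thesis using pdeg_nonneg[of h z] by simp
qed

lemma nevanlinna_T_deriv_le:
  assumes h: "nzmero h" "nzmero (deriv h)" and r: "1 \<le> r"
  shows "nevanlinna_T (deriv h) r \<le> 2 * nevanlinna_T h r + nevanlinna_m (\<lambda>z. deriv h z / h z) r"
proof -
  have r0: "0 < r" using r by simp
  have "nevanlinna_N (deriv h) r \<le> (\<Sum>a\<in>{()}. 2 * nevanlinna_N h r)"
    by (intro nevanlinna_N_le h r) (use pdeg_deriv_le[OF h] h in auto)
  moreover have "nevanlinna_m (deriv h) r \<le> nevanlinna_m h r + nevanlinna_m (\<lambda>z. deriv h z / h z) r"
  proof -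
    have "nevanlinna_m (deriv h) r = nevanlinna_m (\<lambda>z. h z * (deriv h z / h z)) r"
      by (rule nevanlinna_m_cong[OF _ r0]) (use h(1) in \<open>auto simp: nzmero_def elim: eventually_mono\<close>)
    also have "\<dots> \<le> nevanlinna_m h r + nevanlinna_m (\<lambda>z. deriv h z / h z) r"
      by (rule nevanlinna_m_mult[OF _ _ r0]) (use h in \<open>auto simp: nzmero_def intro!: meromorphic_intros\<close>)
    finally show ?thesis .
  qed
  moreover have "0 \<le> nevanlinna_m h r" by (rule nevanlinna_m_nonneg)
  ultimately show ?thesis unfolding nevanlinna_T_def by simp
qed

lemma slow_deriv:
  assumes f: "transcendental_meromorphic f" and h: "nzmero h" "slow f h" "nzmero (deriv h)"
  shows "slow f (deriv h)"
  unfolding slow_def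
proof (intro allI impI)
  fix c :: real and k :: nat assume c: "1 \<le> c" and k: "1 \<le> k"
  note nf = transcendental_nzmero(2)[OF f]
  let ?m = "\<lambda>r. nevanlinna_m (\<lambda>z. deriv h z / h z) r"
  have "small f (\<lambda>r. log_plus (nevanlinna_T h (c * r ^ k)) + ?m (c * r ^ k) + (log_plus 2 + ln 2))"
    using h(2) c k unfolding slow_def by (intro small_add small_const f small_log_derivative h) auto
  moreover have "eventually (\<lambda>r. log_plus (nevanlinna_T (deriv h) (c * r ^ k)) \<le>
     log_plus (nevanlinna_T h (c * r ^ k)) + ?m (c * r ^ k) + (log_plus 2 + ln 2)) at_top"
    using eventually_ge_at_top[of 1]
  proof eventually_elim
    case (elim r)
    let ?R = "c * r ^ k"
    have rk: "1 \<le> r ^ k" using elim by simp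
    have R1: "1 \<le> ?R" using mult_mono[OF c rk] c by simp
    have T: "0 \<le> nevanlinna_T h ?R" by (rule nevanlinna_T_nonneg[OF h(1) R1])
    have m: "0 \<le> ?m ?R" by (rule nevanlinna_m_nonneg)
    have "log_plus (nevanlinna_T (deriv h) ?R) \<le> log_plus (2 * nevanlinna_T h ?R + ?m ?R)"
      by (rule log_plus_mono[OF nevanlinna_T_deriv_le[OF h(1,3) R1]])
    also have "\<dots> \<le> log_plus (2 * nevanlinna_T h ?R) + log_plus (?m ?R) + ln 2"
      by (rule log_plus_add) (use T m in auto)
    also have "log_plus (2 * nevanlinna_T h ?R) \<le> log_plus 2 + log_plus (nevanlinna_T h ?R)"
      by (rule log_plus_mult) (use T in auto)
    also have "log_plus (?m ?R) \<le> ?m ?R" by (rule log_plus_le_self[OF m])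
    finally show ?case by simp
  qed
  ultimately show "small f (\<lambda>r. log_plus (nevanlinna_T (deriv h) (c * r ^ k)))" by (rule small_mono)
qed

text \<open>The quotient f^(i+1) / f is the product of f^(i+1) / f^(i) and f^(i) / f. The first
  factor is handled by \<open>small_log_derivative\<close>, which requires \<open>slow\<close> for
  f^(i); hence the two conjuncts are proved together. If f^(i+1) vanishes identically, the quotient
  is 0.\<close>

lemma small_higher_deriv_quotient:
  assumes f: "transcendental_meromorphic f" and P: "slow f f"
  shows "small f (\<lambda>r. nevanlinna_m (\<lambda>z. (deriv ^^ i) f z / f z) r) \<and> (nzmero ((deriv ^^ i) f) \<longrightarrow> slow f ((deriv ^^ i) f))"
proof (induction i)
  note nf = transcendental_nzmero(2)[OF f]
  case 0
  have "nevanlinna_m (\<lambda>z. f z / f z) r = 0" if "0 < r" for r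
  proof -
    have "nevanlinna_m (\<lambda>z. f z / f z) r = nevanlinna_m (\<lambda>z. 1) r"
      by (rule nevanlinna_m_cong[OF _ that]) (use nf in \<open>auto simp: nzmero_def elim: eventually_mono\<close>)
    then show ?thesis by (simp add: nevanlinna_const log_plus_def)
  qed
  then have "eventually (\<lambda>r. nevanlinna_m (\<lambda>z. f z / f z) r \<le> 0) at_top"
    by (auto intro: eventually_mono[OF eventually_gt_at_top[of 0]])
  then show ?case using small_mono[OF small_zero[OF nf]] P by auto
next
  note nf = transcendental_nzmero(2)[OF f]
  case (Suc i)
  let ?d = "(deriv ^^ i) f"
  have mer: "(deriv ^^ j) f meromorphic_on UNIV" for j using nf by (auto simp: nzmero_def intro!: meromorphic_intros)
  show ?case
  proof (cases "nzmero (deriv ?d)")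
    case True
    have nd: "nzmero ?d"
    proof (rule ccontr)
      assume "\<not> nzmero ?d"
      then have "\<forall>\<^sub>\<approx>z. ?d z = (\<lambda>_. 0) z" using nzmero_or_zero[OF mer] by auto
      from deriv_cong_cosparse[OF this] have "\<forall>\<^sub>\<approx>z. deriv ?d z = 0" by simp
      moreover have "\<forall>\<^sub>\<approx>z. deriv ?d z \<noteq> 0" using True by (simp add: nzmero_def)
      ultimately have "\<forall>\<^sub>\<approx>z::complex. False" by eventually_elim simp
      then show False by simp
    qed
    have sl: "slow f ?d" using Suc nd by simp
    have s: "small f (\<lambda>r. nevanlinna_m (\<lambda>z. deriv ?d z / ?d z) r)"
      using small_log_derivative[OF f nd sl, of 1 1] by simp
    have "small f (\<lambda>r. nevanlinna_m (\<lambda>z. deriv ?d z / ?d z) r + nevanlinna_m (\<lambda>z. ?d z / f z) r)"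
      using Suc by (intro small_add s) simp
    moreover have "eventually (\<lambda>r. nevanlinna_m (\<lambda>z. deriv ?d z / f z) r \<le>
       nevanlinna_m (\<lambda>z. deriv ?d z / ?d z) r + nevanlinna_m (\<lambda>z. ?d z / f z) r) at_top"
      using eventually_gt_at_top[of 0]
    proof eventually_elim
      case (elim r)
      have "nevanlinna_m (\<lambda>z. deriv ?d z / f z) r = nevanlinna_m (\<lambda>z. (deriv ?d z / ?d z) * (?d z / f z)) r"
        by (rule nevanlinna_m_cong[OF _ elim]) (use nd in \<open>auto simp: nzmero_def elim: eventually_mono\<close>)
      also have "\<dots> \<le> nevanlinna_m (\<lambda>z. deriv ?d z / ?d z) r + nevanlinna_m (\<lambda>z. ?d z / f z) r"
        by (rule nevanlinna_m_mult[OF _ _ elim]) (use mer[of i] nf in \<open>auto simp: nzmero_def intro!: meromorphic_intros\<close>)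
      finally show ?case .
    qed
    ultimately have "small f (\<lambda>r. nevanlinna_m (\<lambda>z. deriv ?d z / f z) r)" by (rule small_mono)
    then show ?thesis using slow_deriv[OF f nd sl True] by simp
  next
    case False
    then have z: "\<forall>\<^sub>\<approx>z. deriv ?d z = 0" using nzmero_or_zero[of "deriv ?d"] mer[of "Suc i"] by auto
    have "nevanlinna_m (\<lambda>z. deriv ?d z / f z) r = 0" if "0 < r" for r
    proof -
      have "nevanlinna_m (\<lambda>z. deriv ?d z / f z) r = nevanlinna_m (\<lambda>z. 0) r"
        by (rule nevanlinna_m_cong[OF _ that]) (use z in \<open>auto elim: eventually_mono\<close>)
      then show ?thesis by (simp add: nevanlinna_const log_plus_def)
    qed
    then have "eventually (\<lambda>r. nevanlinna_m (\<lambda>z. deriv ?d z / f z) r \<le> 0) at_top"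
      by (auto intro: eventually_mono[OF eventually_gt_at_top[of 0]])
    then have "small f (\<lambda>r. nevanlinna_m (\<lambda>z. deriv ?d z / f z) r)" by (rule small_mono[OF small_zero[OF nf]])
    then show ?thesis using False by simp
  qed
qed

section \<open>Comparison of f with F\<close>

lemma log_plus_sum_le:
  assumes "finite A" "\<And>a. a \<in> A \<Longrightarrow> 0 \<le> x a"
  shows "log_plus (\<Sum>a\<in>A. x a) \<le> (\<Sum>a\<in>A. log_plus (x a)) + card A * ln 2"
  using assms
proof (induction A rule: finite_induct)
  case (insert a A)
  have "log_plus (x a + sum x A) \<le> log_plus (x a) + log_plus (sum x A) + ln 2"
    using insert by (intro log_plus_add sum_nonneg) auto
  with insert show ?case by (simp add: algebra_simps)
qed (simp add: log_plus_def)

lemma log_plus_power_le: "0 \<le> x \<Longrightarrow> log_plus (x ^ n) \<le> n * log_plus x"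
proof (induction n)
  case (Suc n)
  have "log_plus (x * x ^ n) \<le> log_plus x + log_plus (x ^ n)" using Suc by (intro log_plus_mult) auto
  with Suc show ?case by (simp add: algebra_simps)
qed (simp add: log_plus_def)

lemma log_plus_prod_le:
  assumes "finite A" "\<And>a. a \<in> A \<Longrightarrow> 0 \<le> x a"
  shows "log_plus (\<Prod>a\<in>A. x a) \<le> (\<Sum>a\<in>A. log_plus (x a))"
  using assms
proof (induction A rule: finite_induct)
  case (insert a A)
  have "log_plus (x a * prod x A) \<le> log_plus (x a) + log_plus (prod x A)"
    using insert by (intro log_plus_mult prod_nonneg) auto
  with insert show ?case by simp
qed (simp add: log_plus_def)

text \<open>
  Zeros of \<open>f\<close> are zeros of \<open>F\<close>, and where \<open>f\<close> is small, \<open>1/f\<close> is bounded by \<open>1/F\<close> times a polynomial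
  in the quotients \<open>f\<^sup>(\<^sup>i\<^sup>)/f\<close>; this compares \<open>T(r,1/f)\<close> with \<open>T(r,1/F)\<close>.
\<close>
lemma nevanlinna_T_diff_polynomial_ge:
  assumes f: "transcendental_meromorphic f" and P: "slow f f" and Q: "diff_polynomial f Q" and al: "1 \<le> \<alpha>"
    and F: "F = (\<lambda>z. f z ^ \<alpha> * Q z)" "nzmero F"
  shows "eventually (\<lambda>r. nevanlinna_T f r \<le> 2 * nevanlinna_T F r) at_top"
proof -
  note nf = transcendental_nzmero(2)[OF f]
  obtain s a M where Qd: "\<And>j. j \<in> {1..s::nat} \<Longrightarrow> diff_monomial f (M j)" "Q = (\<lambda>z. \<Sum>j=1..s. a j * M j z)"
    using Q unfolding diff_polynomial_def by blast
  obtain k n where Md: "\<And>j. j \<in> {1..s} \<Longrightarrow> M j = (\<lambda>z. \<Prod>i\<le>k j. ((deriv ^^ i) f z) ^ (n j i :: nat))"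
    using Qd(1) unfolding diff_monomial_def by metis
  have Qeq: "Q = (\<lambda>z. \<Sum>j=1..s. a j * (\<Prod>i\<le>k j. ((deriv ^^ i) f z) ^ n j i))"
    unfolding Qd(2) using Md by (intro ext sum.cong) auto
  have mer: "(deriv ^^ j) f meromorphic_on UNIV" for j using nf by (auto simp: nzmero_def intro!: meromorphic_intros)
  have merQ: "Q meromorphic_on UNIV" unfolding Qeq by (intro meromorphic_intros mer)
  have nQ: "nzmero Q"
  proof (rule ccontr)
    assume "\<not> nzmero Q"
    then have "\<forall>\<^sub>\<approx>z. Q z = 0" using nzmero_or_zero[OF merQ] by simp
    moreover have "\<forall>\<^sub>\<approx>z. F z \<noteq> 0" using F(2) by (simp add: nzmero_def)
    ultimately have "\<forall>\<^sub>\<approx>z::complex. False" by eventually_elim (simp add: F(1))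
    then show False by simp
  qed
  \<comment> \<open>A zero of f is a zero of F of at least the same order: all derivatives of f,
    hence Q, have no pole there, and \<alpha> >= 1.\<close>
  have pd: "pdeg (\<lambda>z. inverse (f z)) z \<le> pdeg (\<lambda>z. inverse (F z)) z" for z
  proof (cases "zorder f z > 0")
    case True
    \<comment> \<open>Differentiation needs a function that is analytic at the point, while f itself
      may have a wrong value there.\<close>
    define f' where "f' = remove_sings f"
    have ev: "\<forall>\<^sub>\<approx>z. f z = f' z"
      using eventually_remove_sings_eq[of f UNIV] nf by (auto simp: f'_def nzmero_def elim: eventually_mono)
    have an: "f' analytic_on {z}" unfolding f'_def using True by (intro analytic_of_zorder nf) auto
    define Q' where "Q' = (\<lambda>z. \<Sum>j=1..s. a j * (\<Prod>i\<le>k j. ((deriv ^^ i) f' z) ^ n j i))"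
    have "\<forall>\<^sub>\<approx>z. \<forall>i\<in>(\<Union>j\<in>{1..s}. {..k j}). (deriv ^^ i) f z = (deriv ^^ i) f' z"
      by (rule eventually_ball_finite) (auto intro: higher_deriv_cong_cosparse[OF ev])
    then have evQ: "\<forall>\<^sub>\<approx>z. Q z = Q' z"
      by eventually_elim (auto simp: Qeq Q'_def intro!: sum.cong prod.cong)
    have dan: "(deriv ^^ i) f' analytic_on {z}" for i
      by (induction i) (use an in \<open>auto intro: analytic_deriv\<close>)
    have "Q' analytic_on {z}" unfolding Q'_def
      by (intro analytic_on_sum analytic_on_mult analytic_on_const analytic_on_prod analytic_on_power dan)
    then have "zorder Q' z \<ge> 0" by (rule zorder_ge_0[OF _ nzmeroD(3)[OF nzmero_cong[OF evQ nQ]]])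
    then have zQ: "zorder Q z \<ge> 0" using zorder_cong_cosparse[OF evQ] by simp
    have "zorder F z = int \<alpha> * zorder f z + zorder Q z"
      unfolding F(1) using nzmero_zorder_mult[OF nzmero_power[OF nf] nQ] nzmero_zorder_powi[OF nf, of "int \<alpha>"] by simp
    also have "\<dots> \<ge> 1 * zorder f z + 0" using True al zQ by (intro add_mono mult_right_mono) auto
    finally show ?thesis using True by (simp add: pdeg_def nzmero_zorder_inverse[OF nf] nzmero_zorder_inverse[OF F(2)])
  next
    case False
    then have "pdeg (\<lambda>z. inverse (f z)) z = 0" by (simp add: pdeg_def nzmero_zorder_inverse[OF nf])
    then show ?thesis using pdeg_nonneg by simp
  qed
  let ?S = "\<lambda>r. \<Sum>j=1..s. \<Sum>i\<le>k j. real (n j i) * nevanlinna_m (\<lambda>z. (deriv ^^ i) f z / f z) r"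
  define K where "K = (\<Sum>j=1..s. log_plus (norm (a j))) + s * ln 2"
  have main: "nevanlinna_T f r - lcn f \<le> nevanlinna_T F r - lcn F + (?S r + K)" if r: "1 \<le> r" for r
  proof -
    have r0: "0 < r" using r by simp
    have N: "nevanlinna_N (\<lambda>z. inverse (f z)) r \<le> (\<Sum>a\<in>{()}. 1 * nevanlinna_N (\<lambda>z. inverse (F z)) r)"
      by (intro nevanlinna_N_le r) (use pd nzmero_inverse[OF nf] nzmero_inverse[OF F(2)] in auto)
    let ?\<psi> = "\<lambda>z. \<Sum>j=1..s. \<Sum>i\<le>k j. real (n j i) * log_plus (norm ((deriv ^^ i) f z / f z))"
    have "\<forall>\<^sub>\<approx>z. f z \<noteq> 0 \<and> F z \<noteq> 0" using nf F(2) by (auto simp: nzmero_def elim: eventually_elim2)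
    from cosparse_finite[OF this, of r] have finB: "finite {z. norm z \<le> r \<and> \<not> (f z \<noteq> 0 \<and> F z \<noteq> 0)}" .
    have merF: "(\<lambda>z. inverse (F z)) meromorphic_on UNIV" using nzmero_inverse[OF F(2)] by (simp add: nzmero_def)
    have merq: "(\<lambda>z. (deriv ^^ i) f z / f z) meromorphic_on UNIV" for i
      by (intro meromorphic_intros mer) (use mer[of 0] in simp)
    have c0: "cint (\<lambda>z. log_plus (norm (inverse (F z)))) r" by (rule cint_log_plus[OF merF r0])
    have cq: "cint (\<lambda>z. log_plus (norm ((deriv ^^ i) f z / f z))) r" for i by (rule cint_log_plus[OF merq r0])
    have c1: "cint ?\<psi> r" by (intro cint_sum cint_cmult cq) auto
    have "nevanlinna_m (\<lambda>z. inverse (f z)) r \<le> cmean (\<lambda>z. log_plus (norm (inverse (F z))) + (?\<psi> z + K)) r"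
    proof (rule nevanlinna_m_mono[OF _ _ r0 finB])
      show "(\<lambda>z. inverse (f z)) meromorphic_on UNIV" using nzmero_inverse[OF nf] by (simp add: nzmero_def)
      show "cint (\<lambda>z. log_plus (norm (inverse (F z))) + (?\<psi> z + K)) r" by (intro cint_add c0 c1 cint_const)
      fix z assume "norm z = r" "z \<notin> {z. norm z \<le> r \<and> \<not> (f z \<noteq> 0 \<and> F z \<noteq> 0)}"
      then have nz: "f z \<noteq> 0" "F z \<noteq> 0" by auto
      have psi0: "0 \<le> ?\<psi> z" by (intro sum_nonneg mult_nonneg_nonneg log_plus_nonneg) auto
      have K0: "0 \<le> K" unfolding K_def by (intro add_nonneg_nonneg sum_nonneg log_plus_nonneg) auto
      show "log_plus (norm (inverse (f z))) \<le> log_plus (norm (inverse (F z))) + (?\<psi> z + K)"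
      \<comment> \<open>Where |f| >= 1 the left side is 0. Where |f| < 1, both |f|^(\<alpha> - 1) <=
        1 and |f^(i)| <= |f^(i) / f|.\<close>
      proof (cases "norm (f z) \<ge> 1")
        case True
        then have "norm (inverse (f z)) \<le> 1" by (simp add: norm_inverse inverse_le_1_iff)
        then have "log_plus (norm (inverse (f z))) = 0" by (simp add: log_plus_def)
        then show ?thesis using psi0 K0 log_plus_nonneg[of "norm (inverse (F z))"] by simp
      next
        case False
        have "inverse (f z) = f z ^ (\<alpha> - 1) * Q z * inverse (F z)"
        proof -
          have "f z ^ \<alpha> = f z * f z ^ (\<alpha> - 1)" using al by (cases \<alpha>) auto
          then have "F z = f z * (f z ^ (\<alpha> - 1) * Q z)" by (simp add: F(1))
          then show ?thesis using nz by (simp add: field_simps)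
        qed
        then have "norm (inverse (f z)) = norm (f z) ^ (\<alpha> - 1) * (norm (Q z) * norm (inverse (F z)))"
          by (simp add: norm_mult norm_power)
        also have "\<dots> \<le> 1 * (norm (Q z) * norm (inverse (F z)))"
          using False by (intro mult_right_mono power_le_one) auto
        finally have "log_plus (norm (inverse (f z))) \<le> log_plus (norm (Q z) * norm (inverse (F z)))"
          by (intro log_plus_mono) simp
        also have "\<dots> \<le> log_plus (norm (Q z)) + log_plus (norm (inverse (F z)))" by (rule log_plus_mult) auto
        also have "log_plus (norm (Q z)) \<le> ?\<psi> z + K"
        proof -
          have dq: "norm ((deriv ^^ i) f z) \<le> norm ((deriv ^^ i) f z / f z)" for i
          proof -
            have "norm ((deriv ^^ i) f z) = norm ((deriv ^^ i) f z / f z) * norm (f z)" using nz by (simp add: norm_divide)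
            also have "\<dots> \<le> norm ((deriv ^^ i) f z / f z) * 1" using False by (intro mult_left_mono) auto
            finally show ?thesis by simp
          qed
          have "norm (Q z) \<le> (\<Sum>j=1..s. norm (a j) * (\<Prod>i\<le>k j. norm ((deriv ^^ i) f z) ^ n j i))"
            unfolding Qeq by (rule order.trans[OF norm_sum]) (simp add: norm_mult norm_power prod_norm[symmetric])
          then have "log_plus (norm (Q z)) \<le> log_plus (\<Sum>j=1..s. norm (a j) * (\<Prod>i\<le>k j. norm ((deriv ^^ i) f z) ^ n j i))"
            by (rule log_plus_mono)
          also have "\<dots> \<le> (\<Sum>j=1..s. log_plus (norm (a j) * (\<Prod>i\<le>k j. norm ((deriv ^^ i) f z) ^ n j i))) + card {1..s} * ln 2"
            by (rule log_plus_sum_le) (auto intro!: mult_nonneg_nonneg prod_nonneg)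
          also have "(\<Sum>j=1..s. log_plus (norm (a j) * (\<Prod>i\<le>k j. norm ((deriv ^^ i) f z) ^ n j i)))
              \<le> (\<Sum>j=1..s. log_plus (norm (a j)) + (\<Sum>i\<le>k j. real (n j i) * log_plus (norm ((deriv ^^ i) f z / f z))))"
          proof (rule sum_mono)
            fix j
            have "log_plus (norm (a j) * (\<Prod>i\<le>k j. norm ((deriv ^^ i) f z) ^ n j i))
              \<le> log_plus (norm (a j)) + log_plus (\<Prod>i\<le>k j. norm ((deriv ^^ i) f z) ^ n j i)"
              by (rule log_plus_mult) (auto intro!: prod_nonneg)
            also have "log_plus (\<Prod>i\<le>k j. norm ((deriv ^^ i) f z) ^ n j i) \<le> (\<Sum>i\<le>k j. log_plus (norm ((deriv ^^ i) f z) ^ n j i))"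
              by (rule log_plus_prod_le) auto
            also have "\<dots> \<le> (\<Sum>i\<le>k j. real (n j i) * log_plus (norm ((deriv ^^ i) f z / f z)))"
            proof (rule sum_mono)
              fix i
              have "log_plus (norm ((deriv ^^ i) f z) ^ n j i) \<le> real (n j i) * log_plus (norm ((deriv ^^ i) f z))"
                by (rule log_plus_power_le) simp
              also have "\<dots> \<le> real (n j i) * log_plus (norm ((deriv ^^ i) f z / f z))"
                by (intro mult_left_mono log_plus_mono dq) auto
              finally show "log_plus (norm ((deriv ^^ i) f z) ^ n j i) \<le> real (n j i) * log_plus (norm ((deriv ^^ i) f z / f z))" .
            qed
            finally show "log_plus (norm (a j) * (\<Prod>i\<le>k j. norm ((deriv ^^ i) f z) ^ n j i))
               \<le> log_plus (norm (a j)) + (\<Sum>i\<le>k j. real (n j i) * log_plus (norm ((deriv ^^ i) f z / f z)))" by simp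
          qed
          also have "\<dots> + card {1..s} * ln 2 = ?\<psi> z + K" by (simp add: K_def sum.distrib)
          finally show ?thesis by simp
        qed
        finally show ?thesis by simp
      qed
    qed
    also have "\<dots> = cmean (\<lambda>z. log_plus (norm (inverse (F z)))) r + (cmean ?\<psi> r + K)"
      by (subst cmean_add[OF c0 cint_add[OF c1 cint_const]], subst cmean_add[OF c1 cint_const]) (simp only: cmean_const)
    also have "cmean ?\<psi> r = (\<Sum>j=1..s. cmean (\<lambda>z. \<Sum>i\<le>k j. real (n j i) * log_plus (norm ((deriv ^^ i) f z / f z))) r)"
      by (rule cmean_sum) (auto intro!: cint_sum cint_cmult cq)
    also have "\<dots> = ?S r"
      unfolding nevanlinna_m_eq_cmean
      by (intro sum.cong refl, subst cmean_sum) (auto intro!: cint_cmult cq simp only: cmean_cmult finite_atMost)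
    finally have "nevanlinna_m (\<lambda>z. inverse (f z)) r \<le> nevanlinna_m (\<lambda>z. inverse (F z)) r + (?S r + K)"
      unfolding nevanlinna_m_eq_cmean[of "\<lambda>z. inverse (F z)"] .
    then have "nevanlinna_T (\<lambda>z. inverse (f z)) r \<le> nevanlinna_T (\<lambda>z. inverse (F z)) r + (?S r + K)"
      using N unfolding nevanlinna_T_def by simp
    then show ?thesis using first_main_theorem[OF nf r0] first_main_theorem[OF F(2) r0] by simp
  qed
  have "small f (\<lambda>r. ?S r + (K + lcn f - lcn F))"
    using small_higher_deriv_quotient[OF f P]
    by (intro small_add small_const f small_sum small_cmult nf) auto
  \<comment> \<open>Errors of at most T(r, f) / 2 give T(r, f) <= T(r, F) + T(r, f) / 2, hence the
    factor 2.\<close>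
  then have "eventually (\<lambda>r. ?S r + (K + lcn f - lcn F) \<le> (1/2) * nevanlinna_T f r) at_top"
    by (rule smallD) simp
  then show ?thesis using eventually_ge_at_top[of 1]
  proof eventually_elim
    case (elim r)
    then show ?case using main[of r] by linarith
  qed
qed

section \<open>Iterated logarithms\<close>

text \<open>The guard exp^[k] 1 <= x keeps all intermediate logarithms at 1 or above, away from the
  conventional values of \<open>ln\<close> at nonpositive arguments.\<close>

lemma lg_ge_one: "(exp ^^ k) 1 \<le> x \<Longrightarrow> 1 \<le> (ln ^^ k) (x::real)"
proof (induction k arbitrary: x)
  case (Suc k)
  have "exp ((exp ^^ k) (1::real)) \<le> x" using Suc.prems by simp
  moreover from this have "0 < x" using exp_gt_zero order.strict_trans2 by blast
  ultimately have "(exp ^^ k) 1 \<le> ln x" by (simp add: ln_ge_iff)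
  from Suc.IH[OF this] show ?case by (simp add: funpow_swap1)
qed auto

lemma lg_mono: "(exp ^^ k) 1 \<le> x \<Longrightarrow> x \<le> y \<Longrightarrow> (ln ^^ k) x \<le> (ln ^^ k) (y::real)"
proof (induction k arbitrary: x y)
  case (Suc k)
  have "exp ((exp ^^ k) (1::real)) \<le> x" using Suc.prems by simp
  moreover from this have x: "0 < x" using exp_gt_zero order.strict_trans2 by blast
  ultimately have "(exp ^^ k) 1 \<le> ln x" by (simp add: ln_ge_iff)
  from Suc.IH[OF this, of "ln y"] show ?case using x Suc.prems by (simp add: funpow_swap1)
qed auto

lemma lg_le_self: "(exp ^^ k) 1 \<le> x \<Longrightarrow> (ln ^^ k) x \<le> (x::real)"
proof (induction k arbitrary: x)
  case (Suc k)
  have "exp ((exp ^^ k) (1::real)) \<le> x" using Suc.prems by simp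
  moreover from this have x: "0 < x" using exp_gt_zero order.strict_trans2 by blast
  ultimately have "(exp ^^ k) 1 \<le> ln x" by (simp add: ln_ge_iff)
  from Suc.IH[OF this] have "(ln ^^ k) (ln x) \<le> ln x" .
  also have "\<dots> \<le> x" using ln_le_minus_one[OF x] by simp
  finally show ?case by (simp add: funpow_swap1)
qed auto

lemma filterlim_lg: "filterlim ((ln::real \<Rightarrow> real) ^^ k) at_top at_top"
proof (induction k)
  case (Suc k)
  show ?case using filterlim_compose[OF ln_at_top Suc] by simp
qed (simp add: filterlim_ident)

lemma filterlim_iterated_exp: "filterlim ((exp::real \<Rightarrow> real) ^^ k) at_top at_top"
proof (induction k)
  case (Suc k)
  show ?case using filterlim_compose[OF exp_at_top Suc] by simp
qed (simp add: filterlim_ident)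

lemma lg_iterated_exp: "(ln ^^ k) ((exp ^^ k) x) = (x::real)"
  by (induction k arbitrary: x) (simp_all add: funpow_swap1[of ln])

lemma lg_iterated_exp_pred: "1 \<le> n \<Longrightarrow> (ln ^^ n) ((exp ^^ (n - 1)) r) = ln (r::real)"
  using lg_iterated_exp[of "n - 1" r] by (cases n) auto

lemma lg_add: "(ln ^^ (j + k)) (x::real) = (ln ^^ j) ((ln ^^ k) x)"
  by (simp add: funpow_add)

text \<open>A logarithm turns the factor D into the summand ln D, which is absorbed again since the
  iterated logarithm is eventually at least 1; so D becomes 1 + ln D.\<close>

lemma lg_scale:
  assumes "1 \<le> C"
  shows "\<exists>D\<ge>1. eventually (\<lambda>x. (ln ^^ k) (C * x) \<le> D * (ln ^^ k) (x::real)) at_top"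
proof (induction k)
  case 0
  then show ?case using assms by (intro exI[of _ C]) auto
next
  case (Suc k)
  then obtain D where D: "D \<ge> 1" "eventually (\<lambda>x. (ln ^^ k) (C * x) \<le> D * (ln ^^ k) (x::real)) at_top" by blast
  have e2: "eventually (\<lambda>x::real. 1 \<le> (ln ^^ Suc k) x) at_top"
    using filterlim_lg[of "Suc k"] unfolding filterlim_at_top by blast
  have "eventually (\<lambda>x. (ln ^^ Suc k) (C * x) \<le> (1 + ln D) * (ln ^^ Suc k) (x::real)) at_top"
    using D(2) e2 eventually_ge_at_top[of "(exp ^^ k) 1"] eventually_ge_at_top[of 0]
  proof eventually_elim
    case (elim x)
    have "x \<le> C * x" using mult_right_mono[OF assms, of x] elim by simp
    then have l1: "1 \<le> (ln ^^ k) x" "1 \<le> (ln ^^ k) (C * x)" using elim by (auto intro: lg_ge_one)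
    have "(ln ^^ Suc k) (C * x) \<le> ln (D * (ln ^^ k) x)" using elim(1) l1 by simp
    also have "\<dots> = ln D * 1 + (ln ^^ Suc k) x" using D(1) l1 by (simp add: ln_mult)
    also have "\<dots> \<le> ln D * (ln ^^ Suc k) x + (ln ^^ Suc k) x"
      using elim(2) D(1) by (intro add_mono mult_left_mono) auto
    finally show ?case by (simp add: algebra_simps)
  qed
  moreover have "1 + ln D \<ge> 1" using D(1) by simp
  ultimately show ?case by blast
qed

text \<open>ln (C x^j) = ln C + j ln x <= (j + ln C) ln x for x >= e, and \<open>lg_scale\<close>
  does the rest. The first logarithm is what turns the power into a factor, hence k >= 1.\<close>

lemma lg_scale_power:
  assumes "1 \<le> C" "1 \<le> (j::nat)" "1 \<le> k"
  shows "\<exists>D\<ge>1. eventually (\<lambda>x. (ln ^^ k) (C * x ^ j) \<le> D * (ln ^^ k) (x::real)) at_top"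
proof -
  obtain k' where k: "k = Suc k'" using assms(3) by (cases k) auto
  obtain D where D: "D \<ge> 1" "eventually (\<lambda>x. (ln ^^ k') ((real j + ln C) * x) \<le> D * (ln ^^ k') (x::real)) at_top"
  proof -
    have "1 \<le> real j" "0 \<le> ln C" using assms by simp_all
    then have "1 \<le> real j + ln C" by linarith
    from lg_scale[OF this] show ?thesis using that by blast
  qed
  from eventually_compose_filterlim[OF D(2) ln_at_top]
  have "eventually (\<lambda>x. (ln ^^ k) (C * x ^ j) \<le> D * (ln ^^ k) (x::real)) at_top"
    using eventually_ge_at_top[of "exp ((exp ^^ k') 1)"] eventually_ge_at_top[of "exp 1"]
  proof eventually_elim
    case (elim x)
    have x: "0 < x" using elim(3) exp_gt_zero order.strict_trans2 by blast
    have lx: "(exp ^^ k') 1 \<le> ln x" "1 \<le> ln x" using elim x by (simp_all add: ln_ge_iff)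
    have eq: "ln (C * x ^ j) = ln C + real j * ln x" using assms(1) x by (simp add: ln_mult ln_realpow)
    have "1 * ln x \<le> real j * ln x" using assms(2) lx by (intro mult_right_mono) auto
    then have ge: "(exp ^^ k') 1 \<le> ln (C * x ^ j)" using lx assms(1) ln_ge_zero[of C] unfolding eq by linarith
    have "ln C * 1 \<le> ln C * ln x" using assms(1) lx by (intro mult_left_mono) auto
    then have le: "ln (C * x ^ j) \<le> (real j + ln C) * ln x" unfolding eq by (simp add: algebra_simps)
    have "(ln ^^ k) (C * x ^ j) = (ln ^^ k') (ln (C * x ^ j))" by (simp add: k funpow_swap1)
    also have "\<dots> \<le> (ln ^^ k') ((real j + ln C) * ln x)" by (rule lg_mono[OF ge le])
    also have "\<dots> \<le> D * (ln ^^ k') (ln x)" by (rule elim(1))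
    finally show ?case by (simp add: k funpow_swap1)
  qed
  with D(1) show ?thesis by blast
qed

lemma eventually_lg_ge: "filterlim X at_top F \<Longrightarrow> eventually (\<lambda>r. (exp ^^ k) (1::real) \<le> X r) F"
  by (simp add: filterlim_at_top)

section \<open>Growth estimates on logarithmic scales\<close>

lemma transcendental_T_at_top:
  assumes "transcendental_meromorphic f" shows "filterlim (nevanlinna_T f) at_top at_top"
  by (rule filterlim_at_top_mono[OF ln_at_top]) (use transcendental_growth[OF assms, of 1] in simp)

lemma exp_dominates_linear:
  assumes "0 < (c::real)"
  shows "eventually (\<lambda>y. K * y < exp (c * y)) at_top"
  using eventually_gt_at_top[of "2 * \<bar>K\<bar> / c\<^sup>2"] eventually_gt_at_top[of 0]
proof eventually_elim
  case (elim y)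
  have "0 \<le> c * y" using assms elim by simp
  from exp_lower_Taylor_quadratic[OF this] have e: "(c * y)\<^sup>2 / 2 < exp (c * y)" using \<open>0 \<le> c * y\<close> by linarith
  have "2 * \<bar>K\<bar> < c\<^sup>2 * y" using elim(1) assms by (simp add: pos_divide_less_eq mult.commute)
  then have "2 * \<bar>K\<bar> * y < c\<^sup>2 * y * y" using elim(2) by (rule mult_strict_right_mono)
  then have "\<bar>K\<bar> * y < (c * y)\<^sup>2 / 2" by (simp add: power2_eq_square algebra_simps)
  moreover have "K * y \<le> \<bar>K\<bar> * y" using elim(2) by (intro mult_right_mono) auto
  ultimately show ?case using e by linarith
qed

text \<open>If \<epsilon> T(r) <= log T(a r^k) at some large r, then s further logarithms, the lower
  bound at r and the upper bound at a r^k give exp (c log^[q] r) <= D log^[q] r with a constant D,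
  which is impossible for large r.\<close>

lemma slow_self:
  assumes f: "transcendental_meromorphic f" and q: "1 \<le> q" and C0: "0 < C0" and c: "0 < c"
    and up: "eventually (\<lambda>r. (ln ^^ Suc s) (nevanlinna_T f r) \<le> C0 * (ln ^^ q) r) at_top"
    and lo: "eventually (\<lambda>r. c * (ln ^^ q) r \<le> (ln ^^ Suc s) (nevanlinna_T f r)) at_top"
  shows "slow f f"
  unfolding slow_def small_def
proof (intro allI impI)
  fix a \<epsilon> :: real and k :: nat assume a: "1 \<le> a" and k: "1 \<le> k" and e: "0 < \<epsilon>"
  let ?T = "nevanlinna_T f"
  note Tinf = transcendental_T_at_top[OF f]
  \<comment> \<open>Undoes the factor \<epsilon>; the maximum with 1 is what \<open>lg_scale\<close>
    requires.\<close>
  define C where "C = max 1 (1 / \<epsilon>)"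
  obtain D1 where D1: "D1 \<ge> 1" "eventually (\<lambda>x. (ln ^^ q) (a * x ^ k) \<le> D1 * (ln ^^ q) x) at_top"
    using lg_scale_power[OF a k q] by blast
  obtain D2 where D2: "D2 \<ge> 1" "eventually (\<lambda>x. (ln ^^ s) (C * x) \<le> D2 * (ln ^^ s) x) at_top"
    using lg_scale[of C s] by (auto simp: C_def)
  have eT: "filterlim (\<lambda>r. \<epsilon> * ?T r) at_top at_top" using Tinf e by (intro filterlim_tendsto_pos_mult_at_top[OF tendsto_const])
  have Rinf: "filterlim (\<lambda>r::real. a * r ^ k) at_top at_top"
    using a k by (intro filterlim_tendsto_pos_mult_at_top[OF tendsto_const] filterlim_pow_at_top filterlim_ident) auto
  have dom: "eventually (\<lambda>y. (D2 * C0 * D1) * y < exp (c * y)) at_top" by (rule exp_dominates_linear[OF c])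
  show "eventually (\<lambda>r. log_plus (?T (a * r ^ k)) \<le> \<epsilon> * ?T r) at_top"
    using lo D1(2) eventually_compose_filterlim[OF D2(2) eT] eventually_compose_filterlim[OF up Rinf]
      eventually_lg_ge[OF eT, of s] eventually_lg_ge[OF Tinf, of s]
      eventually_compose_filterlim[OF dom filterlim_lg[of q]]
      eventually_gt_at_top[of 0] eventually_compose_filterlim[OF filterlim_at_top[THEN iffD1, OF Tinf, rule_format, of 1] Rinf]
  proof eventually_elim
    case (elim r)
    let ?X = "log_plus (?T (a * r ^ k))" and ?y = "(ln ^^ q) r"
    have X: "?X = ln (?T (a * r ^ k))" using elim(9) by (auto simp: log_plus_def)
    have T1: "1 \<le> (ln ^^ s) (?T r)" by (rule lg_ge_one[OF elim(6)])
    show ?case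
    proof (rule ccontr)
      assume "\<not> ?thesis"
      then have lt: "\<epsilon> * ?T r \<le> ?X" by simp
      have Tpos: "0 \<le> ?T r" using elim(6) order.trans[of 0 "(exp ^^ s) (1::real)" "?T r"]
        by (cases s) (auto intro: order.trans[OF less_imp_le[OF exp_gt_zero]])
      have TC: "?T r \<le> C * (\<epsilon> * ?T r)"
      proof -
        have "1 \<le> C * \<epsilon>" using e mult_right_mono[of "1/\<epsilon>" C \<epsilon>] by (simp add: C_def)
        from mult_right_mono[OF this Tpos] show ?thesis by (simp add: mult.assoc)
      qed
      have "exp (c * ?y) \<le> exp ((ln ^^ Suc s) (?T r))" using elim(1) by simp
      also have "\<dots> = (ln ^^ s) (?T r)" using T1 by simp
      also have "\<dots> \<le> (ln ^^ s) (C * (\<epsilon> * ?T r))" by (rule lg_mono[OF elim(6) TC])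
      also have "\<dots> \<le> D2 * (ln ^^ s) (\<epsilon> * ?T r)" by (rule elim(3))
      also have "(ln ^^ s) (\<epsilon> * ?T r) \<le> (ln ^^ s) ?X" by (rule lg_mono[OF elim(5) lt])
      also have "(ln ^^ s) ?X = (ln ^^ Suc s) (?T (a * r ^ k))" unfolding X by (simp add: funpow_swap1)
      also have "\<dots> \<le> C0 * (ln ^^ q) (a * r ^ k)" by (rule elim(4))
      also have "(ln ^^ q) (a * r ^ k) \<le> D1 * ?y" by (rule elim(2))
      finally have "exp (c * ?y) \<le> (D2 * C0 * D1) * ?y" using D2(1) C0 by (simp add: mult.assoc mult_left_mono)
      then show False using elim(7) by simp
    qed
  qed
qed

lemma norm_le_max_modulus:
  assumes g: "g holomorphic_on UNIV" and r: "0 < r" and z: "norm z \<le> r"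
  shows "norm (g z) \<le> max_modulus g r"
proof (rule maximum_modulus_frontier[of g "cball 0 r"])
  have cg: "continuous_on A g" for A using holomorphic_on_imp_continuous_on[OF g] continuous_on_subset by blast
  show "continuous_on (closure (cball 0 r)) g" by (rule cg)
  fix w :: complex assume "w \<in> frontier (cball 0 r)"
  then have w: "w \<in> sphere 0 r" using r by (simp add: frontier_cball)
  have "compact ((\<lambda>z. norm (g z)) ` sphere 0 r)" by (intro compact_continuous_image continuous_intros cg compact_sphere)
  then have "bdd_above ((\<lambda>z. norm (g z)) ` sphere 0 r)" by (intro bounded_imp_bdd_above compact_imp_bounded)
  then show "norm (g w) \<le> max_modulus g r" unfolding max_modulus_def by (rule cSUP_upper[OF w])
qed (use z g in \<open>auto intro: holomorphic_on_subset\<close>)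

lemma max_modulus_at_top:
  assumes g: "g holomorphic_on UNIV" "\<not> g constant_on UNIV"
  shows "filterlim (max_modulus g) at_top at_top"
  unfolding filterlim_at_top
proof
  fix Z
  have "\<exists>z0. norm (g z0) > Z"
  proof (rule ccontr)
    assume "\<not> ?thesis"
    then have "bounded (range g)" unfolding bounded_iff by (intro exI[of _ Z]) (auto simp: not_less)
    then show False using Liouville_theorem[OF g(1)] g(2) by blast
  qed
  then obtain z0 where z0: "norm (g z0) > Z" by blast
  show "eventually (\<lambda>r. Z \<le> max_modulus g r) at_top"
    using eventually_gt_at_top[of 0] eventually_ge_at_top[of "norm z0"]
  proof eventually_elim
    case (elim r)
    then show ?case using norm_le_max_modulus[OF g(1), of r z0] z0 by simp
  qed
qed

lemma T_compose_at_top: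
  assumes f: "transcendental_meromorphic f" and g: "g holomorphic_on UNIV" "\<not> g constant_on UNIV"
  shows "filterlim (nevanlinna_T (f \<circ> g)) at_top at_top"
proof -
  have nz: "nzmero (\<lambda>z. (f \<circ> g) z - a)" for a
    using nzmero_compose[OF transcendental_nzmero(1)[OF f] g] by simp
  have nz0: "nzmero (f \<circ> g)" using nz[of 0] by (simp add: o_def)
  obtain C where C: "\<And>r. 1 \<le> r \<Longrightarrow> ln r - C \<le> nevanlinna_T (f \<circ> g) r"
    using nevanlinna_T_ge_ln[OF nz0 nz] by metis
  have "filterlim (\<lambda>r::real. - C + ln r) at_top at_top"
    by (rule filterlim_tendsto_add_at_top[OF tendsto_const ln_at_top])
  then show ?thesis
    by (rule filterlim_at_top_mono) (use C in \<open>auto intro!: eventually_mono[OF eventually_ge_at_top[of 1]]\<close>)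
qed

lemma lg_T_compose_le:
  assumes f: "transcendental_meromorphic f" and g: "g holomorphic_on UNIV" "\<not> g constant_on UNIV"
    and q: "1 \<le> q" and C0: "0 < C0"
    and up: "eventually (\<lambda>r. (ln ^^ k) (nevanlinna_T f r) \<le> C0 * (ln ^^ q) r) at_top"
  shows "\<exists>D\<ge>1. eventually (\<lambda>r. (ln ^^ k) (nevanlinna_T (f \<circ> g) r) \<le> D * (ln ^^ q) (max_modulus g r)) at_top"
proof -
  let ?T = "nevanlinna_T f" and ?M = "max_modulus g"
  note nf = transcendental_nzmero(2)[OF f]
  note Tinf = transcendental_T_at_top[OF f]
  note Minf = max_modulus_at_top[OF g]
  obtain C1 where C1: "C1 > 0"
    "\<And>r R. 1 \<le> r \<Longrightarrow> 2 \<le> R \<Longrightarrow> (\<And>z. norm z \<le> r \<Longrightarrow> norm (g z) \<le> R / 2) \<Longrightarrow> nevanlinna_T (\<lambda>z. f (g z)) r \<le> C1 * Tb f R"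
    using nevanlinna_T_compose[OF nf g] by metis
  define K where "K = max 1 (C1 * (8 + 4 * \<bar>lcn f\<bar>))"
  obtain D1 where D1: "D1 \<ge> 1" "eventually (\<lambda>x. (ln ^^ k) (K * x) \<le> D1 * (ln ^^ k) x) at_top"
    using lg_scale[of K k] by (auto simp: K_def)
  obtain D2 where D2: "D2 \<ge> 1" "eventually (\<lambda>x. (ln ^^ q) (4 * x ^ 2) \<le> D2 * (ln ^^ q) (x::real)) at_top"
    using lg_scale_power[of 4 2 q] q by auto
  let ?R = "\<lambda>r. 2 * ?M r"
  have Rinf: "filterlim ?R at_top at_top" using Minf by (intro filterlim_tendsto_pos_mult_at_top[OF tendsto_const]) auto
  have Rinf2: "filterlim (\<lambda>r. (?R r)\<^sup>2) at_top at_top" by (rule filterlim_pow_at_top[OF _ Rinf]) simp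
  \<comment> \<open>T(R) and T(R^2) are not compared with each other; the maximum stands for the
    larger one, and either is bounded through log^[q] (R^2).\<close>
  let ?\<Phi> = "\<lambda>r. max (?T (?R r)) (?T ((?R r)\<^sup>2))"
  have TR: "filterlim (\<lambda>r. ?T (?R r)) at_top at_top" by (rule filterlim_compose[OF Tinf Rinf])
  have \<Phi>inf: "filterlim ?\<Phi> at_top at_top" by (rule filterlim_at_top_mono[OF TR]) auto
  have Tfg: "filterlim (nevanlinna_T (f \<circ> g)) at_top at_top" by (rule T_compose_at_top[OF f g])
  have "eventually (\<lambda>r. (ln ^^ k) (nevanlinna_T (f \<circ> g) r) \<le> (D1 * C0 * D2) * (ln ^^ q) (?M r)) at_top"
    using eventually_compose_filterlim[OF D1(2) \<Phi>inf] eventually_compose_filterlim[OF D2(2) Minf]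
      eventually_compose_filterlim[OF up Rinf] eventually_compose_filterlim[OF up Rinf2]
      eventually_lg_ge[OF Tfg, of k] eventually_lg_ge[OF Rinf, of q]
      filterlim_at_top[THEN iffD1, OF Rinf, rule_format, of 2] filterlim_at_top[THEN iffD1, OF \<Phi>inf, rule_format, of 1]
      eventually_ge_at_top[of 1]
  proof eventually_elim
    case (elim r)
    have R: "?R r \<le> (?R r)\<^sup>2" using elim(7) mult_left_mono[of 1 "?R r" "?R r"] by (simp add: power2_eq_square)
    have "nevanlinna_T (f \<circ> g) r \<le> C1 * Tb f (?R r)"
      unfolding o_def by (rule C1(2)[OF elim(9,7)]) (use norm_le_max_modulus[OF g(1), of r] elim(9) in auto)
    also have "Tb f (?R r) \<le> (8 + 4 * \<bar>lcn f\<bar>) * ?\<Phi> r"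
    proof -
      have "4 * \<bar>lcn f\<bar> * 1 \<le> 4 * \<bar>lcn f\<bar> * ?\<Phi> r" by (rule mult_left_mono[OF elim(8)]) simp
      then show ?thesis unfolding Tb_def distrib_right by linarith
    qed
    then have "C1 * Tb f (?R r) \<le> C1 * ((8 + 4 * \<bar>lcn f\<bar>) * ?\<Phi> r)" using C1(1) by (intro mult_left_mono) auto
    also have "\<dots> = (C1 * (8 + 4 * \<bar>lcn f\<bar>)) * ?\<Phi> r" by (simp only: mult.assoc)
    also have "\<dots> \<le> K * ?\<Phi> r" using elim(8) by (intro mult_right_mono) (auto simp: K_def)
    finally have "(ln ^^ k) (nevanlinna_T (f \<circ> g) r) \<le> (ln ^^ k) (K * ?\<Phi> r)" by (rule lg_mono[OF elim(5)])
    also have "\<dots> \<le> D1 * (ln ^^ k) (?\<Phi> r)" by (rule elim(1))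
    also have "(ln ^^ k) (?\<Phi> r) \<le> C0 * (ln ^^ q) ((?R r)\<^sup>2)"
    proof -
      have "C0 * (ln ^^ q) (?R r) \<le> C0 * (ln ^^ q) ((?R r)\<^sup>2)"
        using C0 by (intro mult_left_mono lg_mono[OF elim(6) R]) auto
      then show ?thesis using elim(3,4) unfolding max_def by (auto split: if_splits)
    qed
    also have "(?R r)\<^sup>2 = 4 * (?M r) ^ 2" by (simp add: power_mult_distrib)
    also have "(ln ^^ q) (4 * (?M r) ^ 2) \<le> D2 * (ln ^^ q) (?M r)" by (rule elim(2))
    finally show ?case using D1(1) C0 by (simp add: mult.assoc mult_left_mono o_def)
  qed
  \<comment> \<open>The constant is raised to at least 1, so that \<open>lg_scale\<close> can later
    be applied with it.\<close>
  moreover have "(D1 * C0 * D2) * (ln ^^ q) x \<le> max 1 (D1 * C0 * D2) * (ln ^^ q) x" if "1 \<le> (ln ^^ q) x" for x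
    using that by (intro mult_right_mono) auto
  ultimately have "eventually (\<lambda>r. (ln ^^ k) (nevanlinna_T (f \<circ> g) r) \<le> max 1 (D1 * C0 * D2) * (ln ^^ q) (?M r)) at_top"
    using eventually_lg_ge[OF Minf, of q] 
    by (smt (verit, best) eventually_elim2 lg_ge_one)
  then show ?thesis by (intro exI[of _ "max 1 (D1 * C0 * D2)"]) auto
qed

section \<open>The limits of the quotients\<close>

lemma iter_log_of_nat: "iter_log (int k) = (ln ^^ k)"
  by (simp add: iter_log_def)

lemma quotient_tendsto_zero:
  fixes num den :: "real \<Rightarrow> real"
  assumes "eventually (\<lambda>r. \<bar>num r\<bar> \<le> K * r powr a) at_top" "eventually (\<lambda>r. r powr b \<le> D * den r) at_top"
    and D: "0 < D" and "a < b"
  shows "((\<lambda>r. num r / den r) \<longlongrightarrow> 0) at_top"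
proof (rule tendsto_0_le[where K = "\<bar>K\<bar> * D"])
  show "((\<lambda>r::real. r powr (a - b)) \<longlongrightarrow> 0) at_top" using assms(4) by (intro tendsto_neg_powr filterlim_ident) auto
  show "\<forall>\<^sub>F r in at_top. norm (num r / den r) \<le> norm (r powr (a - b)) * (\<bar>K\<bar> * D)"
    using assms(1,2) eventually_gt_at_top[of 0]
  proof eventually_elim
    case (elim r)
    have p: "0 < r powr b" using elim(3) by simp
    then have den: "0 < den r" using elim(2) D zero_less_mult_pos[of D "den r"] by linarith
    have le: "1 / den r \<le> D / r powr b" using elim(2) den p by (simp add: field_simps)
    have "norm (num r / den r) = \<bar>num r\<bar> * (1 / den r)" using den by simp
    also have "\<dots> \<le> (\<bar>K\<bar> * r powr a) * (D / r powr b)"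
    proof (rule mult_mono[OF _ le])
      show "\<bar>num r\<bar> \<le> \<bar>K\<bar> * r powr a" using elim(1) mult_right_mono[OF abs_ge_self[of K] powr_ge_zero[of r a]] by linarith
    qed (use den in auto)
    also have "\<dots> = norm (r powr (a - b)) * (\<bar>K\<bar> * D)" by (simp add: powr_diff)
    finally show ?case .
  qed
qed

lemma ln_le_powr: assumes "0 < b" "0 < (r::real)" shows "ln r \<le> (1 / b) * r powr b"
proof -
  have "b * ln r = ln (r powr b)" using assms by (simp add: powr_def)
  also have "\<dots> \<le> r powr b" using ln_le_minus_one[of "r powr b"] assms by simp
  finally show ?thesis using assms by (simp add: field_simps)
qed

lemma divide_less_imp_less_mult: "0 < (y::real) \<Longrightarrow> x / y < c \<Longrightarrow> x \<le> c * y"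
  by (simp add: pos_divide_less_eq)

lemma less_divide_imp_mult_less: "0 < (y::real) \<Longrightarrow> c < x / y \<Longrightarrow> c * y \<le> x"
  by (simp add: pos_less_divide_eq)

theorem theorem1:
  fixes f g Q F :: "complex \<Rightarrow> complex" and p q m n \<alpha> :: nat
  assumes "transcendental_meromorphic f"
    and "g holomorphic_on UNIV"
    and "1 \<le> q" and "q \<le> p" and "1 \<le> n" and "n \<le> m"
    and "entire_order m n g < mero_lower_order p q f"
    and "mero_lower_order p q f \<le> mero_order p q f"
    and "mero_order p q f < \<infinity>"
    and "diff_polynomial f Q"
    and "1 \<le> \<alpha>"
    and "F = (\<lambda>z. f z ^ \<alpha> * Q z)"
  shows "(m \<le> q \<longrightarrow>
            ((\<lambda>r. iter_log (int p - 1) (nevanlinna_T (f \<circ> g) (iter_exp (n - 1) r)) /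
                  iter_log (int p - 2) (nevanlinna_T F (iter_exp (q - 1) r))) \<longlongrightarrow> 0) at_top) \<and>
         (q < m \<longrightarrow>
            ((\<lambda>r. iter_log (int p + int m - int q - 2)
                    (nevanlinna_T (f \<circ> g) (iter_exp (n - 1) r)) /
                  iter_log (int p - 2) (nevanlinna_T F (iter_exp (q - 1) r))) \<longlongrightarrow> 0) at_top)"
proof -
  let ?T = "nevanlinna_T f" and ?M = "max_modulus g"
  note f = assms(1) and g = assms(2) and q = assms(3) and n = assms(5)
  note nf = transcendental_nzmero(2)[OF f]
  have p1: "1 \<le> p" using assms by simp
  have ip1: "iter_log (int p - 1) = (ln ^^ (p - 1))" using iter_log_of_nat[of "p - 1"] p1 by (simp add: of_nat_diff)
  have lgpos: "eventually (\<lambda>r::real. 1 \<le> (ln ^^ k) r) at_top" for k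
    using filterlim_at_top[THEN iffD1, OF filterlim_lg[of k], rule_format, of 1] .

  obtain C0' where "mero_order p q f < ereal (real C0')" using assms(9) less_PInf_Ex_of_nat[of "mero_order p q f"] by auto
  then have "eventually (\<lambda>r. ereal ((ln ^^ (p - 1)) (?T r) / (ln ^^ q) r) < ereal (real C0')) at_top"
    unfolding mero_order_def ip1 iter_log_of_nat by (rule Limsup_lessD)
  then have up0: "eventually (\<lambda>r. (ln ^^ (p - 1)) (?T r) \<le> real C0' * (ln ^^ q) r) at_top"
    using lgpos[of q] by eventually_elim (intro divide_less_imp_less_mult, auto)
  \<comment> \<open>Adding 1 makes the constant positive even if C0' is 0.\<close>
  define C0 where "C0 = real C0' + 1"
  have C0: "0 < C0" by (simp add: C0_def)
  have up: "eventually (\<lambda>r. (ln ^^ (p - 1)) (?T r) \<le> C0 * (ln ^^ q) r) at_top"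
    using up0 lgpos[of q] by eventually_elim (simp add: C0_def algebra_simps)
  have p2: "2 \<le> p"
  proof (rule ccontr)
    assume "\<not> 2 \<le> p"
    then have "p = 1" "q = 1" using p1 q assms(4) by auto
    then have "eventually (\<lambda>r. ?T r \<le> C0 * ln r) at_top" using up by simp
    moreover have "eventually (\<lambda>r. (C0 + 1) * ln r \<le> ?T r) at_top" by (rule transcendental_growth[OF f])
    moreover have "eventually (\<lambda>r::real. 1 \<le> ln r) at_top" using lgpos[of 1] by simp
    ultimately have "eventually (\<lambda>r::real. False) at_top" by eventually_elim (simp add: algebra_simps)
    then show False by simp
  qed
  define s where "s = p - 2"
  have ps: "p - 1 = Suc s" using p2 by (simp add: s_def)
  have ip2: "iter_log (int p - 2) = (ln ^^ s)" using iter_log_of_nat[of s] p2 by (simp add: s_def of_nat_diff)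

  obtain c where c: "entire_order m n g < ereal c" "ereal c < mero_lower_order p q f"
    using ereal_dense2[OF assms(7)] by blast
  obtain c' where c': "ereal c < ereal c'" "ereal c' < mero_lower_order p q f"
    using ereal_dense2[OF c(2)] by blast
  have cc: "c < c'" using c' by simp
  have "eventually (\<lambda>r. ereal c' < ereal ((ln ^^ (p - 1)) (?T r) / (ln ^^ q) r)) at_top"
    using c'(2) unfolding mero_lower_order_def ip1 iter_log_of_nat by (rule less_LiminfD)
  then have lo: "eventually (\<lambda>r. c' * (ln ^^ q) r \<le> (ln ^^ Suc s) (?T r)) at_top"
    using lgpos[of q] unfolding ps by eventually_elim (intro less_divide_imp_mult_less, auto)
  have "eventually (\<lambda>r. ereal ((ln ^^ m) (?M r) / (ln ^^ n) r) < ereal c) at_top"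
    using c(1) unfolding entire_order_def iter_log_of_nat by (rule Limsup_lessD)
  then have Mub: "eventually (\<lambda>r. (ln ^^ m) (?M r) \<le> c * (ln ^^ n) r) at_top"
    using lgpos[of n] by eventually_elim (intro divide_less_imp_less_mult, auto)
  have Einf: "filterlim (\<lambda>r. (exp ^^ k) (r::real)) at_top at_top" for k by (rule filterlim_iterated_exp)

  \<comment> \<open>For constant g, log^[m] M_g(r) is constant, and otherwise it is eventually at
    least 1; in neither case can it stay below c log^[n] r with c < 0. This makes c'
    positive.\<close>
  have c0: "0 \<le> c"
  proof (rule ccontr)
    assume neg: "\<not> 0 \<le> c"
    show False
    proof (cases "g constant_on UNIV")
      case True
      then obtain b where b: "\<And>z. g z = b" by (auto simp: constant_on_def)
      have Mc: "?M r = norm b" if "0 < r" for r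
      proof -
        have "sphere (0::complex) r \<noteq> {}" using that by simp
        then show ?thesis by (simp add: max_modulus_def b)
      qed
      have "filterlim (\<lambda>r. (- c) * (ln ^^ n) (r::real)) at_top at_top"
        using neg by (intro filterlim_tendsto_pos_mult_at_top[OF tendsto_const _ filterlim_lg]) auto
      then have "eventually (\<lambda>r. 1 - (ln ^^ m) (norm b) \<le> (- c) * (ln ^^ n) (r::real)) at_top"
        unfolding filterlim_at_top by blast
      then have "eventually (\<lambda>r::real. False) at_top" using Mub eventually_gt_at_top[of 0]
        by eventually_elim (simp add: Mc)
      then show False by simp
    next
      case False
      have "eventually (\<lambda>r. 1 \<le> (ln ^^ m) (?M r)) at_top"
        using eventually_compose_filterlim[OF lgpos[of m] max_modulus_at_top[OF g False]] .
      then have "eventually (\<lambda>r::real. False) at_top" using Mub lgpos[of n]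
      proof eventually_elim
        case (elim r)
        have "c * (ln ^^ n) r \<le> 0" using neg elim by (intro mult_nonpos_nonneg) auto
        then show ?case using elim by simp
      qed
      then show False by simp
    qed
  qed
  have c'0: "0 < c'" using c0 cc by simp

  let ?den = "\<lambda>r. (ln ^^ s) (nevanlinna_T F ((exp ^^ (q - 1)) r))"
  let ?X = "\<lambda>r. nevanlinna_T (f \<circ> g) ((exp ^^ (n - 1)) r)"

  show ?thesis
  proof (cases "nzmero F")
    case False
    have merF: "F meromorphic_on UNIV"
    proof -
      have mer: "(deriv ^^ j) f meromorphic_on UNIV" for j using nf by (auto simp: nzmero_def intro!: meromorphic_intros)
      obtain s' a M where Qd: "\<And>j. j \<in> {1..s'::nat} \<Longrightarrow> diff_monomial f (M j)" "Q = (\<lambda>z. \<Sum>j=1..s'. a j * M j z)"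
        using assms(10) unfolding diff_polynomial_def by blast
      have "M j meromorphic_on UNIV" if "j \<in> {1..s'}" for j
        using Qd(1)[OF that] unfolding diff_monomial_def by (auto intro!: meromorphic_on_prod meromorphic_on_power mer)
      then have "Q meromorphic_on UNIV" unfolding Qd(2) by (intro meromorphic_intros) auto
      then show ?thesis unfolding assms(12) using mer[of 0] by (auto intro!: meromorphic_intros)
    qed
    then have z: "\<forall>\<^sub>\<approx>z. F z = (\<lambda>_. 0) z" using nzmero_or_zero[OF merF] False by simp
    have T0: "nevanlinna_T F r = 0" if "0 < r" for r
      using nevanlinna_T_cong[OF z that] nevanlinna_const(3)[of 0 r] by (simp add: log_plus_def)
    have ln0: "(ln ^^ k) (0::real) = 0" for k by (induction k) auto
    have "eventually (\<lambda>r. 0 < (exp ^^ (q - 1)) (r::real)) at_top"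
      using filterlim_at_top[THEN iffD1, OF Einf[of "q - 1"], rule_format, of 1] by eventually_elim simp
    then have "eventually (\<lambda>r. N r / ?den r = 0) at_top" for N :: "real \<Rightarrow> real"
      by eventually_elim (simp add: T0 ln0)
    then have Z: "((\<lambda>r. N r / ?den r) \<longlongrightarrow> 0) at_top" for N :: "real \<Rightarrow> real" by (rule tendsto_eventually)
    show ?thesis unfolding ip2 iter_exp_def by (intro conjI impI Z)
  next
    case nF: True
    have sl: "slow f f" by (rule slow_self[OF f q C0 c'0 up[unfolded ps] lo])
    have TF: "eventually (\<lambda>r. ?T r \<le> 2 * nevanlinna_T F r) at_top"
      by (rule nevanlinna_T_diff_polynomial_ge[OF f sl assms(10,11,12) nF])
    have TFinf: "filterlim (nevanlinna_T F) at_top at_top"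
    proof -
      have "filterlim (\<lambda>r. (1/2) * ?T r) at_top at_top"
        by (intro filterlim_tendsto_pos_mult_at_top[OF tendsto_const _ transcendental_T_at_top[OF f]]) auto
      then show ?thesis by (rule filterlim_at_top_mono) (use TF in \<open>auto elim: eventually_mono\<close>)
    qed
    obtain D where D: "D \<ge> 1" "eventually (\<lambda>x. (ln ^^ s) (2 * x) \<le> D * (ln ^^ s) (x::real)) at_top"
      using lg_scale[of 2 s] by auto
    \<comment> \<open>Exponentiating the lower bound for log^[p-1] T_f once bounds log^[p-2] T_f
      from below by exp (c' log^[q] r); with exp^[q-1] r in place of r this is exp (c' ln
      r).\<close>
    have "eventually (\<lambda>r. exp (c' * (ln ^^ q) r) \<le> D * (ln ^^ s) (nevanlinna_T F r)) at_top"
      using lo TF eventually_compose_filterlim[OF D(2) TFinf] eventually_lg_ge[OF transcendental_T_at_top[OF f], of s]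
    proof eventually_elim
      case (elim r)
      have T1: "1 \<le> (ln ^^ s) (?T r)" by (rule lg_ge_one[OF elim(4)])
      have "exp (c' * (ln ^^ q) r) \<le> exp ((ln ^^ Suc s) (?T r))" using elim(1) by simp
      also have "\<dots> = (ln ^^ s) (?T r)" using T1 by simp
      also have "\<dots> \<le> (ln ^^ s) (2 * nevanlinna_T F r)" by (rule lg_mono[OF elim(4,2)])
      also have "\<dots> \<le> D * (ln ^^ s) (nevanlinna_T F r)" by (rule elim(3))
      finally show ?case .
    qed
    from eventually_compose_filterlim[OF this Einf[of "q - 1"]]
    have "eventually (\<lambda>r. exp (c' * ln r) \<le> D * ?den r) at_top" unfolding lg_iterated_exp_pred[OF q] .
    then have den: "eventually (\<lambda>r. r powr c' \<le> D * ?den r) at_top"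
      using eventually_gt_at_top[of 0] by eventually_elim (simp add: powr_def mult.commute)
    have D0: "0 < D" using D(1) by simp
    show ?thesis
    proof (cases "g constant_on UNIV")
      case True
      then obtain b where b: "\<And>z. g z = b" by (auto simp: constant_on_def)
      have "f \<circ> g = (\<lambda>_. f b)" by (auto simp: b)
      then have X: "?X r = log_plus (norm (f b))" for r by (simp add: nevanlinna_const)
      \<comment> \<open>The numerator is a constant, whatever value the iterated logarithm takes at
        it, and the denominator grows with the exponent c' > 0.\<close>
      have Z: "((\<lambda>r. h (?X r) / ?den r) \<longlongrightarrow> 0) at_top" for h :: "real \<Rightarrow> real"
      proof (rule quotient_tendsto_zero[OF _ den D0 c'0])
        show "eventually (\<lambda>r. \<bar>h (?X r)\<bar> \<le> \<bar>h (log_plus (norm (f b)))\<bar> * r powr 0) at_top"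
          unfolding X using eventually_gt_at_top[of 0] by eventually_elim simp
      qed
      show ?thesis unfolding ip2 iter_exp_def
        using Z[of "iter_log (int p - 1)"] Z[of "iter_log (int p + int m - int q - 2)"] by simp
    next
      case False
      note Minf = max_modulus_at_top[OF g False]
      have Xinf: "filterlim ?X at_top at_top"
        by (rule filterlim_compose[OF T_compose_at_top[OF f g False] Einf])
      obtain D1 where D1: "D1 \<ge> 1" "eventually (\<lambda>r. (ln ^^ Suc s) (nevanlinna_T (f \<circ> g) r) \<le> D1 * (ln ^^ q) (?M r)) at_top"
        using lg_T_compose_le[OF f g False q C0 up] unfolding ps by blast
      let ?N = "\<lambda>r. ?M ((exp ^^ (n - 1)) r)"
      have Ninf: "filterlim ?N at_top at_top" by (rule filterlim_compose[OF Minf Einf])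
      have Xle: "eventually (\<lambda>r. (ln ^^ Suc s) (?X r) \<le> D1 * (ln ^^ q) (?N r)) at_top"
        by (rule eventually_compose_filterlim[OF D1(2) Einf])
      have Nle: "eventually (\<lambda>r. (ln ^^ m) (?N r) \<le> c * ln r) at_top"
        using eventually_compose_filterlim[OF Mub Einf[of "n - 1"]] unfolding lg_iterated_exp_pred[OF n] .
      have X1: "eventually (\<lambda>r. 1 \<le> (ln ^^ k) (?X r)) at_top" for k
        by (rule eventually_compose_filterlim[OF lgpos Xinf])
      show ?thesis
      proof (intro conjI impI)
        assume mq: "m \<le> q"
        have lgN: "filterlim (\<lambda>r. (ln ^^ m) (?N r)) at_top at_top" by (rule filterlim_compose[OF filterlim_lg Ninf])
        \<comment> \<open>Since m <= q, the q - m additional logarithms only decrease log^[m] M_g,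
          so the numerator is O(ln r). The exponent c'/2 is positive and below c', whereas c may be
          0.\<close>
        have num: "eventually (\<lambda>r. \<bar>(ln ^^ Suc s) (?X r)\<bar> \<le> (D1 * c * (1 / (c'/2))) * r powr (c'/2)) at_top"
          using Xle Nle X1[of "Suc s"] eventually_lg_ge[OF lgN, of "q - m"] eventually_gt_at_top[of 0]
        proof eventually_elim
          case (elim r)
          have "(ln ^^ q) (?N r) = (ln ^^ (q - m)) ((ln ^^ m) (?N r))" using lg_add[of "q - m" m] mq by simp
          also have "\<dots> \<le> (ln ^^ m) (?N r)" by (rule lg_le_self[OF elim(4)])
          also have "\<dots> \<le> c * ln r" by (rule elim(2))
          also have "\<dots> \<le> c * ((1 / (c'/2)) * r powr (c'/2))" using c0 c'0 elim(5) by (intro mult_left_mono ln_le_powr) auto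
          finally have "D1 * (ln ^^ q) (?N r) \<le> D1 * (c * ((1 / (c'/2)) * r powr (c'/2)))" using D1(1) by (intro mult_left_mono) auto
          then show ?case using elim(1,3) by (simp add: mult.assoc)
        qed
        show "((\<lambda>r. iter_log (int p - 1) (nevanlinna_T (f \<circ> g) (iter_exp (n - 1) r)) /
                  iter_log (int p - 2) (nevanlinna_T F (iter_exp (q - 1) r))) \<longlongrightarrow> 0) at_top"
          unfolding ip1 ip2 iter_exp_def ps
          by (rule quotient_tendsto_zero[OF num den D0]) (use c'0 in simp)
      next
        assume qm: "q < m"
        \<comment> \<open>p + m - q - 2 = j + (p - 1), and j further logarithms turn log^[q] M_g
          into log^[m-1] M_g, which is exp (log^[m] M_g) and so at most r^c at the radius exp^[n-1]
          r.\<close>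
        define j where "j = m - q - 1"
        have "int p + int m - int q - 2 = int (j + Suc s)" using qm p2 by (simp add: j_def s_def of_nat_diff)
        then have ipm: "iter_log (int p + int m - int q - 2) = (ln ^^ (j + Suc s))" by (simp only: iter_log_of_nat)
        obtain D2 where D2: "D2 \<ge> 1" "eventually (\<lambda>x. (ln ^^ j) (D1 * x) \<le> D2 * (ln ^^ j) x) at_top"
          using lg_scale[OF D1(1)] by blast
        have lgN: "filterlim (\<lambda>r. (ln ^^ q) (?N r)) at_top at_top" by (rule filterlim_compose[OF filterlim_lg Ninf])
        have lgX: "filterlim (\<lambda>r. (ln ^^ Suc s) (?X r)) at_top at_top" by (rule filterlim_compose[OF filterlim_lg Xinf])
        have num: "eventually (\<lambda>r. \<bar>(ln ^^ (j + Suc s)) (?X r)\<bar> \<le> D2 * r powr c) at_top"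
          using Xle Nle X1[of "j + Suc s"] eventually_compose_filterlim[OF D2(2) lgN]
            eventually_lg_ge[OF lgX, of j] eventually_gt_at_top[of 0] eventually_compose_filterlim[OF lgpos[of "m - 1"] Ninf]
        proof eventually_elim
          case (elim r)
          have "(ln ^^ (j + Suc s)) (?X r) = (ln ^^ j) ((ln ^^ Suc s) (?X r))" by (rule lg_add)
          also have "\<dots> \<le> (ln ^^ j) (D1 * (ln ^^ q) (?N r))" by (rule lg_mono[OF elim(5,1)])
          also have "\<dots> \<le> D2 * (ln ^^ j) ((ln ^^ q) (?N r))" by (rule elim(4))
          also have "(ln ^^ j) ((ln ^^ q) (?N r)) = (ln ^^ (m - 1)) (?N r)" using lg_add[of j q "?N r"] qm by (simp add: j_def)
          also have "\<dots> = exp ((ln ^^ m) (?N r))"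
          proof -
            have "m = Suc (m - 1)" using qm by simp
            then have "(ln ^^ m) (?N r) = ln ((ln ^^ (m - 1)) (?N r))" by (metis comp_apply funpow.simps(2))
            then show ?thesis using elim(7) by simp
          qed
          also have "\<dots> \<le> exp (c * ln r)" using elim(2) by simp
          also have "\<dots> = r powr c" using elim(6) by (simp add: powr_def mult.commute)
          finally have "(ln ^^ (j + Suc s)) (?X r) \<le> D2 * r powr c" using D2(1) by (simp add: o_def)
          then show ?case using elim(3) by simp
        qed
        show "((\<lambda>r. iter_log (int p + int m - int q - 2) (nevanlinna_T (f \<circ> g) (iter_exp (n - 1) r)) /
                  iter_log (int p - 2) (nevanlinna_T F (iter_exp (q - 1) r))) \<longlongrightarrow> 0) at_top"
          unfolding ipm ip2 iter_exp_def
          by (rule quotient_tendsto_zero[OF num den D0 cc])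
      qed
    qed
  qed
qed

end
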